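(* Define \begin{align*} \vartheta_7(a_0,a_1,a_2,a_3,a_4,a_6)&:=\frac{1}{7J_7}\Big[a_0J_{21,49}^2+a_1qJ_{14,49}J_{21,49}+a_2q^2J_{14,49}^2\\ &\qquad+a_3q^3J_{7,49}J_{21,49}+a_4q^4J_{7,49}J_{14,49}+a_6q^6J_{7,49}^2\Big], \end{align*} \[ G_7(b_0,b_2,b_6):=b_0\big(1+q^7g(q^7;q^{49})\big)+b_2\,q^{16}g(q^{21};q^{49})+b_6\,q^{13}g(q^{14};q^{49}). \] Then \begin{align*} D(0,7)&=2\vartheta_7(-4,3,-1,2,1,-2)+2G_7(1,0,0),\\ D(1,7)=D(6,7)&=\vartheta_7(6,-1,5,-3,2,3)+G_7(-1,1,0),\\ D(2,7)=D(5,7)&=\vartheta_7(-1,-1,-2,4,-5,3)+G_7(0,-1,1),\\ D(3,7)=D(4,7)&=\vartheta_7(-1,-1,-2,-3,2,-4)+G_7(0,0,-1), \end{align*} and \begin{align*} D_C(0,7)&=2\vartheta_7(3,-4,-1,2,1,-2),\\ D_C(1,7)=D_C(6,7)&=\vartheta_7(-1,6,-2,-3,-5,3),\\ D_C(2,7)=D_C(5,7)&=\vartheta_7(-1,-1,5,-3,2,-4),\\ D_C(3,7)=D_C(4,7)&=\vartheta_7(-1,-1,-2,4,2,3). \end{align*}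
   Context: Throughout, $q$ is a complex number with $0<|q|<1$. Write $(x)_n=(x;q)_n=\prod_{i=0}^{n-1}(1-q^ix)$ and $(x)_\infty=(x;q)_\infty=\prod_{i\ge0}(1-q^ix)$. Let $j(x;q)=(x)_\infty(q/x)_\infty(q)_\infty=\sum_{n\in\mathbb Z}(-1)^nq^{\binom n2}x^n$. For integers $a$ and $m\ge1$: $J_{a,m}=j(q^a;q^m)$ and $J_m=J_{m,3m}=\prod_{i\ge1}(1-q^{mi})$. The universal mock theta function is $g(x;q)=x^{-1}\big(-1+\sum_{n\ge0}\frac{q^{n^2}}{(x)_{n+1}(q/x)_n}\big)$. Ranks: define integers $N(m,n)$ by $\sum_{n\ge0}\sum_{m\in\mathbb Z}N(m,n)z^mq^n=\sum_{n\ge0}\frac{q^{n^2}}{(zq)_n(z^{-1}q)_n}$ (for $n\ge1$, the number of partitions of $n$ with rank $=$ largest part minus number of parts equal to $m$; $N(m,0)=\delta_{m,0}$). Cranks: define integers $C(m,n)$ by $\sum_{n\ge0}\sum_{m\in\mathbb Z}C(m,n)z^mq^n=\prod_{n\ge1}\frac{1-q^n}{(1-zq^n)(1-z^{-1}q^n)}$ (for $n\ge2$, the number of partitions of $n$ with Andrews–Garvan crank $m$: largest part if there are no ones, otherwise (number of parts larger than the number of ones) minus (number of ones); for $n\le1$: $C(0,0)=1$, $C(\pm1,1)=1$, $C(0,1)=-1$, others $0$). For $M\ge1$ and integer $a$, $N(a,M;n)=\sum_{m\equiv a \pmod M}N(m,n)$, $C(a,M;n)=\sum_{m\equiv a\pmod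 M}C(m,n)$; $p(n)$ is the number of partitions of $n$ ($p(0)=1$). Deviations: $D(a,M)=\sum_{n\ge0}(N(a,M;n)-p(n)/M)q^n$ and $D_C(a,M)=\sum_{n\ge0}(C(a,M;n)-p(n)/M)q^n$. *)

theory Defs
  imports "HOL-Analysis.Analysis" "HOL-Library.Multiset"
begin

definition partitions :: "nat \<Rightarrow> nat multiset set" where
  "partitions n = {P. (\<forall>x\<in>#P. 0 < x) \<and> sum_mset P = n}"

definition npart :: "nat \<Rightarrow> nat" where
  "npart n = card (partitions n)"

definition rank :: "nat multiset \<Rightarrow> int" where
  "rank P = int (Max (set_mset P)) - int (size P)"

definition crank :: "nat multiset \<Rightarrow> int" where
  "crank P = (let w = count P 1 in
     if w = 0 then int (Max (set_mset P))
     else int (size (filter_mset (\<lambda>x. w < x) P)) - int w)"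

definition Nrk :: "int \<Rightarrow> nat \<Rightarrow> int" where
  "Nrk m n = (if n = 0 then (if m = 0 then 1 else 0)
              else int (card {P \<in> partitions n. rank P = m}))"

definition Ccr :: "int \<Rightarrow> nat \<Rightarrow> int" where
  "Ccr m n = (if n = 0 then (if m = 0 then 1 else 0)
              else if n = 1 then (if m = 1 \<or> m = -1 then 1 else if m = 0 then -1 else 0)
              else int (card {P \<in> partitions n. crank P = m}))"

(* N(a,M;n) = sum_{m = a mod M} N(m,n)  (finitely supported sum) *)
definition NrkMod :: "int \<Rightarrow> int \<Rightarrow> nat \<Rightarrow> int" where
  "NrkMod a M n = (\<Sum>m \<in> {m. m mod M = a mod M \<and> Nrk m n \<noteq> 0}. Nrk m n)"

definition CcrMod :: "int \<Rightarrow> int \<Rightarrow> nat \<Rightarrow> int" where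
  "CcrMod a M n = (\<Sum>m \<in> {m. m mod M = a mod M \<and> Ccr m n \<noteq> 0}. Ccr m n)"

definition Dev :: "int \<Rightarrow> int \<Rightarrow> complex \<Rightarrow> complex" where
  "Dev a M q = (\<Sum>n. (of_int (NrkMod a M n) - of_nat (npart n) / of_int M) * q ^ n)"

definition DevC :: "int \<Rightarrow> int \<Rightarrow> complex \<Rightarrow> complex" where
  "DevC a M q = (\<Sum>n. (of_int (CcrMod a M n) - of_nat (npart n) / of_int M) * q ^ n)"

definition qpoch :: "complex \<Rightarrow> complex \<Rightarrow> nat \<Rightarrow> complex" where
  "qpoch x q n = (\<Prod>i<n. 1 - q ^ i * x)"

definition qpoch_inf :: "complex \<Rightarrow> complex \<Rightarrow> complex" where
  "qpoch_inf x q = (\<Prod>i. 1 - q ^ i * x)"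

definition jfun :: "complex \<Rightarrow> complex \<Rightarrow> complex" where
  "jfun x q = qpoch_inf x q * qpoch_inf (q / x) q * qpoch_inf q q"

definition Jam :: "nat \<Rightarrow> nat \<Rightarrow> complex \<Rightarrow> complex" where
  "Jam a m q = jfun (q ^ a) (q ^ m)"

definition Jm :: "nat \<Rightarrow> complex \<Rightarrow> complex" where
  "Jm m q = qpoch_inf (q ^ m) (q ^ m)"

definition gmock :: "complex \<Rightarrow> complex \<Rightarrow> complex" where
  "gmock x q = inverse x * (-1 + (\<Sum>n. q ^ (n^2) / (qpoch x q (n + 1) * qpoch (q / x) q n)))"

definition theta7 :: "complex \<Rightarrow> complex \<Rightarrow> complex \<Rightarrow> complex \<Rightarrow> complex \<Rightarrow> complex \<Rightarrow> complex \<Rightarrow> complex" where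
  "theta7 a0 a1 a2 a3 a4 a6 q =
     1 / (7 * Jm 7 q) *
     (a0 * Jam 21 49 q ^ 2 + a1 * q * Jam 14 49 q * Jam 21 49 q + a2 * q ^ 2 * Jam 14 49 q ^ 2
      + a3 * q ^ 3 * Jam 7 49 q * Jam 21 49 q + a4 * q ^ 4 * Jam 7 49 q * Jam 14 49 q
      + a6 * q ^ 6 * Jam 7 49 q ^ 2)"

definition G7 :: "complex \<Rightarrow> complex \<Rightarrow> complex \<Rightarrow> complex \<Rightarrow> complex" where
  "G7 b0 b2 b6 q =
     b0 * (1 + q ^ 7 * gmock (q ^ 7) (q ^ 49)) + b2 * q ^ 16 * gmock (q ^ 21) (q ^ 49)
     + b6 * q ^ 13 * gmock (q ^ 14) (q ^ 49)"

end

theory Submission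
  imports Defs "HOL-Complex_Analysis.Complex_Analysis"
begin

text \<open>Both deviations are recovered from their discrete Fourier transforms in the residue \<open>a\<close>,
  that is, from the rank and crank generating functions at the seventh roots of unity \<open>z\<close>; at
  \<open>z = 1\<close> the transform vanishes because of the subtracted \<open>p(n)/7\<close>.

  For \<open>z \<noteq> 1\<close> the product \<open>(q)\<^sub>\<infinity> / ((zq)\<^sub>\<infinity> (q/z)\<^sub>\<infinity>)\<close> is, up to elementary factors and \<open>J\<^sub>7\<close>, the product of the
  theta functions at \<open>z\<^sup>2\<close> and \<open>z\<^sup>3\<close>, each of which is dissected modulo \<open>7\<close> by splitting
  its theta series. The rank generating function is a Lambert series divided by \<open>(q)\<^sub>\<infinity>\<close>.
  Splitting its summation index modulo \<open>7\<close> leads to Lambert series of level three with nome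
  \<open>q\<^sup>4\<^sup>9\<close>, which Liouville's theorem relates to each other through a three-term identity;
  the part of this relation that remains finite when two of the arguments collide produces
  logarithmic derivatives of theta functions, and the Weierstrass relation evaluates those as
  quotients of \<open>J\<^sub>7\<^sub>,\<^sub>4\<^sub>9\<close>, \<open>J\<^sub>1\<^sub>4\<^sub>,\<^sub>4\<^sub>9\<close>, \<open>J\<^sub>2\<^sub>1\<^sub>,\<^sub>4\<^sub>9\<close>. What is left of the Lambert series are the universal mock
  theta functions in \<open>G\<^sub>7\<close>.\<close>

section \<open>The Jacobi triple product\<close>

text \<open>Why g enters with a mere power of q as coefficient: the residues k and -k combine into
  one and the same series \<open>lambert3 1\<close> at q^(7a), with coefficient
  \<open>kap k\<close>. By the quintuple product the dissection of (q)_inf has exactly these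
  coefficients, so their total is (q)_inf / (q^49;q^49)_inf up to sign and a power of q. Its
  numerator cancels the division by (q)_inf in the rank series, its denominator is the one in g. The
  obstacle is the remainder. The pair with k = a is singular and leaves logarithmic derivatives, and
  these have to be matched with quadratic forms in only three theta functions. The three satisfy
  Klein's quartic relation \<open>klein_relation\<close>, modulo which the matching is a polynomial
  identity. The sevenths: as 1 + z + ... + z^6 = 0, the values at z \<noteq> 1 fix the seven
  deviations only up to a common summand. The value at z = 1 selects the solution with total 0,
  which is where the factor 1/7 comes from; the constants 3/7, 2/7, 1/7 in
  \<open>rank_sum_theta7\<close> drop out at z \<noteq> 1 for the same reason.\<close>

lemma infsum_tendsto_dominated:
  fixes f :: "nat \<Rightarrow> 'a \<Rightarrow> 'c :: banach"
  assumes bound: "\<And>n k. k \<in> A \<Longrightarrow> norm (f n k) \<le> M k"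
    and M: "M summable_on A"
    and lim: "\<And>k. k \<in> A \<Longrightarrow> (\<lambda>n. f n k) \<longlonglongrightarrow> g k"
  shows "(\<lambda>n. infsum (f n) A) \<longlonglongrightarrow> infsum g A"
proof -
  have g: "norm (g k) \<le> M k" if "k \<in> A" for k
    by (rule tendsto_upperbound[OF tendsto_norm[OF lim[OF that]]]) (use bound that in auto)
  have gs: "g summable_on A"
    by (rule abs_summable_summable, rule Infinite_Sum.abs_summable_on_comparison_test'[OF M g])
  have ul: "uniform_limit UNIV (\<lambda>X n. \<Sum>k\<in>X. f n k) (\<lambda>n. infsum (f n) A) (finite_subsets_at_top A)"
    by (rule Weierstrass_m_test_general[OF bound M]) auto
  show ?thesis
  proof (rule swap_uniform_limit'[OF _ _ ul])
    show "\<forall>\<^sub>F X in finite_subsets_at_top A. ((\<lambda>n. \<Sum>k\<in>X. f n k) \<longlongrightarrow> (\<Sum>k\<in>X. g k)) sequentially"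
      by (rule eventually_finite_subsets_at_top_weakI) (auto intro!: tendsto_sum lim)
    show "((\<lambda>X. \<Sum>k\<in>X. g k) \<longlongrightarrow> infsum g A) (finite_subsets_at_top A)"
      using gs infsum_tendsto by blast
  qed auto
qed

section \<open>Theta series terms and reciprocals of (q)_n, indexed by all integers\<close>

definition tri :: "int \<Rightarrow> int" where "tri n = n * (n - 1) div 2"

lemma two_tri: "2 * tri n = n * (n - 1)"
proof -
  have "even (n * (n - 1))" by auto
  then show ?thesis by (simp add: tri_def)
qed

lemma tri_eqI: "2 * m = n * (n - 1) \<Longrightarrow> tri n = m"
  using two_tri[of n] by simp

lemma tri_simps [simp]: "tri 0 = 0" "tri 1 = 0"
  by (auto intro: tri_eqI)

lemma tri_add: "tri (m + n) = tri m + tri n + m * n"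
  by (rule tri_eqI) (use two_tri[of m] two_tri[of n] in \<open>simp add: algebra_simps\<close>)

lemma tri_Suc: "tri (n + 1) = tri n + n"
  by (simp add: tri_add)

lemma tri_minus: "tri (- n) = tri n + n"
  by (rule tri_eqI) (use two_tri[of n] in \<open>simp add: algebra_simps\<close>)

definition gterm :: "complex \<Rightarrow> complex \<Rightarrow> int \<Rightarrow> complex" where
  "gterm x q n = x powi n * q powi tri n"

text \<open>Extending 1/(q)_m by zero keeps the recurrence \<open>rq_rec\<close> valid for every
  integer, so finite sums can run over all integers and be shifted without boundary terms.\<close>

definition rq :: "complex \<Rightarrow> int \<Rightarrow> complex" where
  "rq q m = (if m < 0 then 0 else inverse (qpoch q q (nat m)))"

lemma qpoch_0 [simp]: "qpoch x q 0 = 1"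
  by (simp add: qpoch_def)

lemma qpoch_Suc: "qpoch x q (Suc n) = qpoch x q n * (1 - q ^ n * x)"
  by (simp add: qpoch_def)

lemma qpoch_Suc_left: "qpoch x q (Suc n) = (1 - x) * qpoch (q * x) q n"
  unfolding qpoch_def prod.lessThan_Suc_shift by (simp add: mult_ac)

lemma summable_gauss:
  fixes X p :: real
  assumes "0 \<le> p" "p < 1" "0 \<le> X"
  shows "summable (\<lambda>n. X ^ n * p ^ (n * (n - 1) div 2))"
proof -
  have "(\<lambda>n. X * p ^ n) \<longlonglongrightarrow> X * 0"
    using assms by (intro tendsto_intros LIMSEQ_power_zero) auto
  then have "\<forall>\<^sub>F n in sequentially. X * p ^ n < 1 / 2"
    by (intro order_tendstoD) auto
  then obtain N where N: "X * p ^ n < 1 / 2" if "n \<ge> N" for n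
    by (auto simp: eventually_sequentially)
  show ?thesis
  proof (rule summable_ratio_test[of "1/2" N])
    fix n assume n: "N \<le> n"
    have e: "Suc n * (Suc n - 1) div 2 = n * (n - 1) div 2 + n"
      by (cases n) (auto simp: algebra_simps)
    have "norm (X ^ Suc n * p ^ (Suc n * (Suc n - 1) div 2)) = (X * p ^ n) * (X ^ n * p ^ (n * (n - 1) div 2))"
      using assms unfolding e by (simp add: power_add abs_mult mult_ac)
    also have "\<dots> \<le> 1 / 2 * (X ^ n * p ^ (n * (n - 1) div 2))"
      using N[OF n] assms by (intro mult_right_mono) auto
    finally show "norm (X ^ Suc n * p ^ (Suc n * (Suc n - 1) div 2)) \<le> 1/2 * norm (X ^ n * p ^ (n * (n - 1) div 2))"
      using assms by simp
  qed auto
qed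

lemma summable_on_int_iff:
  fixes f :: "int \<Rightarrow> 'a :: {topological_comm_monoid_add, t2_space}"
  assumes "(\<lambda>n. f (int n)) summable_on UNIV" "(\<lambda>n. f (- int n - 1)) summable_on UNIV"
  shows "f summable_on UNIV"
proof -
  have "f summable_on range int"
    by (subst summable_on_reindex) (use assms in \<open>auto simp: o_def\<close>)
  moreover have "f summable_on range (\<lambda>n. - int n - 1)"
    by (subst summable_on_reindex) (use assms in \<open>auto simp: o_def inj_on_def\<close>)
  moreover have "n \<in> range int \<union> range (\<lambda>n. - int n - 1)" for n :: int
    by (cases "n \<ge> 0") (auto intro: image_eqI[of _ _ "nat n"] image_eqI[of _ _ "nat (-n-1)"])
  then have "range int \<union> range (\<lambda>n. - int n - 1) = UNIV" by auto
  ultimately show ?thesis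
    by (subst \<open>_ = UNIV\<close>[symmetric], intro summable_on_Un_disjoint) auto
qed

lemma tri_of_nat: "tri (int n) = int (n * (n - 1) div 2)"
  by (cases n) (auto simp: tri_def zdiv_int algebra_simps)

locale nome =
  fixes q :: complex
  assumes q_nz [simp]: "q \<noteq> 0" and norm_q: "norm q < 1"
begin

lemma gterm_summable_norm:
  assumes "x \<noteq> 0"
  shows "(\<lambda>n. norm (gterm x q n)) summable_on UNIV"
proof (rule summable_on_int_iff)
  let ?X = "norm x" and ?p = "norm q"
  have "summable (\<lambda>n. ?X ^ n * ?p ^ (n * (n - 1) div 2))"
    by (rule summable_gauss) (use norm_q in auto)
  moreover have "norm (gterm x q (int n)) = ?X ^ n * ?p ^ (n * (n - 1) div 2)" for n
    unfolding gterm_def tri_of_nat by (simp add: norm_mult norm_power norm_power_int)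
  ultimately show "(\<lambda>n. norm (gterm x q (int n))) summable_on UNIV"
    by (intro summable_nonneg_imp_summable_on) auto
  have "summable (\<lambda>n. (?p / ?X) ^ n * ?p ^ (n * (n - 1) div 2))"
    by (rule summable_gauss) (use norm_q in auto)
  then have "summable (\<lambda>n. (?p / ?X) * ((?p / ?X) ^ n * ?p ^ (n * (n - 1) div 2) * ?p ^ n))"
    apply (intro summable_mult)
    apply (rule summable_comparison_test'[of _ 0], assumption)
    using norm_q by (simp add: mult_left_le power_le_one)
  moreover have "norm (gterm x q (- int n - 1)) = (?p / ?X) * ((?p / ?X) ^ n * ?p ^ (n * (n - 1) div 2) * ?p ^ n)" for n
  proof -
    have "tri (- int n - 1) = tri (int n) + int n + int n + 1"
      by (rule tri_eqI) (use two_tri[of "int n"] in \<open>simp add: algebra_simps\<close>)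
    then have t: "tri (- int n - 1) = int (n * (n - 1) div 2 + n + n + 1)"
      by (simp add: tri_of_nat)
    have "- int n - 1 = - int (Suc n)" by simp
    then have xp: "x powi (- int n - 1) = inverse (x ^ Suc n)"
      by (simp only: power_int_minus power_int_of_nat)
    show ?thesis
      unfolding gterm_def t xp power_int_of_nat using assms
      by (simp add: norm_mult norm_power norm_inverse power_add power_divide) (simp add: field_simps)
  qed
  ultimately show "(\<lambda>n. norm (gterm x q (- int n - 1))) summable_on UNIV"
    using assms by (intro summable_nonneg_imp_summable_on) auto
qed

lemma gterm_summable:
  assumes "x \<noteq> 0"
  shows "gterm x q summable_on UNIV"
  using gterm_summable_norm[OF assms] abs_summable_summable by blast

lemma gterm_0 [simp]: "gterm x q 0 = 1"
  by (simp add: gterm_def)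

lemma gterm_Suc: "x \<noteq> 0 \<Longrightarrow> gterm x q (n + 1) = x * q powi n * gterm x q n"
  by (simp add: gterm_def tri_Suc power_int_add)

lemma power_neq_1: "n > 0 \<Longrightarrow> q ^ n \<noteq> 1"
  using norm_q norm_power[of q n] power_less_one_iff[of "norm q" n] by force

lemma powi_eq_1_iff: "q powi n = 1 \<longleftrightarrow> n = 0"
proof
  assume *: "q powi n = 1"
  show "n = 0"
  proof (rule ccontr)
    assume "n \<noteq> 0"
    then have "q ^ nat \<bar>n\<bar> = 1"
      using * by (cases "n \<ge> 0") (auto simp: power_int_def power_inverse split: if_splits)
    then show False using power_neq_1[of "nat \<bar>n\<bar>"] \<open>n \<noteq> 0\<close> by simp
  qed
qed simp

lemma qpoch_q_nz [simp]: "qpoch q q n \<noteq> 0"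
  using power_neq_1[of "Suc _"] by (auto simp: qpoch_def mult.commute)

lemma rq_rec: "(1 - q powi m) * rq q m = rq q (m - 1)"
proof (cases "m > 0")
  case True
  then obtain n where m: "m = int (Suc n)"
    by (cases m) (auto simp: gr0_conv_Suc)
  have "1 - q ^ Suc n \<noteq> 0" using power_neq_1[of "Suc n"] by auto
  then show ?thesis
    unfolding m rq_def using qpoch_q_nz[of n] by (simp add: qpoch_Suc nat_add_distrib power_int_add field_simps)
next
  case False
  then show ?thesis by (cases "m = 0") (auto simp: rq_def)
qed

lemma rq_0 [simp]: "rq q 0 = 1"
  by (simp add: rq_def)

lemma rq_neg: "m < 0 \<Longrightarrow> rq q m = 0"
  by (simp add: rq_def)

lemma conv_prod: "convergent_prod (\<lambda>i. 1 - q ^ i * x)"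
proof (rule abs_convergent_prod_imp_convergent_prod)
  have "summable (\<lambda>i. norm x * norm q ^ i)"
    using norm_q by (intro summable_mult summable_geometric) auto
  then have "summable (\<lambda>i. norm ((1 - q ^ i * x) - 1))"
    by (simp add: norm_mult norm_power mult.commute)
  then show "abs_convergent_prod (\<lambda>i. 1 - q ^ i * x)"
    by (rule summable_imp_abs_convergent_prod)
qed

lemma qpoch_tendsto: "(\<lambda>n. qpoch x q n) \<longlonglongrightarrow> qpoch_inf x q"
  using convergent_prod_LIMSEQ[OF conv_prod[of x]]
  unfolding qpoch_def qpoch_inf_def by (rule LIMSEQ_lessThan_iff_atMost[THEN iffD2])

lemma qpoch_inf_unfold: "qpoch_inf x q = (1 - x) * qpoch_inf (q * x) q"
proof (rule LIMSEQ_unique)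
  show "(\<lambda>n. qpoch x q (Suc n)) \<longlonglongrightarrow> qpoch_inf x q"
    using qpoch_tendsto by (rule LIMSEQ_Suc)
  show "(\<lambda>n. qpoch x q (Suc n)) \<longlonglongrightarrow> (1 - x) * qpoch_inf (q * x) q"
    unfolding qpoch_Suc_left by (intro tendsto_intros qpoch_tendsto)
qed

lemma qpoch_inf_eq_0_iff: "qpoch_inf x q = 0 \<longleftrightarrow> (\<exists>i. q ^ i * x = 1)"
proof -
  have "(\<lambda>i. 1 - q ^ i * x) has_prod qpoch_inf x q"
    unfolding qpoch_inf_def using conv_prod by (simp add: convergent_prod_has_prod)
  then show ?thesis by (auto simp: has_prod_eq_0_iff)
qed

lemma qpoch_inf_q_nz [simp]: "qpoch_inf q q \<noteq> 0"
  using power_neq_1[of "Suc _"] by (auto simp: qpoch_inf_eq_0_iff mult.commute)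

lemma rq_tendsto: "(\<lambda>n. rq q (int n + c)) \<longlonglongrightarrow> inverse (qpoch_inf q q)"
proof -
  have "filterlim (\<lambda>n. nat (int n + c)) at_top sequentially"
    unfolding filterlim_at_top eventually_sequentially
  proof
    fix Z :: nat
    show "\<exists>N. \<forall>n\<ge>N. Z \<le> nat (int n + c)" by (rule exI[of _ "nat (int Z - c)"]) auto
  qed
  then have "(\<lambda>n. inverse (qpoch q q (nat (int n + c)))) \<longlonglongrightarrow> inverse (qpoch_inf q q)"
    by (intro tendsto_inverse filterlim_compose[OF qpoch_tendsto] qpoch_inf_q_nz)
  then show ?thesis
    by (rule Lim_transform_eventually)
       (auto simp: rq_def eventually_sequentially intro!: exI[of _ "nat (- c)"])
qed

lemma rq_bounded: obtains C where "C > 0" "\<And>m. norm (rq q m) \<le> C"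
proof -
  have "Bseq (\<lambda>n. rq q (int n + 0))"
    by (rule convergent_imp_Bseq) (use rq_tendsto[of 0] in \<open>auto simp: convergent_def\<close>)
  then obtain K where "K > 0" "\<And>n. norm (rq q (int n)) \<le> K"
    by (auto simp: Bseq_def)
  moreover have "norm (rq q m) \<le> K" for m
    using calculation by (cases "m \<ge> 0") (auto simp: rq_neg elim!: nonneg_int_cases)
  ultimately show ?thesis using that by blast
qed

text \<open>Since \<open>rq q m = 0\<close> for negative \<open>m\<close>, the sum below is finite; for \<open>m = n\<close> it is the
  finite form of the triple product, and unlike that special case it can be
  reduced in each of the two parameters separately.\<close>

definition fjtp :: "complex \<Rightarrow> int \<Rightarrow> int \<Rightarrow> complex" where
  "fjtp x m n = (\<Sum>\<^sub>\<infinity>k. gterm (- x) q k * rq q (m - k) * rq q (n + k))"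

lemma rq_prod_summable: "(\<lambda>k. f k * rq q (m - k) * rq q (n + k)) summable_on UNIV"
proof (rule finite_nonzero_values_imp_summable_on)
  have "{k. f k * rq q (m - k) * rq q (n + k) \<noteq> 0} \<subseteq> {- n..m}"
    by (auto simp: rq_def split: if_splits)
  then show "finite {k \<in> UNIV. f k * rq q (m - k) * rq q (n + k) \<noteq> 0}"
    using finite_subset by auto
qed

lemma infsum_shift:
  fixes f :: "int \<Rightarrow> complex"
  shows "(\<Sum>\<^sub>\<infinity>k. f (k + c)) = (\<Sum>\<^sub>\<infinity>k. f k)"
  by (rule infsum_reindex_bij_betw) (rule bij_betwI[of _ _ _ "\<lambda>k. k - c"], auto)

text \<open>Split 1 - q^(m+n) = (1 - q^(m-k)) + q^(m-k) (1 - q^(n+k)). Each part lowers the index of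
  one factor \<open>rq\<close>, and shifting k by one makes the second sum a multiple of the
  first.\<close>

lemma fjtp_rec1:
  assumes "x \<noteq> 0"
  shows "(1 - q powi (m + n)) * fjtp x m n = (1 - x * q powi (m - 1)) * fjtp x (m - 1) n"
proof -
  let ?g = "gterm (- x) q"
  have "(1 - q powi (m + n)) * fjtp x m n =
     (\<Sum>\<^sub>\<infinity>k. (1 - q powi (m + n)) * (?g k * rq q (m - k) * rq q (n + k)))"
    unfolding fjtp_def by (simp add: infsum_cmult_right')
  also have "\<dots> = (\<Sum>\<^sub>\<infinity>k. ?g k * rq q (m - 1 - k) * rq q (n + k)
       + (?g k * q powi (m - k)) * rq q (m - k) * rq q (n - 1 + k))"
  proof (rule infsum_cong)
    fix k :: int
    have 1: "1 - q powi (m + n) = (1 - q powi (m - k)) + q powi (m - k) * (1 - q powi (n + k))"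
      by (simp add: power_int_add power_int_diff field_simps)
    have 2: "rq q (m - 1 - k) = (1 - q powi (m - k)) * rq q (m - k)"
      using rq_rec[of "m - k"] by (simp add: algebra_simps)
    have 3: "rq q (n - 1 + k) = (1 - q powi (n + k)) * rq q (n + k)"
      using rq_rec[of "n + k"] by (simp add: algebra_simps)
    show "(1 - q powi (m + n)) * (?g k * rq q (m - k) * rq q (n + k)) =
      ?g k * rq q (m - 1 - k) * rq q (n + k) + (?g k * q powi (m - k)) * rq q (m - k) * rq q (n - 1 + k)"
      unfolding 1 2 3 by (simp add: algebra_simps)
  qed
  also have "\<dots> = fjtp x (m - 1) n + (\<Sum>\<^sub>\<infinity>k. (?g k * q powi (m - k)) * rq q (m - k) * rq q (n - 1 + k))"
    unfolding fjtp_def by (rule infsum_add) (rule rq_prod_summable)+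
  also have "(\<Sum>\<^sub>\<infinity>k. (?g k * q powi (m - k)) * rq q (m - k) * rq q (n - 1 + k))
     = (\<Sum>\<^sub>\<infinity>k. (?g (k + 1) * q powi (m - (k + 1))) * rq q (m - (k + 1)) * rq q (n - 1 + (k + 1)))"
    by (rule infsum_shift[symmetric])
  also have "\<dots> = (\<Sum>\<^sub>\<infinity>k. - x * q powi (m - 1) * (?g k * rq q (m - 1 - k) * rq q (n + k)))"
    using assms by (intro infsum_cong) (simp add: gterm_Suc power_int_diff power_int_add field_simps)
  also have "\<dots> = - x * q powi (m - 1) * fjtp x (m - 1) n"
    unfolding fjtp_def by (rule infsum_cmult_right')
  finally show ?thesis by (simp add: algebra_simps)
qed

text \<open>The opposite splitting, 1 - q^(n+k) plus q^(n+k) (1 - q^(m-k)). After a shift of k both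
  parts are multiples of one auxiliary sum, with factors -x q^(-n) and 1; the first part alone is
  \<open>fjtp x m (n - 1)\<close>, which eliminates that sum.\<close>

lemma fjtp_rec2:
  assumes "x \<noteq> 0"
  shows "(1 - q powi (m + n)) * fjtp x m n = (1 - q powi n / x) * fjtp x m (n - 1)"
proof -
  let ?g = "gterm (- x) q"
  have "(1 - q powi (m + n)) * fjtp x m n =
     (\<Sum>\<^sub>\<infinity>k. (1 - q powi (m + n)) * (?g k * rq q (m - k) * rq q (n + k)))"
    unfolding fjtp_def by (simp add: infsum_cmult_right')
  also have "\<dots> = (\<Sum>\<^sub>\<infinity>k. ?g k * rq q (m - k) * rq q (n - 1 + k)
       + (?g k * q powi (n + k)) * rq q (m - 1 - k) * rq q (n + k))"
  proof (rule infsum_cong)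
    fix k :: int
    have 1: "1 - q powi (m + n) = (1 - q powi (n + k)) + q powi (n + k) * (1 - q powi (m - k))"
      by (simp add: power_int_add power_int_diff field_simps)
    have 2: "rq q (m - 1 - k) = (1 - q powi (m - k)) * rq q (m - k)"
      using rq_rec[of "m - k"] by (simp add: algebra_simps)
    have 3: "rq q (n - 1 + k) = (1 - q powi (n + k)) * rq q (n + k)"
      using rq_rec[of "n + k"] by (simp add: algebra_simps)
    show "(1 - q powi (m + n)) * (?g k * rq q (m - k) * rq q (n + k)) =
      ?g k * rq q (m - k) * rq q (n - 1 + k) + (?g k * q powi (n + k)) * rq q (m - 1 - k) * rq q (n + k)"
      unfolding 1 2 3 by (simp add: algebra_simps)
  qed
  also have "\<dots> = fjtp x m (n - 1) + (\<Sum>\<^sub>\<infinity>k. (?g k * q powi (n + k)) * rq q (m - 1 - k) * rq q (n + k))"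
    unfolding fjtp_def by (rule infsum_add) (rule rq_prod_summable)+
  also have "fjtp x m (n - 1) = (\<Sum>\<^sub>\<infinity>k. ?g (k + 1) * rq q (m - (k + 1)) * rq q (n - 1 + (k + 1)))"
    unfolding fjtp_def by (rule infsum_shift[symmetric])
  also have "\<dots> = (\<Sum>\<^sub>\<infinity>k. - x * q powi (- n) * ((?g k * q powi (n + k)) * rq q (m - 1 - k) * rq q (n + k)))"
    using assms by (intro infsum_cong) (simp add: gterm_Suc power_int_minus power_int_add field_simps)
  also have "\<dots> = - x * q powi (- n) * (\<Sum>\<^sub>\<infinity>k. (?g k * q powi (n + k)) * rq q (m - 1 - k) * rq q (n + k))"
    by (rule infsum_cmult_right')
  finally have *: "(1 - q powi (m + n)) * fjtp x m n = (- x * q powi (- n) + 1) * (\<Sum>\<^sub>\<infinity>k. (?g k * q powi (n + k)) * rq q (m - 1 - k) * rq q (n + k))"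
    by (simp add: algebra_simps)
  have "fjtp x m (n - 1) = (\<Sum>\<^sub>\<infinity>k. ?g (k + 1) * rq q (m - (k + 1)) * rq q (n - 1 + (k + 1)))"
    unfolding fjtp_def by (rule infsum_shift[symmetric])
  also have "\<dots> = (\<Sum>\<^sub>\<infinity>k. - x * q powi (- n) * ((?g k * q powi (n + k)) * rq q (m - 1 - k) * rq q (n + k)))"
    using assms by (intro infsum_cong) (simp add: gterm_Suc power_int_minus power_int_add field_simps)
  also have "\<dots> = - x * q powi (- n) * (\<Sum>\<^sub>\<infinity>k. (?g k * q powi (n + k)) * rq q (m - 1 - k) * rq q (n + k))"
    by (rule infsum_cmult_right')
  finally show ?thesis unfolding * using assms
    by (simp add: power_int_minus field_simps)
qed

text \<open>The recurrences lower n to 0 and then m to 0, where only the term k = 0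
  survives.\<close>

lemma fjtp_eq:
  assumes "x \<noteq> 0"
  shows "fjtp x (int m) (int n) = qpoch x q m * qpoch (q / x) q n * rq q (int (m + n))"
proof -
  have zero: "fjtp x (int m) 0 = qpoch x q m * rq q (int m)" for m
  proof (induction m)
    case 0
    have "fjtp x 0 0 = (\<Sum>\<^sub>\<infinity>k\<in>{0}. gterm (- x) q k * rq q (0 - k) * rq q (0 + k))"
      unfolding fjtp_def by (rule infsum_cong_neutral) (auto simp: rq_def)
    then show ?case by simp
  next
    case (Suc m)
    have nz: "1 - q powi int (Suc m) \<noteq> 0" using powi_eq_1_iff[of "int (Suc m)"] by auto
    have "(1 - q powi int (Suc m)) * fjtp x (int (Suc m)) 0 = (1 - x * q ^ m) * fjtp x (int m) 0"
      using fjtp_rec1[OF assms, of "int (Suc m)" 0] by simp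
    also have "\<dots> = (1 - q powi int (Suc m)) * (qpoch x q (Suc m) * rq q (int (Suc m)))"
      using rq_rec[of "int (Suc m)"] by (simp add: Suc qpoch_Suc mult_ac)
    finally show ?case using nz by simp
  qed
  show ?thesis
  proof (induction n)
    case 0
    show ?case by (simp add: zero)
  next
    case (Suc n)
    have nz: "1 - q powi int (Suc (m + n)) \<noteq> 0" using powi_eq_1_iff[of "int (Suc (m + n))"] by auto
    have "(1 - q powi int (Suc (m + n))) * fjtp x (int m) (int (Suc n)) = (1 - q ^ Suc n / x) * fjtp x (int m) (int n)"
      using fjtp_rec2[OF assms, of "int m" "int (Suc n)"] power_int_of_nat[of q "Suc n"]
      by (simp only: of_nat_Suc) (simp add: ac_simps)
    also have "\<dots> = (1 - q powi int (Suc (m + n))) * (qpoch x q m * qpoch (q / x) q (Suc n) * rq q (int (m + Suc n)))"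
      using rq_rec[of "int (Suc (m + n))"] by (simp add: Suc qpoch_Suc mult_ac)
    finally show ?case using nz by simp
  qed
qed

text \<open>Let m = n tend to infinity in \<open>fjtp_eq\<close>. The factors \<open>rq\<close> are
  bounded, so the summable theta terms dominate.\<close>

theorem jfun_has_sum:
  assumes "x \<noteq> 0"
  shows "(gterm (- x) q has_sum jfun x q) UNIV"
proof -
  obtain C where C: "C > 0" "\<And>m. norm (rq q m) \<le> C" using rq_bounded by blast
  let ?P = "qpoch_inf q q"
  have "(\<lambda>n. fjtp x (int n) (int n)) \<longlonglongrightarrow> (\<Sum>\<^sub>\<infinity>k. gterm (- x) q k * inverse ?P * inverse ?P)"
    unfolding fjtp_def
  proof (rule infsum_tendsto_dominated)
    show "(\<lambda>k. norm (gterm (- x) q k) * (C * C)) summable_on UNIV"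
      using assms by (intro summable_on_cmult_left gterm_summable_norm) auto
    show "norm (gterm (- x) q k * rq q (int n - k) * rq q (int n + k)) \<le> norm (gterm (- x) q k) * (C * C)" for k n
      unfolding norm_mult mult.assoc
      by (intro mult_left_mono mult_mono C) (use C in auto)
    show "(\<lambda>n. gterm (- x) q k * rq q (int n - k) * rq q (int n + k)) \<longlonglongrightarrow> gterm (- x) q k * inverse ?P * inverse ?P" for k
      using rq_tendsto[of "- k"] rq_tendsto[of k] by (intro tendsto_mult tendsto_const) auto
  qed
  moreover have "(\<lambda>n. fjtp x (int n) (int n)) \<longlonglongrightarrow> qpoch_inf x q * qpoch_inf (q / x) q * inverse ?P"
  proof -
    have "filterlim (\<lambda>n::nat. n + n) at_top sequentially"
      by (rule filterlim_at_top_mono[OF filterlim_ident]) auto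
    from filterlim_compose[OF rq_tendsto[of 0] this]
    show ?thesis unfolding fjtp_eq[OF assms] by (intro tendsto_mult qpoch_tendsto) auto
  qed
  ultimately have "(\<Sum>\<^sub>\<infinity>k. gterm (- x) q k * inverse ?P * inverse ?P) = qpoch_inf x q * qpoch_inf (q / x) q * inverse ?P"
    by (rule LIMSEQ_unique)
  then have "(\<Sum>\<^sub>\<infinity>k. gterm (- x) q k) * inverse ?P * inverse ?P = qpoch_inf x q * qpoch_inf (q / x) q * inverse ?P"
    by (simp only: infsum_cmult_left')
  then have "(\<Sum>\<^sub>\<infinity>k. gterm (- x) q k) = jfun x q"
    by (simp add: jfun_def field_simps)
  then show ?thesis using has_sum_infsum[OF gterm_summable[of "- x"]] assms by simp
qed

end

section \<open>Partial fractions of the rank series\<close>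

text \<open>\<open>gterm (- (q ^ 2)) (q ^ 3) k\<close> is (-1)^k q^(k(3k+1)/2): these are the
  pentagonal number terms over 1 - x q^k.\<close>

definition rank_lambert :: "complex \<Rightarrow> complex \<Rightarrow> complex" where
  "rank_lambert x q = (\<Sum>\<^sub>\<infinity>k. gterm (- (q ^ 2)) (q ^ 3) k / (1 - x * q powi k))"

text \<open>The Appell function of level three, with general term (-1)^k t^k q^(3k(k+1)/2) / (1 - x
  q^k).\<close>

definition lambert3 :: "complex \<Rightarrow> complex \<Rightarrow> complex \<Rightarrow> complex" where
  "lambert3 t x q = (\<Sum>\<^sub>\<infinity>k. gterm (- t * q ^ 3) (q ^ 3) k / (1 - x * q powi k))"

lemma has_sum_diff:
  fixes f :: "'a \<Rightarrow> complex"
  shows "(f has_sum a) A \<Longrightarrow> (g has_sum b) A \<Longrightarrow> ((\<lambda>x. f x - g x) has_sum (a - b)) A"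
  using has_sum_add[of f A a "\<lambda>x. - g x" "- b"] has_sum_uminusI[of g A b] by simp

lemma summable_on_diff:
  fixes f :: "'a \<Rightarrow> complex"
  shows "f summable_on A \<Longrightarrow> g summable_on A \<Longrightarrow> (\<lambda>x. f x - g x) summable_on A"
  unfolding summable_on_def using has_sum_diff by blast

lemma infsum_diff:
  fixes f :: "'a \<Rightarrow> complex"
  shows "f summable_on A \<Longrightarrow> g summable_on A \<Longrightarrow>
    (\<Sum>\<^sub>\<infinity>x\<in>A. f x - g x) = infsum f A - infsum g A"
  by (intro infsumI has_sum_diff has_sum_infsum)

context nome
begin

lemma nome_power: "n > 0 \<Longrightarrow> nome (q ^ n)"
  by unfold_locales (use norm_q in \<open>auto simp: norm_power power_less_one_iff\<close>)

lemma qpoch_inf_split: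
  assumes "m > 0"
  shows "qpoch_inf x q = (\<Prod>r<m. qpoch_inf (q ^ r * x) (q ^ m))"
proof (rule LIMSEQ_unique)
  interpret m: nome "q ^ m" using nome_power assms .
  have "qpoch x q (n * m) = (\<Prod>r<m. qpoch (q ^ r * x) (q ^ m) n)" for n
  proof -
    have "qpoch x q (n * m) = (\<Prod>i<n. \<Prod>j\<in>{i * m..<i * m + m}. 1 - q ^ j * x)"
      unfolding qpoch_def by (simp add: prod.nat_group)
    also have "\<dots> = (\<Prod>i<n. \<Prod>r<m. 1 - (q ^ m) ^ i * (q ^ r * x))"
    proof (rule prod.cong[OF refl])
      fix i
      have "(q ^ m) ^ i * (q ^ r * x) = q ^ (i * m + r) * x" for r
        by (simp add: power_add mult_ac flip: power_mult)
      then show "(\<Prod>j\<in>{i * m..<i * m + m}. 1 - q ^ j * x) = (\<Prod>r<m. 1 - (q ^ m) ^ i * (q ^ r * x))"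
        by (simp only:) (rule prod.reindex_bij_witness[of _ "\<lambda>r. i * m + r" "\<lambda>j. j - i * m"], auto)
    qed
    also have "\<dots> = (\<Prod>r<m. qpoch (q ^ r * x) (q ^ m) n)"
      unfolding qpoch_def by (rule prod.swap)
    finally show ?thesis .
  qed
  then show "(\<lambda>n. qpoch x q (n * m)) \<longlonglongrightarrow> (\<Prod>r<m. qpoch_inf (q ^ r * x) (q ^ m))"
    by (simp add: tendsto_prod m.qpoch_tendsto)
  have "filterlim (\<lambda>n. n * m) at_top sequentially"
    by (rule filterlim_at_top_mono[OF filterlim_ident]) (use assms in auto)
  then show "(\<lambda>n. qpoch x q (n * m)) \<longlonglongrightarrow> qpoch_inf x q"
    by (rule filterlim_compose[OF qpoch_tendsto])
qed

text \<open>Sorting the factors of (q)_inf by their exponent modulo 3 gives exactly the three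
  products in j(q^2; q^3).\<close>

theorem pentagonal: "(gterm (- (q ^ 2)) (q ^ 3) has_sum qpoch_inf q q) UNIV"
proof -
  interpret q3: nome "q ^ 3" by (rule nome_power) simp
  have "qpoch_inf q q = jfun (q ^ 2) (q ^ 3)"
    unfolding qpoch_inf_split[of 3 q, simplified] jfun_def
    by (simp add: numeral_eq_Suc power_Suc mult_ac field_simps)
  then show ?thesis using q3.jfun_has_sum[of "q ^ 2"] by simp
qed

text \<open>The sequence converges in both directions of k, hence is bounded. A vanishing
  denominator does no harm because \<open>inverse 0 = 0\<close>, so x may be any point, poles of the
  Lambert series included.\<close>

lemma inverse_one_minus_bounded:
  obtains B where "B > 0" "\<And>k. norm (inverse (1 - x * q powi k)) \<le> B"
proof -
  have "(\<lambda>n. inverse (1 - x * q ^ n)) \<longlonglongrightarrow> inverse (1 - x * 0)"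
    by (intro tendsto_intros LIMSEQ_power_zero) (use norm_q in auto)
  then have "Bseq (\<lambda>n. inverse (1 - x * q ^ n))"
    by (intro convergent_imp_Bseq) (auto simp: convergent_def)
  then obtain B1 where B1: "B1 > 0" "\<And>n. norm (inverse (1 - x * q ^ n)) \<le> B1"
    by (auto simp: Bseq_def)
  have "\<exists>B2>0. \<forall>n. norm (inverse (1 - x * q powi (- int n))) \<le> B2"
  proof (cases "x = 0")
    case True
    then show ?thesis by (intro exI[of _ 1]) auto
  next
    case False
    have "(\<lambda>n. q ^ n * inverse (q ^ n - x)) \<longlonglongrightarrow> 0 * inverse (0 - x)"
      by (intro tendsto_intros LIMSEQ_power_zero) (use norm_q False in auto)
    moreover have "q ^ n * inverse (q ^ n - x) = inverse (1 - x * q powi (- int n))" for n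
    proof -
      have "1 - x * q powi (- int n) = inverse (q ^ n) * (q ^ n - x)"
        by (simp add: power_int_minus field_simps)
      then show ?thesis by (simp add: inverse_mult_distrib)
    qed
    ultimately have "Bseq (\<lambda>n. inverse (1 - x * q powi (- int n)))"
      by (intro convergent_imp_Bseq) (auto simp: convergent_def)
    then show ?thesis by (auto simp: Bseq_def)
  qed
  then obtain B2 where B2: "B2 > 0" "\<And>n. norm (inverse (1 - x * q powi (- int n))) \<le> B2"
    by auto
  have "norm (inverse (1 - x * q powi k)) \<le> max B1 B2" for k
    using B1(2) B2(2) by (cases k rule: int_cases2) (auto simp: le_max_iff_disj)
  then show ?thesis using that[of "max B1 B2"] B1(1) by auto
qed

lemma lambert_summable_norm:
  assumes "(\<lambda>k. norm (f k)) summable_on A"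
  shows "(\<lambda>k. norm (f k / (1 - x * q powi k))) summable_on A"
proof -
  obtain B where B: "B > 0" "\<And>k. norm (inverse (1 - x * q powi k)) \<le> B"
    using inverse_one_minus_bounded by blast
  show ?thesis
  proof (rule summable_on_comparison_test)
    show "(\<lambda>k. norm (f k) * B) summable_on A"
      using assms by (rule summable_on_cmult_left)
    show "norm (f k / (1 - x * q powi k)) \<le> norm (f k) * B" for k
      unfolding divide_inverse norm_mult by (intro mult_left_mono B) auto
  qed auto
qed

lemma gterm_cube_summable:
  assumes "x \<noteq> 0"
  shows "(\<lambda>k. norm (gterm x (q ^ 3) k)) summable_on UNIV"
proof -
  interpret q3: nome "q ^ 3" by (rule nome_power) simp
  show ?thesis using q3.gterm_summable_norm assms .
qed

text \<open>The products contain the factor 1 - 1, from (1)_n and from (q/q)_n. These are the two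
  sums left over in the partial fraction recurrence.\<close>

lemma fjtp_vanish:
  assumes "n > 0"
  shows "fjtp 1 (int n) (int n) = 0" "fjtp q (int n) (int n) = 0"
  using assms by (auto simp: fjtp_eq qpoch_def intro!: bexI[of _ 0])

text \<open>The partial fraction expansion of 1 / ((x)_(n+1) (q/x)_n) in x;
  \<open>gterm (- q) q k\<close> is (-1)^k q^(k(k+1)/2).\<close>

definition pfrac :: "complex \<Rightarrow> int \<Rightarrow> complex" where
  "pfrac x n = (\<Sum>\<^sub>\<infinity>k. gterm (- q) q k / (1 - x * q powi k) * rq q (n - k) * rq q (n + k))"

lemma pfrac_rec:
  assumes "x \<noteq> 0" "\<And>k. x * q powi k \<noteq> 1" "n > 0"
  shows "(1 - x * q ^ n) * (1 - q ^ n / x) * pfrac x (int n) = pfrac x (int n - 1)"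
proof -
  let ?g = "gterm (- q) q" and ?n = "int n"
  have "(1 - x * q ^ n) * (1 - q ^ n / x) * pfrac x ?n =
    (\<Sum>\<^sub>\<infinity>k. (1 - x * q ^ n) * (1 - q ^ n / x) * (?g k / (1 - x * q powi k) * rq q (?n - k) * rq q (?n + k)))"
    unfolding pfrac_def by (rule infsum_cmult_right'[symmetric])
  also have "\<dots> = (\<Sum>\<^sub>\<infinity>k. ?g k / (1 - x * q powi k) * rq q (?n - 1 - k) * rq q (?n - 1 + k) +
      (q ^ n * (gterm (- 1) q k * rq q (?n - k) * rq q (?n + k))
      + (- (q ^ n) / x) * (?g k * rq q (?n - k) * rq q (?n + k))))"
  proof (rule infsum_cong)
    fix k :: int
    have nz: "1 - x * q powi k \<noteq> 0" using assms(2)[of k] by simp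
    \<comment> \<open>The first product lowers both indices of \<open>rq\<close>. The rest is
      divisible by 1 - x q^k, so it cancels the denominator and leaves finite theta sums at the
      arguments 1 and q, which vanish.\<close>
    have 1: "(1 - x * q ^ n) * (1 - q ^ n / x) = (1 - q powi (?n - k)) * (1 - q powi (?n + k))
         + q ^ n * ((1 - x * q powi k) * (q powi (- k) - 1 / x))"
      using assms(1) by (simp add: power_int_add power_int_diff power_int_minus field_simps)
    have 2: "rq q (?n - 1 - k) = (1 - q powi (?n - k)) * rq q (?n - k)"
      using rq_rec[of "?n - k"] by (simp add: algebra_simps)
    have 3: "rq q (?n - 1 + k) = (1 - q powi (?n + k)) * rq q (?n + k)"
      using rq_rec[of "?n + k"] by (simp add: algebra_simps)
    have 4: "gterm (- 1) q k = ?g k * q powi (- k)"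
      by (simp add: gterm_def power_int_mult_distrib[of "- 1" q, simplified] power_int_minus field_simps)
    have 5: "(P * R + c * (d * (u - 1 / x))) * (g / d * a * b) =
      g / d * (P * a) * (R * b) + (c * ((g * u) * a * b) + (- c / x) * (g * a * b))"
      if "d \<noteq> 0" for P R c d u g a b
      using that assms(1) by (simp add: field_simps)
    show "(1 - x * q ^ n) * (1 - q ^ n / x) * (?g k / (1 - x * q powi k) * rq q (?n - k) * rq q (?n + k))
      = ?g k / (1 - x * q powi k) * rq q (?n - 1 - k) * rq q (?n - 1 + k) +
      (q ^ n * (gterm (- 1) q k * rq q (?n - k) * rq q (?n + k))
      + (- (q ^ n) / x) * (?g k * rq q (?n - k) * rq q (?n + k)))"
      unfolding 1 2 3 4 by (rule 5[OF nz])
  qed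
  also have "\<dots> = pfrac x (?n - 1) + (q ^ n * fjtp 1 ?n ?n + (- (q ^ n) / x) * fjtp q ?n ?n)"
    unfolding pfrac_def fjtp_def
    by (subst infsum_add; (intro summable_on_add summable_on_cmult_right rq_prod_summable)?)
       (subst infsum_add; (intro summable_on_add summable_on_cmult_right rq_prod_summable)?; simp only: infsum_cmult_right')
  also have "\<dots> = pfrac x (?n - 1)"
    using fjtp_vanish[OF assms(3)] by simp
  finally show ?thesis .
qed

lemma pfrac_eq:
  assumes "x \<noteq> 0" "\<And>k. x * q powi k \<noteq> 1"
  shows "qpoch x q (Suc n) * qpoch (q / x) q n * pfrac x (int n) = 1"
proof (induction n)
  case 0
  have "pfrac x 0 = (\<Sum>\<^sub>\<infinity>k\<in>{0}. gterm (- q) q k / (1 - x * q powi k) * rq q (0 - k) * rq q (0 + k))"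
    unfolding pfrac_def by (rule infsum_cong_neutral) (auto simp: rq_def)
  then show ?case using assms(2)[of 0] by (simp add: qpoch_Suc)
next
  case (Suc n)
  have "qpoch x q (Suc (Suc n)) * qpoch (q / x) q (Suc n) * pfrac x (int (Suc n))
    = qpoch x q (Suc n) * qpoch (q / x) q n * ((1 - x * q ^ Suc n) * (1 - q ^ Suc n / x) * pfrac x (int (Suc n)))"
    by (simp add: qpoch_Suc[of x q "Suc n"] qpoch_Suc[of "q / x"] mult_ac)
  also have "\<dots> = 1"
    using Suc pfrac_rec[OF assms, of "Suc n"] by simp
  finally show ?case .
qed

section \<open>The Durfee rectangle identity and the rank series as a Lambert series\<close>

definition durfee :: "nat \<Rightarrow> complex" where
  "durfee j = (\<Sum>\<^sub>\<infinity>m. q powi (m * m + int j * m) * rq q m * rq q (m + int j))"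

lemma durfee_bound:
  obtains M where "M summable_on UNIV"
    "\<And>i j c m. norm (q powi (m * m + int j * m) * rq q m * rq q (m + c)) \<le> M m"
proof -
  obtain C where C: "C > 0" "\<And>m. norm (rq q m) \<le> C" using rq_bounded by blast
  define M where "M m = (if m < 0 then 0 else C * C * norm q ^ nat m)" for m
  have "M summable_on UNIV"
  proof (rule summable_on_int_iff)
    have "summable (\<lambda>n. C * C * norm q ^ n)"
      using norm_q by (intro summable_mult summable_geometric) auto
    then show "(\<lambda>n. M (int n)) summable_on UNIV"
      using C by (intro summable_nonneg_imp_summable_on) (auto simp: M_def)
  qed (simp add: M_def)
  moreover have "norm (q powi (m * m + int j * m) * rq q m * rq q (m + c)) \<le> M m" for j c m
  proof (cases "m < 0")
    case False
    then obtain n where m: "m = int n" by (metis linorder_not_less zero_le_imp_eq_int)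
    have "n \<le> n * n + j * n" by (cases n) auto
    then have "norm q ^ (n * n + j * n) \<le> norm q ^ n"
      using norm_q by (intro power_decreasing) auto
    moreover have "q powi (m * m + int j * m) = q ^ (n * n + j * n)"
      unfolding m by (simp flip: power_int_of_nat)
    ultimately have "norm (q powi (m * m + int j * m)) * (norm (rq q m) * norm (rq q (m + c))) \<le> norm q ^ n * (C * C)"
      by (intro mult_mono C) (use C in \<open>auto simp: norm_power\<close>)
    then show ?thesis
      by (simp add: m M_def norm_mult mult_ac)
  qed (simp add: M_def rq_neg)
  ultimately show ?thesis using that by blast
qed

lemma durfee_summable: "(\<lambda>m. q powi (m * m + int j * m) * rq q m * rq q (m + c)) summable_on UNIV"
proof -
  obtain M where M: "M summable_on UNIV"
    "\<And>j c m. norm (q powi (m * m + int j * m) * rq q m * rq q (m + c)) \<le> M m"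
    using durfee_bound by metis
  show ?thesis
    by (rule abs_summable_summable, rule Infinite_Sum.abs_summable_on_comparison_test'[OF M(1)]) (rule M(2))
qed

text \<open>Termwise the difference contains 1 - q^m - q^(m+j+1) = (1 - q^m) - q^(j+1) q^m. The
  second part is a multiple of \<open>durfee (Suc j)\<close>; in the first, shifting m by one
  completes the square and yields q^(j+1) \<open>durfee (Suc (Suc j))\<close>.\<close>

lemma durfee_diff:
  "durfee j - durfee (Suc j) = - (q ^ Suc j) * (durfee (Suc j) - durfee (Suc (Suc j)))"
proof -
  let ?e = "\<lambda>j m. q powi (m * m + int j * m)"
  have d1: "durfee j - durfee (Suc j) = (\<Sum>\<^sub>\<infinity>m. ?e j m * rq q (m - 1) * rq q (m + int (Suc j)))
      + - (q ^ Suc j) * (\<Sum>\<^sub>\<infinity>m. ?e (Suc j) m * rq q m * rq q (m + int (Suc j)))" for j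
  proof -
    have s: "(\<lambda>m. ?e j m * rq q (m - 1) * rq q (m + int (Suc j))) summable_on UNIV"
    proof -
      have "?e j m * rq q (m - 1) * rq q (m + int (Suc j)) = ?e j m * rq q m * rq q (m + int (Suc j))
         - ?e (Suc j) m * rq q m * rq q (m + int (Suc j))" for m
      proof -
        have "rq q (m - 1) = (1 - q powi m) * rq q m" by (simp add: rq_rec)
        moreover have "?e (Suc j) m = ?e j m * q powi m" by (simp add: power_int_add algebra_simps)
        ultimately show ?thesis by (simp only:) (simp add: algebra_simps)
      qed
      then show ?thesis by (simp only:) (intro summable_on_diff durfee_summable)
    qed
    have "durfee j - durfee (Suc j) = (\<Sum>\<^sub>\<infinity>m. ?e j m * rq q m * rq q (m + int j) - ?e (Suc j) m * rq q m * rq q (m + int (Suc j)))"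
      unfolding durfee_def by (rule infsum_diff[symmetric]) (rule durfee_summable)+
    also have "\<dots> = (\<Sum>\<^sub>\<infinity>m. ?e j m * rq q (m - 1) * rq q (m + int (Suc j))
      + - (q ^ Suc j) * (?e (Suc j) m * rq q m * rq q (m + int (Suc j))))"
    proof (rule infsum_cong)
      fix m
      have 1: "rq q (m + int j) = (1 - q powi (m + int (Suc j))) * rq q (m + int (Suc j))"
        using rq_rec[of "m + int (Suc j)"] by simp
      have 2: "rq q (m - 1) = (1 - q powi m) * rq q m" by (simp add: rq_rec)
      have 3: "?e (Suc j) m = ?e j m * q powi m" by (simp add: power_int_add algebra_simps)
      have 4: "q powi (m + int (Suc j)) = q powi m * q ^ Suc j" 
        using power_int_of_nat[of q "Suc j"] by (simp only: power_int_add q_nz simp_thms)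
      show "?e j m * rq q m * rq q (m + int j) - ?e (Suc j) m * rq q m * rq q (m + int (Suc j))
        = ?e j m * rq q (m - 1) * rq q (m + int (Suc j))
        + - (q ^ Suc j) * (?e (Suc j) m * rq q m * rq q (m + int (Suc j)))"
        unfolding 1 2 3 4 by algebra
    qed
    also have "\<dots> = (\<Sum>\<^sub>\<infinity>m. ?e j m * rq q (m - 1) * rq q (m + int (Suc j)))
      + - (q ^ Suc j) * (\<Sum>\<^sub>\<infinity>m. ?e (Suc j) m * rq q m * rq q (m + int (Suc j)))"
      by (subst infsum_add[OF s summable_on_cmult_right[OF durfee_summable]], subst infsum_cmult_right') (rule refl)
    finally show ?thesis .
  qed
  have "(\<Sum>\<^sub>\<infinity>m. ?e j m * rq q (m - 1) * rq q (m + int (Suc j)))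
     = (\<Sum>\<^sub>\<infinity>m. ?e j (m + 1) * rq q (m + 1 - 1) * rq q (m + 1 + int (Suc j)))"
    by (rule infsum_shift[symmetric])
  also have "\<dots> = (\<Sum>\<^sub>\<infinity>m. q ^ Suc j * (?e (Suc (Suc j)) m * rq q m * rq q (m + int (Suc (Suc j)))))"
  proof (rule infsum_cong)
    fix m
    have "(m + 1) * (m + 1) + int j * (m + 1) = int (Suc j) + (m * m + int (Suc (Suc j)) * m)"
      by (simp add: algebra_simps)
    then have "?e j (m + 1) = q ^ Suc j * ?e (Suc (Suc j)) m"
      using power_int_of_nat[of q "Suc j"] by (simp only: power_int_add q_nz simp_thms)
    moreover have "m + 1 + int (Suc j) = m + int (Suc (Suc j))" by simp
    ultimately show "?e j (m + 1) * rq q (m + 1 - 1) * rq q (m + 1 + int (Suc j)) =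
      q ^ Suc j * (?e (Suc (Suc j)) m * rq q m * rq q (m + int (Suc (Suc j))))" by (simp only:) simp
  qed
  also have "\<dots> = q ^ Suc j * durfee (Suc (Suc j))"
    unfolding durfee_def by (rule infsum_cmult_right')
  finally have c: "(\<Sum>\<^sub>\<infinity>m. ?e j m * rq q (m - 1) * rq q (m + int (Suc j))) = q ^ Suc j * durfee (Suc (Suc j))" .
  show ?thesis
    using d1[of j] unfolding c durfee_def[of "Suc j", symmetric] by (simp only: right_diff_distrib) simp
qed

text \<open>As |q^(j+1)| < 1, \<open>durfee_diff\<close> makes the norms of consecutive differences
  nondecreasing in j. They also tend to 0, so all of them vanish, and the common value is the limit
  for large j, where only m = 0 survives.\<close>

lemma durfee_eq: "durfee j = inverse (qpoch_inf q q)"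
proof -
  obtain M where M: "M summable_on UNIV"
    "\<And>j c m. norm (q powi (m * m + int j * m) * rq q m * rq q (m + c)) \<le> M m"
    using durfee_bound by metis
  have lim: "durfee \<longlonglongrightarrow> (\<Sum>\<^sub>\<infinity>m::int. if m = 0 then inverse (qpoch_inf q q) else 0)"
    unfolding durfee_def
  proof (rule infsum_tendsto_dominated[OF _ M(1)])
    fix m :: int
    show "(\<lambda>j. q powi (m * m + int j * m) * rq q m * rq q (m + int j)) \<longlonglongrightarrow>
      (if m = 0 then inverse (qpoch_inf q q) else 0)"
    proof (cases "m > 0")
      case True
      have "(\<lambda>j. q powi (m * m) * (q powi m) ^ j * rq q m * rq q (int j + m)) \<longlonglongrightarrow>
         q powi (m * m) * 0 * rq q m * inverse (qpoch_inf q q)"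
        by (intro tendsto_intros LIMSEQ_power_zero rq_tendsto)
          (use True norm_q in \<open>auto simp: power_int_def norm_power power_less_one_iff\<close>)
      moreover have "q powi (m * m) * (q powi m) ^ j = q powi (m * m + int j * m)" for j
        by (simp add: power_int_add power_int_mult[symmetric] mult.commute flip: power_int_of_nat)
      ultimately show ?thesis using True by (simp add: add.commute)
    next
      case False
      then show ?thesis using rq_tendsto[of 0] by (auto simp: rq_neg)
    qed
  qed (rule M(2))
  have "(\<Sum>\<^sub>\<infinity>m::int. if m = 0 then inverse (qpoch_inf q q) else 0) = (\<Sum>\<^sub>\<infinity>m\<in>{0::int}. inverse (qpoch_inf q q))"
    by (rule infsum_cong_neutral) auto
  with lim have lim: "durfee \<longlonglongrightarrow> inverse (qpoch_inf q q)" by simp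
  have "durfee j = durfee (Suc j)" for j
  proof -
    have "norm (durfee j - durfee (Suc j)) \<le> norm (durfee (Suc j) - durfee (Suc (Suc j)))" for j
      unfolding durfee_diff[of j] norm_mult
      using norm_q power_le_one[of "norm q" "Suc j"] by (simp add: norm_mult norm_power mult_left_le_one_le)
    then have "incseq (\<lambda>j. norm (durfee j - durfee (Suc j)))"
      by (rule incseq_SucI)
    moreover have "(\<lambda>j. norm (durfee j - durfee (Suc j))) \<longlonglongrightarrow> norm (inverse (qpoch_inf q q) - inverse (qpoch_inf q q))"
      by (intro tendsto_intros lim LIMSEQ_Suc)
    ultimately have "norm (durfee j - durfee (Suc j)) \<le> norm (inverse (qpoch_inf q q) - inverse (qpoch_inf q q))"
      by (rule incseq_le)
    then show ?thesis by simp
  qed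
  then have "durfee j = durfee 0" for j by (induction j) auto
  then have "durfee = (\<lambda>_. durfee 0)" by auto
  with lim have "(\<lambda>_. durfee 0) \<longlonglongrightarrow> inverse (qpoch_inf q q)" by metis
  then show ?thesis using \<open>durfee = _\<close> by (metis LIMSEQ_const_iff)
qed

text \<open>Shifting n by |k| gives the Durfee sum of offset 2|k|. This evaluates the inner sum once
  the partial fractions have been inserted into the rank series.\<close>

lemma durfee_rectangle:
  "(\<Sum>\<^sub>\<infinity>n::nat. q ^ (n\<^sup>2) * rq q (int n - k) * rq q (int n + k)) = q powi (k * k) / qpoch_inf q q"
proof -
  have 1: "(\<Sum>\<^sub>\<infinity>n::nat. q ^ (n\<^sup>2) * rq q (int n - int j) * rq q (int n + int j)) = q powi (int j * int j) / qpoch_inf q q" for j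
  proof -
    have "(\<Sum>\<^sub>\<infinity>n::nat. q ^ (n\<^sup>2) * rq q (int n - int j) * rq q (int n + int j))
       = (\<Sum>\<^sub>\<infinity>n\<in>range int. q powi (n * n) * rq q (n - int j) * rq q (n + int j))"
      by (subst infsum_reindex) (auto simp: o_def power2_eq_square power_int_def nat_mult_distrib intro!: infsum_cong)
    also have "\<dots> = (\<Sum>\<^sub>\<infinity>n. q powi (n * n) * rq q (n - int j) * rq q (n + int j))"
    proof (rule infsum_cong_neutral)
      fix n :: int assume "n \<in> UNIV - range int"
      then have "n < 0" by (metis DiffD2 int_nat_eq linorder_not_le rangeI not_less)
      then show "q powi (n * n) * rq q (n - int j) * rq q (n + int j) = 0" by (simp add: rq_neg)
    qed auto
    also have "\<dots> = (\<Sum>\<^sub>\<infinity>n. q powi ((n + int j) * (n + int j)) * rq q (n + int j - int j) * rq q (n + int j + int j))"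
      by (rule infsum_shift[symmetric])
    also have "\<dots> = (\<Sum>\<^sub>\<infinity>n. q powi (int j * int j) * (q powi (n * n + int (2 * j) * n) * rq q n * rq q (n + int (2 * j))))"
    proof (rule infsum_cong)
      fix n
      have "(n + int j) * (n + int j) = int j * int j + (n * n + int (2 * j) * n)" by (simp add: algebra_simps)
      then show "q powi ((n + int j) * (n + int j)) * rq q (n + int j - int j) * rq q (n + int j + int j)
        = q powi (int j * int j) * (q powi (n * n + int (2 * j) * n) * rq q n * rq q (n + int (2 * j)))"
        by (simp add: power_int_add mult_ac add_ac)
    qed
    also have "\<dots> = q powi (int j * int j) * durfee (2 * j)"
      unfolding durfee_def by (rule infsum_cmult_right')
    finally show ?thesis by (simp add: durfee_eq divide_inverse)
  qed
  show ?thesis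
  proof (cases "k \<ge> 0")
    case True
    then show ?thesis using 1[of "nat k"] by simp
  next
    case False
    then show ?thesis using 1[of "nat (- k)"] by (simp add: mult_ac)
  qed
qed

text \<open>Expand every term by \<open>pfrac_eq\<close>, interchange the two absolutely convergent
  sums, and apply \<open>durfee_rectangle\<close> for each k.\<close>

theorem rank_series:
  assumes "x \<noteq> 0" "\<And>k. x * q powi k \<noteq> 1"
  shows "((\<lambda>n. q ^ (n\<^sup>2) / (qpoch x q (n + 1) * qpoch (q / x) q n)) has_sum
           (rank_lambert x q / qpoch_inf q q)) UNIV"
proof -
  obtain C where C: "C > 0" "\<And>m. norm (rq q m) \<le> C" using rq_bounded by blast
  let ?g = "\<lambda>k. gterm (- q) q k / (1 - x * q powi k)"
  let ?f = "\<lambda>n k. q ^ (n\<^sup>2) * (?g k * rq q (int n - k) * rq q (int n + k))"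
  have g: "(\<lambda>k. norm (?g k)) summable_on UNIV"
    by (intro lambert_summable_norm gterm_summable_norm) simp
  have q2: "(\<lambda>n::nat. norm q ^ (n\<^sup>2)) summable_on UNIV"
  proof (rule summable_on_comparison_test)
    show "(\<lambda>n. norm q ^ n) summable_on UNIV"
      by (rule summable_nonneg_imp_summable_on) (use norm_q in \<open>auto intro!: summable_geometric\<close>)
    show "norm q ^ (n\<^sup>2) \<le> norm q ^ n" for n
      using norm_q by (intro power_decreasing) (auto simp: power2_eq_square)
  qed auto
  have "(\<lambda>(n, k). norm q ^ (n\<^sup>2) * (norm (?g k) * (C * C))) summable_on UNIV \<times> UNIV"
  proof (rule summable_on_SigmaI)
    show "((\<lambda>k. case (n, k) of (n, k) \<Rightarrow> norm q ^ (n\<^sup>2) * (norm (?g k) * (C * C))) has_sum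
      norm q ^ (n\<^sup>2) * ((\<Sum>\<^sub>\<infinity>k. norm (?g k)) * (C * C))) UNIV" for n
      unfolding prod.case by (intro has_sum_cmult_right has_sum_cmult_left has_sum_infsum g)
    show "(\<lambda>n. norm q ^ (n\<^sup>2) * ((\<Sum>\<^sub>\<infinity>k. norm (?g k)) * (C * C))) summable_on UNIV"
      by (intro summable_on_cmult_left q2)
  qed (use C in auto)
  then have sum: "(\<lambda>(n, k). ?f n k) summable_on UNIV \<times> UNIV"
  proof (rule abs_summable_summable[OF Infinite_Sum.abs_summable_on_comparison_test'])
    fix p :: "nat \<times> int" assume "p \<in> UNIV \<times> UNIV"
    obtain n k where p: "p = (n, k)" by (cases p)
    have "norm (?g k) * (norm (rq q (int n - k)) * norm (rq q (int n + k))) \<le> norm (?g k) * (C * C)"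
      by (intro mult_left_mono mult_mono C) (use C in auto)
    then show "norm (case p of (n, k) \<Rightarrow> ?f n k) \<le> (case p of (n, k) \<Rightarrow> norm q ^ (n\<^sup>2) * (norm (?g k) * (C * C)))"
      unfolding p prod.case norm_mult norm_power mult.assoc by (rule mult_left_mono) simp
  qed
  have fn: "(\<Sum>\<^sub>\<infinity>k. ?f n k) = q ^ (n\<^sup>2) / (qpoch x q (n + 1) * qpoch (q / x) q n)" for n
  proof -
    have "(\<Sum>\<^sub>\<infinity>k. ?f n k) = q ^ (n\<^sup>2) * pfrac x (int n)"
      unfolding pfrac_def by (rule infsum_cmult_right')
    moreover have "pfrac x (int n) = 1 / (qpoch x q (n + 1) * qpoch (q / x) q n)"
      using pfrac_eq[OF assms, of n] by (simp add: eq_divide_eq mult.commute) force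
    ultimately show ?thesis by simp
  qed
  have fk: "(\<Sum>\<^sub>\<infinity>n. ?f n k) = gterm (- (q\<^sup>2)) (q ^ 3) k / (1 - x * q powi k) / qpoch_inf q q" for k
  proof -
    have "(\<Sum>\<^sub>\<infinity>n. ?f n k) = (\<Sum>\<^sub>\<infinity>n. ?g k * (q ^ (n\<^sup>2) * rq q (int n - k) * rq q (int n + k)))"
      by (rule infsum_cong) (simp add: mult_ac)
    also have "\<dots> = ?g k * (q powi (k * k) / qpoch_inf q q)"
      by (subst infsum_cmult_right') (simp add: durfee_rectangle)
    \<comment> \<open>On the exponents this is k(k+1)/2 + k^2 = k(3k+1)/2.\<close>
    also have "gterm (- q) q k * q powi (k * k) = gterm (- (q\<^sup>2)) (q ^ 3) k"
    proof -
      have "k + tri k + k * k = 2 * k + 3 * tri k"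
        using two_tri[of k] by (simp add: algebra_simps)
      then have "q powi k * q powi tri k * q powi (k * k) = q powi (2 * k) * q powi (3 * tri k)"
        by (simp only: power_int_add[symmetric] q_nz simp_thms)
      moreover have "q powi (2 * k) = (q\<^sup>2) powi k" "q powi (3 * tri k) = (q ^ 3) powi tri k"
        unfolding power_int_mult by simp_all
      moreover have "(- q) powi k = (- 1) powi k * q powi k" "(- (q\<^sup>2)) powi k = (- 1) powi k * (q\<^sup>2) powi k"
        using power_int_mult_distrib[of "- 1" q k] power_int_mult_distrib[of "- 1" "q\<^sup>2" k] by auto
      ultimately show ?thesis
        by (simp only: gterm_def mult.assoc)
    qed
    then have "?g k * (q powi (k * k) / qpoch_inf q q) = gterm (- (q\<^sup>2)) (q ^ 3) k / (1 - x * q powi k) / qpoch_inf q q"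
      by (simp add: field_simps)
    finally show ?thesis .
  qed
  have "(\<lambda>n. \<Sum>\<^sub>\<infinity>k. ?f n k) summable_on UNIV"
    using summable_on_Sigma_banach[OF sum] by simp
  moreover have "(\<Sum>\<^sub>\<infinity>n. \<Sum>\<^sub>\<infinity>k. ?f n k) = (\<Sum>\<^sub>\<infinity>k. \<Sum>\<^sub>\<infinity>n. ?f n k)"
    by (rule infsum_swap_banach[OF sum])
  moreover have "(\<Sum>\<^sub>\<infinity>k. \<Sum>\<^sub>\<infinity>n. ?f n k) = rank_lambert x q / qpoch_inf q q"
    unfolding fk rank_lambert_def unfolding divide_inverse by (rule infsum_cmult_left')
  ultimately show ?thesis
    unfolding fn has_sum_iff by simp
qed

text \<open>Termwise x q^k / (1 - x q^k) = 1 / (1 - x q^k) - 1; the subtracted series is the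
  pentagonal one.\<close>

lemma lambert3_eq:
  assumes "x \<noteq> 0" "\<And>k. x * q powi k \<noteq> 1"
  shows "x * lambert3 1 x q = rank_lambert x q - qpoch_inf q q"
proof -
  let ?g = "gterm (- (q\<^sup>2)) (q ^ 3)"
  have s: "(\<lambda>k. norm (?g k)) summable_on UNIV" by (rule gterm_cube_summable) simp
  have "x * lambert3 1 x q = (\<Sum>\<^sub>\<infinity>k. x * (gterm (- 1 * q ^ 3) (q ^ 3) k / (1 - x * q powi k)))"
    unfolding lambert3_def by (rule infsum_cmult_right'[symmetric])
  also have "\<dots> = (\<Sum>\<^sub>\<infinity>k. ?g k / (1 - x * q powi k) - ?g k)"
  proof (rule infsum_cong)
    fix k
    have "gterm (- 1 * q ^ 3) (q ^ 3) k = q powi k * ?g k"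
      using power_int_mult_distrib[of q "- (q\<^sup>2)" k] by (simp add: gterm_def power3_eq_cube power2_eq_square mult_ac)
    moreover have "1 - x * q powi k \<noteq> 0" using assms(2)[of k] by simp
    ultimately show "x * (gterm (- 1 * q ^ 3) (q ^ 3) k / (1 - x * q powi k)) = ?g k / (1 - x * q powi k) - ?g k"
      by (simp add: field_simps)
  qed
  also have "\<dots> = rank_lambert x q - (\<Sum>\<^sub>\<infinity>k. ?g k)"
    unfolding rank_lambert_def
    by (intro infsum_diff abs_summable_summable[OF lambert_summable_norm[OF s]] abs_summable_summable[OF s])
  also have "(\<Sum>\<^sub>\<infinity>k. ?g k) = qpoch_inf q q"
    using pentagonal by (rule infsumI)
  finally show ?thesis .
qed

lemma gmock_eq_rank_lambert:
  assumes "x \<noteq> 0" "\<And>k. x * q powi k \<noteq> 1"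
  shows "1 + x * gmock x q = rank_lambert x q / qpoch_inf q q"
  using assms(1) sums_unique[OF has_sum_imp_sums[OF rank_series[OF assms]]]
  by (simp add: gmock_def mult.assoc[symmetric])

lemma gmock_eq_lambert3:
  assumes "x \<noteq> 0" "\<And>k. x * q powi k \<noteq> 1"
  shows "gmock x q = lambert3 1 x q / qpoch_inf q q"
proof -
  have "x * gmock x q = x * (lambert3 1 x q / qpoch_inf q q)"
    using gmock_eq_rank_lambert[OF assms] lambert3_eq[OF assms]
    by (simp add: diff_divide_distrib) (simp add: algebra_simps)
  then show ?thesis using assms(1) by (simp only: mult_cancel_left simp_thms)
qed

end

section \<open>The Weierstrass relation\<close>

lemma has_sum_Times_mult:
  fixes f :: "'a \<Rightarrow> complex" and g :: "'b \<Rightarrow> complex"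
  assumes f: "(\<lambda>x. norm (f x)) summable_on A" "(f has_sum a) A"
    and g: "(\<lambda>x. norm (g x)) summable_on B" "(g has_sum b) B"
  shows "((\<lambda>(x, y). f x * g y) has_sum (a * b)) (A \<times> B)"
proof (rule has_sum_SigmaI)
  show "((\<lambda>y. case (x, y) of (x, y) \<Rightarrow> f x * g y) has_sum f x * b) B" for x
    unfolding prod.case by (intro has_sum_cmult_right g)
  show "((\<lambda>x. f x * b) has_sum a * b) A"
    by (intro has_sum_cmult_left f)
  have "(\<lambda>(x, y). norm (f x) * norm (g y)) summable_on A \<times> B"
  proof (rule summable_on_SigmaI)
    show "((\<lambda>y. case (x, y) of (x, y) \<Rightarrow> norm (f x) * norm (g y)) has_sum
      norm (f x) * (\<Sum>\<^sub>\<infinity>y\<in>B. norm (g y))) B" for x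
      unfolding prod.case by (intro has_sum_cmult_right has_sum_infsum g)
    show "(\<lambda>x. norm (f x) * (\<Sum>\<^sub>\<infinity>y\<in>B. norm (g y))) summable_on A"
      by (intro summable_on_cmult_left f)
  qed auto
  then have "(\<lambda>p. norm (case p of (x, y) \<Rightarrow> f x * g y)) summable_on A \<times> B"
    by (simp add: case_prod_unfold norm_mult)
  then show "(\<lambda>(x, y). f x * g y) summable_on A \<times> B"
    by (rule abs_summable_summable)
qed

text \<open>\<open>jreg x q\<close> continues \<open>jfun x q / (1 - x)\<close> to \<open>x = 1\<close>.\<close>

definition jreg :: "complex \<Rightarrow> complex \<Rightarrow> complex" where
  "jreg x q = qpoch_inf (q * x) q * qpoch_inf (q / x) q * qpoch_inf q q"

definition jd :: "complex \<Rightarrow> complex \<Rightarrow> complex" where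
  "jd x q = deriv (\<lambda>x. jfun x q) x"

definition jld :: "complex \<Rightarrow> complex \<Rightarrow> complex" where
  "jld x q = x * jd x q / jfun x q"

context nome
begin

section \<open>Analytic properties of j(x;q): zeros, quasi-periodicity, derivatives\<close>

lemma qpoch_inf_holomorphic: "(\<lambda>x. qpoch_inf x q) holomorphic_on UNIV"
proof (rule holomorphic_uniform_sequence)
  fix x :: complex
  let ?R = "norm x + 1"
  have "uniformly_convergent_on (cball 0 ?R) (\<lambda>N x. \<Prod>n<N. 1 - q ^ n * x)"
  proof (rule Complex_Transcendental.uniformly_convergent_on_prod')
    show "uniformly_convergent_on (cball 0 ?R) (\<lambda>N x. \<Sum>n<N. norm (1 - q ^ n * x - 1))"
    proof (rule Weierstrass_m_test')
      show "summable (\<lambda>n. norm q ^ n * ?R)"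
        using norm_q by (intro summable_mult2 summable_geometric) auto
      show "norm (norm (1 - q ^ n * y - 1)) \<le> norm q ^ n * ?R" if "y \<in> cball 0 ?R" for n y
        using that by (auto simp: norm_mult norm_power intro!: mult_left_mono)
    qed
  qed (auto intro!: continuous_intros)
  then obtain l where l: "uniform_limit (cball 0 ?R) (\<lambda>N x. qpoch x q N) l sequentially"
    by (auto simp: uniformly_convergent_on_def qpoch_def)
  have "l y = qpoch_inf y q" if "y \<in> cball 0 ?R" for y
    using tendsto_uniform_limitI[OF l that] qpoch_tendsto[of y] LIMSEQ_unique by blast
  then have "uniform_limit (cball 0 ?R) (\<lambda>N x. qpoch x q N) l sequentially \<longleftrightarrow>
      uniform_limit (cball 0 ?R) (\<lambda>N x. qpoch x q N) (\<lambda>x. qpoch_inf x q) sequentially"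
    by (intro uniform_limit_cong') auto
  with l have "uniform_limit (cball 0 ?R) (\<lambda>N x. qpoch x q N) (\<lambda>x. qpoch_inf x q) sequentially"
    by blast
  then have "uniform_limit (cball x 1) (\<lambda>N x. qpoch x q N) (\<lambda>x. qpoch_inf x q) sequentially"
    by (rule uniform_limit_on_subset) (simp add: cball_subset_cball_iff)
  then show "\<exists>d>0. cball x d \<subseteq> UNIV \<and> uniform_limit (cball x d) (\<lambda>N x. qpoch x q N) (\<lambda>x. qpoch_inf x q) sequentially"
    by (intro exI[of _ 1]) auto
qed (auto simp: qpoch_def intro!: holomorphic_intros)

lemma qpoch_inf_holomorphic_compose:
  "f holomorphic_on A \<Longrightarrow> (\<lambda>x. qpoch_inf (f x) q) holomorphic_on A"
  using holomorphic_on_compose_gen[OF _ qpoch_inf_holomorphic, of f A] by (simp add: o_def)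

lemma jreg_holomorphic: "(\<lambda>x. jreg x q) holomorphic_on - {0}"
  unfolding jreg_def by (intro holomorphic_intros qpoch_inf_holomorphic_compose) auto

lemma jfun_holomorphic: "(\<lambda>x. jfun x q) holomorphic_on - {0}"
  unfolding jfun_def by (intro holomorphic_intros qpoch_inf_holomorphic_compose) auto

lemma jfun_holomorphic_compose:
  assumes "f holomorphic_on A" "\<And>x. x \<in> A \<Longrightarrow> f x \<noteq> 0"
  shows "(\<lambda>x. jfun (f x) q) holomorphic_on A"
proof -
  have "f ` A \<subseteq> - {0}" using assms(2) by auto
  then show ?thesis
    using holomorphic_on_compose_gen[OF assms(1) jfun_holomorphic] by (simp add: o_def)
qed

lemma jfun_deriv: "x \<noteq> 0 \<Longrightarrow> ((\<lambda>x. jfun x q) has_field_derivative jd x q) (at x)"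
  unfolding jd_def using holomorphic_derivI[OF jfun_holomorphic, of x] by auto

lemma jfun_reg: "jfun x q = (1 - x) * jreg x q"
  unfolding jfun_def jreg_def using qpoch_inf_unfold[of x] by simp

lemma jreg_inverse: "jreg (1 / x) q = jreg x q"
  by (simp add: jreg_def mult_ac)

lemma jreg_1: "jreg 1 q = qpoch_inf q q ^ 3"
  by (simp add: jreg_def power3_eq_cube)

text \<open>The function is invariant under x -> 1/x, a map whose derivative at its fixed point 1 is
  -1.\<close>

lemma jreg_deriv_1: "((\<lambda>x. jreg x q) has_field_derivative 0) (at 1)"
proof -
  let ?d = "deriv (\<lambda>x. jreg x q) 1"
  have d: "((\<lambda>x. jreg x q) has_field_derivative ?d) (at 1)"
    using holomorphic_derivI[OF jreg_holomorphic, of 1] by auto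
  have "((\<lambda>x. jreg (1 / x) q) has_field_derivative ?d * (- 1)) (at 1)"
  proof (rule DERIV_chain2[where f = "\<lambda>x. jreg x q" and g = "\<lambda>x. 1 / x"])
    show "((\<lambda>x. jreg x q) has_field_derivative ?d) (at (1 / 1))" using d by simp
    show "((\<lambda>x::complex. 1 / x) has_field_derivative - 1) (at 1)"
      by (auto intro!: derivative_eq_intros)
  qed
  then have "((\<lambda>x. jreg x q) has_field_derivative ?d * (- 1)) (at 1)"
    unfolding jreg_inverse .
  with d have "?d = ?d * (- 1)" by (rule DERIV_unique)
  then show ?thesis using d by simp
qed

lemma jd_1: "jd 1 q = - (qpoch_inf q q ^ 3)"
proof -
  have "((\<lambda>x. (1 - x) * jreg x q) has_field_derivative - jreg 1 q) (at 1)"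
    by (auto intro!: derivative_eq_intros jreg_deriv_1)
  then have "((\<lambda>x. jfun x q) has_field_derivative - jreg 1 q) (at 1)"
    by (simp add: jfun_reg)
  then show ?thesis unfolding jd_def jreg_1[symmetric] by (rule DERIV_imp_deriv)
qed

lemma jfun_1 [simp]: "jfun 1 q = 0"
  by (simp add: jfun_reg)

lemma jfun_q_div: "jfun (q / x) q = jfun x q"
  by (simp add: jfun_def mult_ac)

lemma jfun_inverse:
  assumes "x \<noteq> 0"
  shows "jfun (1 / x) q = - jfun x q / x"
  using assms by (simp add: jfun_reg jreg_inverse field_simps)

lemma jfun_mult_q:
  assumes "x \<noteq> 0"
  shows "jfun (q * x) q = - jfun x q / x"
  using jfun_q_div[of "1 / x"] jfun_inverse[OF assms] by simp

lemma jfun_eq_0_iff: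
  assumes "x \<noteq> 0"
  shows "jfun x q = 0 \<longleftrightarrow> (\<exists>k. x * q powi k = 1)"
proof
  assume "jfun x q = 0"
  then have "qpoch_inf x q = 0 \<or> qpoch_inf (q / x) q = 0"
    by (simp add: jfun_def)
  then consider i where "q ^ i * x = 1" | i where "q ^ i * (q / x) = 1"
    unfolding qpoch_inf_eq_0_iff by blast
  then show "\<exists>k. x * q powi k = 1"
  proof cases
    case 1
    then show ?thesis by (intro exI[of _ "int i"]) (simp add: mult.commute)
  next
    case 2
    then have "x = q ^ Suc i" using assms by (simp add: field_simps)
    then show ?thesis by (intro exI[of _ "- int (Suc i)"]) (simp add: power_int_minus field_simps del: of_nat_Suc)
  qed
next
  assume "\<exists>k. x * q powi k = 1"
  then obtain k where k: "x * q powi k = 1" ..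
  show "jfun x q = 0"
  proof (cases k rule: int_cases2)
    case (nonneg n)
    then have "qpoch_inf x q = 0" using k by (auto simp: qpoch_inf_eq_0_iff mult.commute)
    then show ?thesis by (simp add: jfun_def)
  next
    case (nonpos n)
    then have x: "x = q ^ n" using k by (simp add: power_int_minus field_simps)
    show ?thesis
    proof (cases n)
      case 0
      then show ?thesis using x by simp
    next
      case (Suc m)
      then have "qpoch_inf (q / x) q = 0"
        using x by (auto simp: qpoch_inf_eq_0_iff intro!: exI[of _ m])
      then show ?thesis by (simp add: jfun_def)
    qed
  qed
qed

lemma jld_inverse:
  assumes "x \<noteq> 0" "jfun x q \<noteq> 0"
  shows "jld (1 / x) q = 1 - jld x q"
proof -
  have "((\<lambda>x. jfun (1 / x) q) has_field_derivative jd (1 / x) q * (- 1 / x\<^sup>2)) (at x)"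
    by (rule DERIV_chain2[OF jfun_deriv])
       (use assms in \<open>auto intro!: derivative_eq_intros simp: power2_eq_square field_simps\<close>)
  moreover have "((\<lambda>x. - jfun x q / x) has_field_derivative (- jd x q * x + jfun x q) / x\<^sup>2) (at x)"
    by (rule derivative_eq_intros jfun_deriv refl | use assms in \<open>simp add: power2_eq_square\<close>)+
  then have "((\<lambda>x. jfun (1 / x) q) has_field_derivative (- jd x q * x + jfun x q) / x\<^sup>2) (at x)"
    by (rule has_field_derivative_transform_within_open[of _ _ _ "- {0}"]) (use assms in \<open>auto simp: jfun_inverse\<close>)
  ultimately have "jd (1 / x) q * (- 1 / x\<^sup>2) = (- jd x q * x + jfun x q) / x\<^sup>2"
    by (rule DERIV_unique)
  then have "jd (1 / x) q = jd x q * x - jfun x q"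
    using assms by (simp add: field_simps)
  then show ?thesis
    using assms by (simp add: jld_def jfun_inverse field_simps)
qed

lemma jld_q_div:
  assumes "x \<noteq> 0"
  shows "jld (q / x) q = - jld x q"
proof -
  have "((\<lambda>x. jfun (q / x) q) has_field_derivative jd (q / x) q * (- q / x\<^sup>2)) (at x)"
    by (rule DERIV_chain2[OF jfun_deriv])
       (use assms in \<open>auto intro!: derivative_eq_intros simp: power2_eq_square field_simps\<close>)
  then have "jd (q / x) q * (- q / x\<^sup>2) = jd x q"
    unfolding jfun_q_div using jfun_deriv[OF assms] by (rule DERIV_unique)
  moreover have "q / x * jd (q / x) q = - (x * (jd (q / x) q * (- q / x\<^sup>2)))"
    using assms by (simp add: field_simps power2_eq_square)
  ultimately have "q / x * jd (q / x) q = - (x * jd x q)"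
    by simp
  then show ?thesis
    unfolding jld_def jfun_q_div by simp
qed

section \<open>The addition formula, the Weierstrass relation and two of its specialisations\<close>

definition th0 :: "complex \<Rightarrow> complex" where
  "th0 x = (\<Sum>\<^sub>\<infinity>s. gterm (x\<^sup>2) (q\<^sup>2) s)"

definition th1 :: "complex \<Rightarrow> complex" where
  "th1 x = (\<Sum>\<^sub>\<infinity>s. gterm (x\<^sup>2 * q) (q\<^sup>2) s)"

text \<open>Splitting the double series for \<open>j(xz) j(x/z)\<close> by the parity of the sum of the two
  summation indices separates the variables \<open>x\<close> and \<open>z\<close>.\<close>

lemma jfun_mult_jfun:
  assumes x: "x \<noteq> 0" and z: "z \<noteq> 0"
  shows "jfun (x * z) q * jfun (x / z) q = th0 x * th1 z - x / z * (th1 x * th0 z)"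
proof -
  interpret q2: nome "q\<^sup>2" by (rule nome_power) simp
  let ?f = "\<lambda>(m, n). gterm (- (x * z)) q m * gterm (- (x / z)) q n"
  let ?e = "\<lambda>(s, t). (s + t, s - t) :: int \<times> int"
  let ?o = "\<lambda>(s, t). (s + t + 1, s - t) :: int \<times> int"
  have norm0: "(\<lambda>s. norm (gterm (y\<^sup>2) (q\<^sup>2) s)) summable_on UNIV" if "y \<noteq> 0" for y
    using that by (intro q2.gterm_summable_norm) auto
  have norm1: "(\<lambda>s. norm (gterm (y\<^sup>2 * q) (q\<^sup>2) s)) summable_on UNIV" if "y \<noteq> 0" for y
    using that by (intro q2.gterm_summable_norm) auto
  have sum0: "(gterm (y\<^sup>2) (q\<^sup>2) has_sum th0 y) UNIV" if "y \<noteq> 0" for y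
    unfolding th0_def using norm0[OF that] abs_summable_summable has_sum_infsum by blast
  have sum1: "(gterm (y\<^sup>2 * q) (q\<^sup>2) has_sum th1 y) UNIV" if "y \<noteq> 0" for y
    unfolding th1_def using norm1[OF that] abs_summable_summable has_sum_infsum by blast
  have pw: "q powi a * q powi b = q powi (a + b)" "x powi a * x powi b = x powi (a + b)"
     "z powi a * z powi b = z powi (a + b)" "(- x) powi a * (- x) powi b = (- x) powi (a + b)" for a b
    using x z by (simp_all add: power_int_add)
  have g1: "gterm (- (x * z)) q m * gterm (- (x / z)) q n
     = (- x) powi (m + n) * z powi (m - n) * q powi (tri m + tri n)" for m n
  proof -
    have "(- (x * z)) powi m = (- x) powi m * z powi m"
      using power_int_mult_distrib[of "- x" z m] by simp
    moreover have "(- (x / z)) powi n = (- x) powi n * z powi (- n)"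
      using power_int_mult_distrib[of "- x" "inverse z" n]
      by (simp add: power_int_minus power_int_inverse divide_inverse)
    ultimately have "gterm (- (x * z)) q m * gterm (- (x / z)) q n =
      ((- x) powi m * (- x) powi n) * (z powi m * z powi (- n)) * (q powi tri m * q powi tri n)"
      by (simp only: gterm_def mult_ac)
    then show ?thesis unfolding pw by simp
  qed
  have g0: "gterm (y\<^sup>2) (q\<^sup>2) s = y powi (2 * s) * q powi (2 * tri s)" for y s
    unfolding gterm_def power_int_mult by simp
  have g0': "gterm (y\<^sup>2 * q) (q\<^sup>2) s = y powi (2 * s) * q powi (2 * tri s + s)" for y s
    unfolding gterm_def power_int_mult power_int_mult_distrib power_int_add[OF disjI1[OF q_nz]] by simp
  have even_pow: "(- x) powi (2 * s) = x powi (2 * s)" for s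
    unfolding power_int_mult by simp
  have e: "(?f has_sum (th0 x * th1 z)) (range ?e)"
  proof (subst has_sum_reindex)
    show "inj ?e" by (auto simp: inj_on_def)
    have "?f \<circ> ?e = (\<lambda>(s, t). gterm (x\<^sup>2) (q\<^sup>2) s * gterm (z\<^sup>2 * q) (q\<^sup>2) t)"
    proof (rule ext, clarify)
      fix s t :: int
      have "tri (s + t) + tri (s - t) = 2 * tri s + (2 * tri t + t)"
        using two_tri[of s] two_tri[of t] two_tri[of "s + t"] two_tri[of "s - t"] by (simp add: algebra_simps)
      then show "(?f \<circ> ?e) (s, t) = gterm (x\<^sup>2) (q\<^sup>2) s * gterm (z\<^sup>2 * q) (q\<^sup>2) t"
        using even_pow[of s] pw(1)[of "2 * tri s" "2 * tri t + t"] by (simp add: g1 g0 g0')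
    qed
    then show "(?f \<circ> ?e has_sum th0 x * th1 z) UNIV"
      using has_sum_Times_mult[OF norm0[OF x] sum0[OF x] norm1[OF z] sum1[OF z]] by simp
  qed
  have o: "(?f has_sum (- x / z * (th1 x * th0 z))) (range ?o)"
  proof (subst has_sum_reindex)
    show "inj ?o" by (auto simp: inj_on_def)
    have fo: "?f \<circ> ?o = (\<lambda>p. - x * z * ((\<lambda>(s, t). gterm (x\<^sup>2 * q) (q\<^sup>2) s * gterm (z\<^sup>2) (q\<^sup>2) (t + 1) / z\<^sup>2) p))"
    proof (rule ext, clarify)
      fix s t :: int
      have t: "tri (s + t + 1) + tri (s - t) = (2 * tri s + s) + 2 * tri (t + 1)"
        using two_tri[of s] two_tri[of "t + 1"] two_tri[of "s + t + 1"] two_tri[of "s - t"] by (simp add: algebra_simps)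
      have m: "(- x) powi (2 * s + 1) = - x * x powi (2 * s)"
        using even_pow[of s] x by (simp add: power_int_add)
      have z': "z powi (2 * t + 1) = z * (z powi (2 * (t + 1)) / z\<^sup>2)"
        using z by (simp add: power_int_add algebra_simps)
      have i: "s + t + 1 + (s - t) = 2 * s + 1" "s + t + 1 - (s - t) = 2 * t + 1" by auto
      show "(?f \<circ> ?o) (s, t) = - x * z * (gterm (x\<^sup>2 * q) (q\<^sup>2) s * gterm (z\<^sup>2) (q\<^sup>2) (t + 1) / z\<^sup>2)"
        unfolding o_def prod.case g1 g0 g0' t i m z' pw(1)[of "2 * tri s + s" "2 * tri (t + 1)", symmetric] by simp
    qed
    have "(gterm (z\<^sup>2) (q\<^sup>2) has_sum th0 z) UNIV \<longleftrightarrow> ((\<lambda>t. gterm (z\<^sup>2) (q\<^sup>2) (t + 1)) has_sum th0 z) UNIV"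
      by (rule has_sum_reindex_bij_betw[symmetric]) (rule bij_betwI[of _ _ _ "\<lambda>k. k - 1"], auto)
    then have s2: "((\<lambda>t. gterm (z\<^sup>2) (q\<^sup>2) (t + 1) / z\<^sup>2) has_sum th0 z / z\<^sup>2) UNIV"
      using sum0[OF z] by (intro has_sum_divide_const) auto
    have s1: "(\<lambda>t. norm (gterm (z\<^sup>2) (q\<^sup>2) (t + 1) / z\<^sup>2)) summable_on UNIV"
    proof -
      have "(\<lambda>t. norm (gterm (z\<^sup>2) (q\<^sup>2) (t + 1))) summable_on UNIV \<longleftrightarrow> (\<lambda>t. norm (gterm (z\<^sup>2) (q\<^sup>2) t)) summable_on UNIV"
        by (rule summable_on_reindex_bij_betw) (rule bij_betwI[of _ _ _ "\<lambda>k. k - 1"], auto)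
      with norm0[OF z] have "(\<lambda>t. norm (gterm (z\<^sup>2) (q\<^sup>2) (t + 1))) summable_on UNIV" by blast
      from summable_on_cmult_left[OF this, of "norm (inverse (z\<^sup>2))"] show ?thesis
        by (simp only: divide_inverse norm_mult)
    qed
    have "(?f \<circ> ?o has_sum - x * z * (th1 x * (th0 z / z\<^sup>2))) UNIV"
      unfolding fo using has_sum_cmult_right[OF has_sum_Times_mult[OF norm1[OF x] sum1[OF x] s1 s2], of "- x * z"]
      by (simp only: UNIV_Times_UNIV times_divide_eq_right)
    then show "(?f \<circ> ?o has_sum - x / z * (th1 x * th0 z)) UNIV"
      using z by (simp add: power2_eq_square field_simps)
  qed
  have "range ?e \<inter> range ?o = {}"
  proof -
    have "s + t \<noteq> s' + t' + 1 \<or> s - t \<noteq> s' - t'" for s t s' t' :: int by presburger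
    then show ?thesis by auto
  qed
  from has_sum_Un_disjoint[OF e o this]
  have "(?f has_sum (th0 x * th1 z + - x / z * (th1 x * th0 z))) (range ?e \<union> range ?o)" .
  moreover have "range ?e \<union> range ?o = UNIV"
  proof -
    have "(m, n) \<in> range ?e \<union> range ?o" for m n
    proof (cases "even (m + n)")
      case True
      then have "m = (m + n) div 2 + (m - n) div 2 \<and> n = (m + n) div 2 - (m - n) div 2"
        by presburger
      then have "(m, n) = ?e ((m + n) div 2, (m - n) div 2)" by simp
      then show ?thesis by blast
    next
      case False
      then have "m = (m + n - 1) div 2 + (m - n - 1) div 2 + 1 \<and> n = (m + n - 1) div 2 - (m - n - 1) div 2"
        by presburger
      then have "(m, n) = ?o ((m + n - 1) div 2, (m - n - 1) div 2)" by simp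
      then show ?thesis by blast
    qed
    then show ?thesis by auto
  qed
  moreover have "(?f has_sum (jfun (x * z) q * jfun (x / z) q)) (UNIV \<times> UNIV)"
    by (rule has_sum_Times_mult) (use x z in \<open>auto intro!: gterm_summable_norm jfun_has_sum\<close>)
  ultimately have "jfun (x * z) q * jfun (x / z) q = th0 x * th1 z + - x / z * (th1 x * th0 z)"
    by (auto intro: has_sum_unique)
  then show ?thesis by simp
qed

text \<open>The division by x makes the product of the two theta functions antisymmetric in x and
  z.\<close>

definition jj :: "complex \<Rightarrow> complex \<Rightarrow> complex" where
  "jj x z = jfun (x * z) q * jfun (x / z) q / x"

text \<open>By \<open>jfun_mult_jfun\<close>, \<open>jj x z\<close> is the determinant with columns
  (\<open>a x\<close>, \<open>th1 x\<close>) and (\<open>a z\<close>, \<open>th1 z\<close>), so this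
  is the Pluecker relation between 2 x 2 minors.\<close>

theorem weierstrass:
  assumes "x \<noteq> 0" "y \<noteq> 0" "u \<noteq> 0" "v \<noteq> 0"
  shows "jj x y * jj u v = jj x u * jj y v - jj x v * jj y u"
proof -
  define a where "a x = th0 x / x" for x
  have eq: "jj x z = a x * th1 z - th1 x * a z" if "x \<noteq> 0" "z \<noteq> 0" for x z
    unfolding jj_def jfun_mult_jfun[OF that] a_def using that by (simp add: field_simps)
  show ?thesis unfolding eq[OF assms(1,2)] eq[OF assms(3,4)] eq[OF assms(1,3)] eq[OF assms(2,4)]
      eq[OF assms(1,4)] eq[OF assms(2,3)]
    by (simp add: algebra_simps)
qed

text \<open>The Weierstrass relation at x^3, x^2, x, 1. If x^7 equals the nome, reflection
  identifies the arguments x^4, x^5 with x^3, x^2, and the relation becomes Klein's quartic.\<close>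

lemma jfun_quartic:
  assumes "x \<noteq> 0"
  shows "x * jfun (x ^ 5) q * jfun x q ^ 3 = jfun (x ^ 4) q * jfun (x ^ 2) q ^ 3 - jfun (x ^ 3) q ^ 3 * jfun x q"
proof -
  have "jj (x ^ 3) (x ^ 2) * jj x 1 = jj (x ^ 3) x * jj (x ^ 2) 1 - jj (x ^ 3) 1 * jj (x ^ 2) x"
    by (rule weierstrass) (use assms in auto)
  moreover have "x ^ 3 * x ^ 2 = x ^ 5" "x ^ 3 / x ^ 2 = x" "x ^ 3 * x = x ^ 4" "x ^ 3 / x = x ^ 2" "x\<^sup>2 * x = x ^ 3" "x\<^sup>2 / x = x"
    using assms by (simp_all add: eval_nat_numeral)
  moreover have alg: "a / x ^ 3 * (b / x) = c / x ^ 3 * (d / x ^ 2) - e / x ^ 3 * (f / x ^ 2) \<Longrightarrow>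
      x * (a * b) = c * d - e * f" for a b c d e f
    using assms by (simp add: field_simps eval_nat_numeral)
  ultimately have "jfun (x ^ 5) q * jfun x q / x ^ 3 * (jfun x q * jfun x q / x)
    = jfun (x ^ 4) q * jfun (x ^ 2) q / x ^ 3 * (jfun (x ^ 2) q * jfun (x ^ 2) q / x ^ 2)
      - jfun (x ^ 3) q * jfun (x ^ 3) q / x ^ 3 * (jfun (x ^ 3) q * jfun x q / x ^ 2)"
    by (simp add: jj_def)
  from alg[OF this] show ?thesis by (simp add: power2_eq_square power3_eq_cube mult_ac)
qed

text \<open>The derivative of the Weierstrass relation at \<open>u = v\<close>.\<close>

lemma jld_relation:
  assumes nz: "x \<noteq> 0" "y \<noteq> 0" "v \<noteq> 0"
    and j: "jfun (x * v) q \<noteq> 0" "jfun (x / v) q \<noteq> 0" "jfun (y * v) q \<noteq> 0" "jfun (y / v) q \<noteq> 0"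
  shows "- (qpoch_inf q q ^ 3) * jfun (v\<^sup>2) q * jj x y / v =
    jj x v * jj y v * (jld (x * v) q - jld (x / v) q - jld (y * v) q + jld (y / v) q)"
proof -
  \<comment> \<open>Since j(1) = 0, only the derivative of the vanishing factor contributes, which
    is -(q)_inf^3 by \<open>jd_1\<close>.\<close>
  have d1: "((\<lambda>s. jj (v * s) v) has_field_derivative - (qpoch_inf q q ^ 3) * jfun (v\<^sup>2) q / v) (at 1)"
  proof -
    have "((\<lambda>s. jfun (v\<^sup>2 * s) q) has_field_derivative jd (v\<^sup>2 * 1) q * v\<^sup>2) (at 1)"
      by (rule DERIV_chain2[OF jfun_deriv]) (use nz in \<open>auto intro!: derivative_eq_intros\<close>)
    then have "((\<lambda>s. jfun (v\<^sup>2 * s) q * jfun s q / (v * s)) has_field_derivative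
        ((jd (v\<^sup>2 * 1) q * v\<^sup>2 * jfun 1 q + jd 1 q * jfun (v\<^sup>2 * 1) q) * (v * 1) - jfun (v\<^sup>2 * 1) q * jfun 1 q * v)
          / ((v * 1) * (v * 1))) (at 1)"
      using nz by (intro DERIV_divide DERIV_mult jfun_deriv) (auto intro!: derivative_eq_intros)
    moreover have "jfun (v\<^sup>2 * s) q * jfun s q / (v * s) = jj (v * s) v" for s
      using nz by (simp add: jj_def power2_eq_square mult_ac)
    ultimately show ?thesis using nz by (simp add: jd_1 mult_ac)
  qed
  have d2: "((\<lambda>s. jj a (v * s)) has_field_derivative jj a v * (jld (a * v) q - jld (a / v) q)) (at 1)"
    if a: "a \<noteq> 0" "jfun (a * v) q \<noteq> 0" "jfun (a / v) q \<noteq> 0" for a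
  proof -
    have "((\<lambda>s. jfun (a * (v * s)) q) has_field_derivative jd (a * (v * 1)) q * (a * v)) (at 1)"
      by (rule DERIV_chain2[OF jfun_deriv]) (use nz a in \<open>auto intro!: derivative_eq_intros\<close>)
    moreover have "((\<lambda>s. jfun (a / (v * s)) q) has_field_derivative jd (a / (v * 1)) q * - (a / v)) (at 1)"
      by (rule DERIV_chain2[OF jfun_deriv]) (use nz a in \<open>auto intro!: derivative_eq_intros simp: power2_eq_square\<close>)
    ultimately have "((\<lambda>s. jj a (v * s)) has_field_derivative
        (jd (a * (v * 1)) q * (a * v) * jfun (a / (v * 1)) q + jd (a / (v * 1)) q * - (a / v) * jfun (a * (v * 1)) q) / a) (at 1)"
      unfolding jj_def by (intro DERIV_cdivide DERIV_mult)
    moreover have "(jd (a * (v * 1)) q * (a * v) * jfun (a / (v * 1)) q + jd (a / (v * 1)) q * - (a / v) * jfun (a * (v * 1)) q) / a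
      = jj a v * (jld (a * v) q - jld (a / v) q)"
      using a nz by (simp add: jj_def jld_def field_simps)
    ultimately show ?thesis by simp
  qed
  have d4: "((\<lambda>s. jj x y * jj (v * s) v) has_field_derivative jj x y * (- (qpoch_inf q q ^ 3) * jfun (v\<^sup>2) q / v)) (at 1)"
    by (intro DERIV_cmult d1)
  have "((\<lambda>s. jj x (v * s) * jj y v - jj x v * jj y (v * s)) has_field_derivative
      jj x v * (jld (x * v) q - jld (x / v) q) * jj y v - jj x v * (jj y v * (jld (y * v) q - jld (y / v) q))) (at 1)"
    by (intro DERIV_diff DERIV_cmult DERIV_cmult_right d2 nz j)
  moreover have "jj x (v * s) * jj y v - jj x v * jj y (v * s) = jj x y * jj (v * s) v" if "s \<noteq> 0" for s
    by (rule weierstrass[symmetric]) (use nz that in auto)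
  ultimately have d3: "((\<lambda>s. jj x y * jj (v * s) v) has_field_derivative
      jj x v * (jld (x * v) q - jld (x / v) q) * jj y v - jj x v * (jj y v * (jld (y * v) q - jld (y / v) q))) (at 1)"
    by (elim has_field_derivative_transform_within_open[of _ _ _ "- {0}"]) auto
  have "jj x y * (- (qpoch_inf q q ^ 3) * jfun (v\<^sup>2) q / v)
     = jj x v * (jld (x * v) q - jld (x / v) q) * jj y v - jj x v * (jj y v * (jld (y * v) q - jld (y / v) q))"
    using d4 d3 by (rule DERIV_unique)
  then show ?thesis by (simp add: algebra_simps)
qed

text \<open>\<open>jld_relation\<close> at the points 1, x^3 and v = x, where the arguments are x,
  1/x, x^4, x^2; \<open>jld_inverse\<close> removes 1/x and is the origin of the constant 1.\<close>

lemma jld_sum: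
  assumes x: "x \<noteq> 0" and j: "jfun x q \<noteq> 0" "jfun (x ^ 2) q \<noteq> 0" "jfun (x ^ 4) q \<noteq> 0"
  shows "qpoch_inf q q ^ 3 * jfun (x ^ 3) q ^ 2 =
    jfun x q ^ 2 * jfun (x ^ 4) q * (1 - 2 * jld x q - jld (x ^ 2) q + jld (x ^ 4) q)"
proof -
  have j1: "jfun (1 / x) q \<noteq> 0" using x j by (simp add: jfun_inverse)
  have e: "x ^ 3 * x = x ^ 4" "x ^ 3 / x = x ^ 2"
    using x by (simp_all add: eval_nat_numeral)
  have "- (qpoch_inf q q ^ 3) * jfun (x\<^sup>2) q * jj 1 (x ^ 3) / x =
    jj 1 x * jj (x ^ 3) x * (jld (1 * x) q - jld (1 / x) q - jld (x ^ 3 * x) q + jld (x ^ 3 / x) q)"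
    by (rule jld_relation) (use x j j1 e in auto)
  then have "- (qpoch_inf q q ^ 3) * jfun (x\<^sup>2) q * (jfun (x ^ 3) q * (- jfun (x ^ 3) q / x ^ 3)) / x =
    jfun x q * (- jfun x q / x) * (jfun (x ^ 4) q * jfun (x ^ 2) q / x ^ 3) * (2 * jld x q - 1 - jld (x ^ 4) q + jld (x ^ 2) q)"
    unfolding jj_def e using x by (simp add: jfun_inverse jld_inverse[OF x j(1)])
  moreover have "- P * b * (c * (- c / x ^ 3)) / x = a * (- a / x) * (d * b / x ^ 3) * L \<Longrightarrow>
      b * (P * c ^ 2) = b * (a ^ 2 * d * - L)" for P a b c d L
    using x by (simp add: field_simps power2_eq_square)
  ultimately have "jfun (x\<^sup>2) q * (qpoch_inf q q ^ 3 * jfun (x ^ 3) q ^ 2) =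
    jfun (x\<^sup>2) q * (jfun x q ^ 2 * jfun (x ^ 4) q * - (2 * jld x q - 1 - jld (x ^ 4) q + jld (x ^ 2) q))"
    by blast
  then have "qpoch_inf q q ^ 3 * jfun (x ^ 3) q ^ 2 =
    jfun x q ^ 2 * jfun (x ^ 4) q * - (2 * jld x q - 1 - jld (x ^ 4) q + jld (x ^ 2) q)"
    using mult_left_cancel[OF j(2)] by blast
  then show ?thesis by (simp add: algebra_simps)
qed

end

section \<open>Lambert series of level three\<close>

text \<open>The simple zeros of j(x;q) lie exactly at the poles of the series. At such a point the
  literal product is 0, since both j and the singular term are 0 there; \<open>remove_sings\<close>
  replaces it by the limit.\<close>

definition lambert_ext :: "complex \<Rightarrow> (int \<Rightarrow> complex) \<Rightarrow> complex \<Rightarrow> complex" where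
  "lambert_ext q c = remove_sings (\<lambda>x. jfun x q * (\<Sum>\<^sub>\<infinity>k. c k / (1 - x * q powi k)))"

context nome
begin

section \<open>Holomorphic continuation of Lambert series multiplied by j(x;q)\<close>

lemma finite_near_poles:
  assumes "x \<noteq> 0"
  shows "finite {k. 1 / 4 \<le> norm (x * q powi k) \<and> norm (x * q powi k) \<le> 4}"
proof -
  have "(\<lambda>n. norm x * norm q ^ n) \<longlonglongrightarrow> norm x * 0"
    by (intro tendsto_intros LIMSEQ_power_zero) (use norm_q in auto)
  then have "\<forall>\<^sub>F n in sequentially. norm x * norm q ^ n < 1 / 4"
    by (rule order_tendstoD) auto
  then obtain M where M: "norm x * norm q ^ n < 1 / 4" if "n \<ge> M" for n
    by (auto simp: eventually_sequentially)
  have "(\<lambda>n. norm q ^ n / norm x) \<longlonglongrightarrow> 0 / norm x"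
    by (intro tendsto_intros LIMSEQ_power_zero) (use norm_q assms in auto)
  then have "\<forall>\<^sub>F n in sequentially. norm q ^ n / norm x < 1 / 4"
    by (rule order_tendstoD) auto
  then obtain N where N: "norm q ^ n / norm x < 1 / 4" if "n \<ge> N" for n
    by (auto simp: eventually_sequentially)
  have "{k. 1 / 4 \<le> norm (x * q powi k) \<and> norm (x * q powi k) \<le> 4} \<subseteq> {- int N..int M}"
  proof safe
    fix k assume k: "1 / 4 \<le> norm (x * q powi k)" "norm (x * q powi k) \<le> 4"
    have "k \<le> int M"
    proof (rule ccontr)
      assume "\<not> k \<le> int M"
      then have "norm x * norm q ^ nat k < 1 / 4" by (intro M) auto
      then show False using k(1) \<open>\<not> k \<le> int M\<close> by (simp add: norm_mult norm_power power_int_def)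
    qed
    moreover have "- int N \<le> k"
    proof (rule ccontr)
      assume c: "\<not> - int N \<le> k"
      then have "norm q ^ nat (- k) / norm x < 1 / 4" by (intro N) auto
      then have "norm q ^ nat (- k) < norm x / 4"
        using assms by (simp add: field_simps)
      moreover have "norm (x * q powi k) = norm x / norm q ^ nat (- k)"
        using c by (simp add: norm_mult norm_power power_int_def norm_inverse divide_inverse power_inverse)
      then have "norm x = norm q ^ nat (- k) * norm (x * q powi k)" by simp
      moreover have "norm q ^ nat (- k) * norm (x * q powi k) \<le> norm q ^ nat (- k) * 4"
        by (intro mult_left_mono k) auto
      ultimately show False by linarith
    qed
    ultimately show "k \<in> {- int N..int M}" by simp
  qed
  then show ?thesis by (rule finite_subset) simp
qed

lemma lambert_analytic:
  assumes c: "(\<lambda>k. norm (c k)) summable_on UNIV" and x: "x \<noteq> 0"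
    and K: "\<And>k. k \<in> K \<Longrightarrow> x * q powi k \<noteq> 1"
  shows "(\<lambda>y. \<Sum>\<^sub>\<infinity>k\<in>K. c k / (1 - y * q powi k)) analytic_on {x}"
proof -
  \<comment> \<open>For |y - x| \<le> |x|/2 the ratio |y| / |x| lies between 1/2 and 3/2. So if |x
    q^k| is below 1/4 or above 4, then |y q^k| is at most 1/2 or at least 2, and the denominator has
    norm at least 1/2. The bounds 1/4 and 4 leave only finitely many other k.\<close>
  define S where "S = {k. 1 / 4 \<le> norm (x * q powi k) \<and> norm (x * q powi k) \<le> 4}"
  have S: "finite S" unfolding S_def by (rule finite_near_poles[OF x])
  let ?r = "norm x / 2"
  let ?f = "\<lambda>k y. c k / (1 - y * q powi k)"
  have far: "norm (1 - y * q powi k) \<ge> 1 / 2" if y: "y \<in> cball x ?r" and k: "k \<notin> S" for y k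
  proof -
    have d: "norm (x - y) \<le> norm x / 2" using y by (simp add: dist_norm)
    have ny: "norm y \<le> 3 / 2 * norm x" "norm y \<ge> norm x / 2"
      using d norm_triangle_ineq2[of y x] norm_triangle_ineq2[of x y] by (auto simp: norm_minus_commute)
    consider "norm (x * q powi k) < 1 / 4" | "norm (x * q powi k) > 4"
      using k by (auto simp: S_def)
    then show ?thesis
    proof cases
      case 1
      have "norm (y * q powi k) \<le> 3 / 2 * norm x * norm (q powi k)"
        unfolding norm_mult by (intro mult_right_mono ny) auto
      also have "\<dots> = 3 / 2 * norm (x * q powi k)" by (simp add: norm_mult)
      finally have "norm (y * q powi k) \<le> 1 / 2" using 1 by linarith
      then show ?thesis using norm_triangle_ineq2[of 1 "y * q powi k"] by simp
    next
      case 2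
      have "norm x / 2 * norm (q powi k) \<le> norm (y * q powi k)"
        unfolding norm_mult by (intro mult_right_mono ny) auto
      moreover have "norm x / 2 * norm (q powi k) = 1 / 2 * norm (x * q powi k)" by (simp add: norm_mult)
      ultimately have "norm (y * q powi k) \<ge> 2" using 2 by linarith
      then show ?thesis using norm_triangle_ineq2[of "y * q powi k" 1] by (simp add: norm_minus_commute)
    qed
  qed
  have bd: "norm (?f k y) \<le> 2 * norm (c k)" if "k \<in> K - S" "y \<in> cball x ?r" for k y
  proof -
    have "1 \<le> 2 * norm (1 - y * q powi k)" using far[OF that(2), of k] that(1) by simp
    then have "norm (c k) * 1 \<le> norm (c k) * (2 * norm (1 - y * q powi k))"
      by (intro mult_left_mono) auto
    then show ?thesis by (auto simp: norm_divide divide_le_eq mult_ac)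
  qed
  have ul: "uniform_limit (cball x ?r) (\<lambda>X y. \<Sum>k\<in>X. ?f k y) (\<lambda>y. \<Sum>\<^sub>\<infinity>k\<in>K - S. ?f k y) (finite_subsets_at_top (K - S))"
  proof (rule Weierstrass_m_test_general[OF bd])
    show "(\<lambda>k. 2 * norm (c k)) summable_on K - S"
      using summable_on_cmult_right[OF summable_on_subset_banach[OF c, of "K - S"], of 2] by simp
  qed
  have hol: "(\<lambda>y. \<Sum>k\<in>X. ?f k y) holomorphic_on cball x ?r" if "X \<subseteq> K - S" for X
  proof (intro holomorphic_intros)
    fix k y assume "k \<in> X" "y \<in> cball x ?r"
    then show "1 - y * q powi k \<noteq> 0" using far[of y k] that by auto
  qed
  have "(\<lambda>y. \<Sum>\<^sub>\<infinity>k\<in>K - S. ?f k y) holomorphic_on ball x ?r"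
  proof (rule holomorphic_uniform_limit[OF _ ul])
    show "\<forall>\<^sub>F X in finite_subsets_at_top (K - S). continuous_on (cball x ?r) (\<lambda>y. \<Sum>k\<in>X. ?f k y) \<and>
        (\<lambda>y. \<Sum>k\<in>X. ?f k y) holomorphic_on ball x ?r"
      by (rule eventually_finite_subsets_at_top_weakI)
         (use hol holomorphic_on_subset[OF hol ball_subset_cball] in \<open>auto intro: holomorphic_on_imp_continuous_on\<close>)
  qed auto
  then have 1: "(\<lambda>y. \<Sum>\<^sub>\<infinity>k\<in>K - S. ?f k y) analytic_on {x}"
    by (rule holomorphic_on_imp_analytic_at) (use x in auto)
  have 2: "(\<lambda>y. \<Sum>k\<in>K \<inter> S. ?f k y) analytic_on {x}"
    using K by (intro analytic_intros) auto
  have "(\<Sum>\<^sub>\<infinity>k\<in>K. ?f k y) = (\<Sum>k\<in>K \<inter> S. ?f k y) + (\<Sum>\<^sub>\<infinity>k\<in>K - S. ?f k y)" for y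
  proof -
    have s: "(\<lambda>k. ?f k y) summable_on UNIV"
      by (rule abs_summable_summable[OF lambert_summable_norm[OF c]])
    have "(\<Sum>\<^sub>\<infinity>k\<in>(K \<inter> S) \<union> (K - S). ?f k y) = (\<Sum>\<^sub>\<infinity>k\<in>K \<inter> S. ?f k y) + (\<Sum>\<^sub>\<infinity>k\<in>K - S. ?f k y)"
      by (rule infsum_Un_disjoint) (auto intro!: summable_on_subset_banach[OF s])
    then show ?thesis using S by (simp add: Int_Diff_Un)
  qed
  then show ?thesis using analytic_on_add[OF 2 1] by simp
qed

lemma jfun_div_tendsto:
  assumes x: "x * q powi k = 1"
  shows "((\<lambda>y. jfun y q / (1 - y * q powi k)) \<longlongrightarrow> - x * jd x q) (at x)"
proof -
  have nz: "x \<noteq> 0" using x by auto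
  have "jfun x q = 0" using jfun_eq_0_iff[OF nz] x by blast
  then have "((\<lambda>y. jfun y q / (y - x)) \<longlongrightarrow> jd x q) (at x)"
    using jfun_deriv[OF nz] by (simp add: has_field_derivative_iff)
  then have "((\<lambda>y. - x * (jfun y q / (y - x))) \<longlongrightarrow> - x * jd x q) (at x)"
    by (intro tendsto_intros)
  moreover have "- x * (jfun y q / (y - x)) = jfun y q / (1 - y * q powi k)" for y
  proof -
    have k: "q powi k = 1 / x" using x nz by (simp add: field_simps)
    show ?thesis unfolding k using nz by (simp add: divide_simps) (simp add: algebra_simps)
  qed
  ultimately show ?thesis by simp
qed

lemma eventually_neq_0: "\<forall>\<^sub>F y in at x. y \<noteq> 0" if "x \<noteq> 0" for x :: complex
  using eventually_at_in_open'[of "- {0}" x] open_Compl[OF closed_singleton, of 0] that by simp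

lemma eventually_jfun_nz:
  assumes "x \<noteq> 0"
  shows "\<forall>\<^sub>F y in at x. jfun y q \<noteq> 0"
proof (cases "jfun x q = 0")
  case False
  have "isCont (\<lambda>y. jfun y q) x" using jfun_deriv[OF assms] by (rule DERIV_isCont)
  then have "((\<lambda>y. jfun y q) \<longlongrightarrow> jfun x q) (at x)" by (simp add: isCont_def)
  then show ?thesis using False by (rule tendsto_imp_eventually_ne)
next
  case True
  \<comment> \<open>The point -1 shows that j is not identically zero, so that its zeros are
    isolated.\<close>
  have "jfun (- 1) q \<noteq> 0"
  proof
    assume "jfun (- 1) q = 0"
    then obtain k where k: "- 1 * q powi k = 1" by (auto simp: jfun_eq_0_iff)
    then have "(- 1 * q powi k)\<^sup>2 = 1" by simp
    then have "q powi (2 * k) = 1" using power_int_mult[of q k 2] by (simp add: mult.commute)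
    then have "k = 0" by (simp add: powi_eq_1_iff)
    then show False using k by simp
  qed
  moreover have "connected (- {0 :: complex})"
    by (rule connected_punctured_universe) simp
  ultimately obtain r where "r > 0" "\<And>z. z \<in> ball x r - {x} \<Longrightarrow> jfun z q \<noteq> 0"
    using isolated_zeros[OF jfun_holomorphic, of x "- 1"] True assms by (auto simp: open_delete)
  then show ?thesis
    unfolding eventually_at by (auto simp: dist_commute)
qed

text \<open>At a zero of j exactly one index k is singular. That term has the limit
  \<open>c k * (- x * jd x q)\<close>, while the remaining series is analytic and is multiplied by j
  = 0. At x = 1 the index is 0 and \<open>jd_1\<close> gives the value.\<close>

lemma lambert_ext:
  fixes c :: "int \<Rightarrow> complex"
  assumes c: "(\<lambda>k. norm (c k)) summable_on UNIV"
  shows "lambert_ext q c holomorphic_on - {0}"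
    and "\<And>x. x \<noteq> 0 \<Longrightarrow> jfun x q \<noteq> 0 \<Longrightarrow> lambert_ext q c x = jfun x q * (\<Sum>\<^sub>\<infinity>k. c k / (1 - x * q powi k))"
    and "lambert_ext q c 1 = c 0 * qpoch_inf q q ^ 3"
proof -
  let ?f = "\<lambda>k y. c k / (1 - y * q powi k)"
  let ?F = "\<lambda>x. jfun x q * (\<Sum>\<^sub>\<infinity>k. ?f k x)"
  have jan: "(\<lambda>y. jfun y q) analytic_on {x}" if "x \<noteq> 0" for x
    using jfun_holomorphic that by (auto simp: analytic_at intro!: exI[of _ "- {0}"])
  have reg: "?F analytic_on {x}" if "x \<noteq> 0" "jfun x q \<noteq> 0" for x
    using that by (intro analytic_intros jan lambert_analytic[OF c]) (auto simp: jfun_eq_0_iff)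
  have pole: "(?F \<longlongrightarrow> c k * (- x * jd x q)) (at x)" if "x * q powi k = 1" for x k
  proof -
    have nz: "x \<noteq> 0" using that by auto
    have j0: "jfun x q = 0" using jfun_eq_0_iff[OF nz] that by blast
    have uniq: "l = k" if "x * q powi l = 1" for l
    proof -
      have "x * q powi l = x * q powi k" using that \<open>x * q powi k = 1\<close> by simp
      then have "q powi (l - k) = 1" using nz by (simp add: power_int_diff)
      then show ?thesis by (simp add: powi_eq_1_iff)
    qed
    let ?R = "\<lambda>y. \<Sum>\<^sub>\<infinity>k\<in>- {k}. ?f k y"
    have "?R analytic_on {x}"
      by (rule lambert_analytic[OF c nz]) (use uniq in auto)
    then have "(?R \<longlongrightarrow> ?R x) (at x)"
      using analytic_at_imp_isCont isCont_def by blast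
    moreover have "((\<lambda>y. jfun y q) \<longlongrightarrow> jfun x q) (at x)"
      using DERIV_isCont[OF jfun_deriv[OF nz]] by (simp add: isCont_def)
    ultimately have "((\<lambda>y. c k * (jfun y q / (1 - y * q powi k)) + jfun y q * ?R y) \<longlongrightarrow>
        c k * (- x * jd x q) + jfun x q * ?R x) (at x)"
      by (intro tendsto_intros jfun_div_tendsto that)
    moreover have "c k * (jfun y q / (1 - y * q powi k)) + jfun y q * ?R y = ?F y" for y
    proof -
      have s: "(\<lambda>k. ?f k y) summable_on UNIV"
        by (rule abs_summable_summable[OF lambert_summable_norm[OF c]])
      have "(\<Sum>\<^sub>\<infinity>k\<in>{k} \<union> - {k}. ?f k y) = (\<Sum>\<^sub>\<infinity>k\<in>{k}. ?f k y) + ?R y"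
        by (rule infsum_Un_disjoint) (auto intro!: summable_on_subset_banach[OF s])
      then have "(\<Sum>\<^sub>\<infinity>k. ?f k y) = ?f k y + ?R y" by simp
      then show ?thesis by (simp add: algebra_simps)
    qed
    ultimately show ?thesis by (simp add: j0)
  qed
  have iso: "isolated_singularity_at ?F x" if "x \<noteq> 0" for x
    unfolding isolated_singularity_at_altdef
    using eventually_jfun_nz[OF that] eventually_neq_0[OF that] by eventually_elim (rule reg)
  have "lambert_ext q c analytic_on {x}" if "x \<noteq> 0" for x
  proof (cases "jfun x q = 0")
    case False
    then show ?thesis unfolding lambert_ext_def by (intro remove_sings_analytic_on reg that)
  next
    case True
    then show ?thesis unfolding lambert_ext_def using pole that remove_sings_analytic_at[OF iso[OF that]]
      by (auto simp: jfun_eq_0_iff)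
  qed
  then have "lambert_ext q c analytic_on - {0}"
    by (subst analytic_on_analytic_at) auto
  then show "lambert_ext q c holomorphic_on - {0}"
    by (rule analytic_imp_holomorphic)
  show "lambert_ext q c x = ?F x" if "x \<noteq> 0" "jfun x q \<noteq> 0" for x
    unfolding lambert_ext_def by (rule remove_sings_at_analytic[OF reg[OF that]])
  show "lambert_ext q c 1 = c 0 * qpoch_inf q q ^ 3"
    unfolding lambert_ext_def using pole[of 1 0] by (intro remove_sings_eqI) (simp add: jd_1)
qed

text \<open>Every orbit under multiplication by q meets the compact annulus |q| \<le> |z| \<le> 1,
  so f is bounded on the punctured plane. Composition with \<open>exp\<close> makes it entire, and
  Liouville's theorem applies.\<close>

lemma elliptic_constant:
  assumes hol: "f holomorphic_on - {0}" and per: "\<And>z. z \<noteq> 0 \<Longrightarrow> f (q * z) = f z"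
    and "z \<noteq> 0" "w \<noteq> 0"
  shows "f z = f w"
proof -
  have per': "f (z * q powi k) = f z" if "z \<noteq> 0" for z k
  proof -
    have nat: "f (z * q ^ n) = f z" if "z \<noteq> 0" for z n
    proof (induction n)
      case (Suc n)
      then show ?case using per[of "z * q ^ n"] that by (simp add: mult_ac)
    qed simp
    show ?thesis
    proof (cases k rule: int_cases2)
      case (nonneg n)
      then show ?thesis using nat that by simp
    next
      case (nonpos n)
      then show ?thesis using nat[of "z * q powi k" n] that by (simp add: power_int_minus mult.assoc)
    qed
  qed
  let ?A = "cball 0 1 - ball 0 (norm q) :: complex set"
  have annulus: "\<exists>k. z * q powi k \<in> ?A" if "z \<noteq> 0" for z
  proof -
    let ?L = "ln (norm q)"
    have L: "?L < 0" using norm_q by simp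
    define k where "k = \<lceil>ln (norm z) / - ?L\<rceil>"
    have "ln (norm z) / - ?L \<le> of_int k" "of_int k < ln (norm z) / - ?L + 1"
      unfolding k_def by linarith+
    then have k: "ln (norm z) + of_int k * ?L \<le> 0" "ln (norm z) + of_int k * ?L \<ge> ?L"
      using L by (auto simp: field_simps)
    have "norm (q powi k) = exp (of_int k * ?L)"
      by (simp add: norm_power_int powr_real_of_int' [symmetric] powr_def)
    then have "norm (z * q powi k) = exp (ln (norm z) + of_int k * ?L)"
      using that by (simp add: norm_mult exp_add)
    moreover have "exp ?L = norm q" by simp
    ultimately have "norm q \<le> norm (z * q powi k)" "norm (z * q powi k) \<le> 1"
      using k exp_le_cancel_iff[of ?L "ln (norm z) + of_int k * ?L"] by auto
    then show ?thesis by (intro exI[of _ k]) auto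
  qed
  have "compact ?A" by (intro compact_diff) auto
  moreover have "0 \<notin> ?A" by simp
  then have "continuous_on ?A f"
    by (intro holomorphic_on_imp_continuous_on[OF holomorphic_on_subset[OF hol]]) auto
  ultimately have "bounded (f ` ?A)"
    by (intro compact_imp_bounded compact_continuous_image)
  moreover have "range (f \<circ> exp) \<subseteq> f ` ?A"
  proof safe
    fix w :: complex
    obtain k where "exp w * q powi k \<in> ?A" using annulus[of "exp w"] by auto
    then show "(f \<circ> exp) w \<in> f ` ?A"
      using per'[of "exp w" k] by (intro image_eqI[of _ _ "exp w * q powi k"]) auto
  qed
  ultimately have "bounded (range (f \<circ> exp))" by (rule bounded_subset)
  moreover have "(f \<circ> exp) holomorphic_on UNIV"
    by (rule holomorphic_on_compose_gen[OF _ hol]) (auto intro: holomorphic_intros)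
  ultimately have "(f \<circ> exp) constant_on UNIV" by (intro Liouville_theorem)
  then obtain c where "\<And>u. f (exp u) = c" by (auto simp: constant_on_def)
  from this[of "Ln z"] this[of "Ln w"] show ?thesis using assms(3,4) by simp
qed

section \<open>Quasi-periodicity of the level-three series and the three-term identity\<close>

definition lam_coeff :: "complex \<Rightarrow> int \<Rightarrow> complex" where
  "lam_coeff t = gterm (- t * q ^ 3) (q ^ 3)"

lemma lam_coeff_summable: "t \<noteq> 0 \<Longrightarrow> (\<lambda>k. norm (lam_coeff t k)) summable_on UNIV"
  unfolding lam_coeff_def by (rule gterm_cube_summable) simp

lemma lambert3_alt: "lambert3 t x q = (\<Sum>\<^sub>\<infinity>k. lam_coeff t k / (1 - x * q powi k))"
  by (simp add: lambert3_def lam_coeff_def)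

text \<open>Shifting k multiplies the coefficient by -t q^(3k). With u = x q^k, the identity 1/(u^3
  (1 - u)) = 1/(1 - u) + 1/u + 1/u^2 + 1/u^3 then leaves the old series and three theta series.
  These inhomogeneous terms must cancel in a combination before Liouville's theorem can be
  used.\<close>

lemma lambert3_mult_q:
  assumes "t \<noteq> 0" "x \<noteq> 0" "jfun x q \<noteq> 0"
  shows "lambert3 t (q * x) q = - (x ^ 3 / t) * (lambert3 t x q + jfun (t * q ^ 2) (q ^ 3) / x
     + jfun (t * q) (q ^ 3) / x ^ 2 + jfun t (q ^ 3) / x ^ 3)"
proof -
  interpret q3: nome "q ^ 3" by (rule nome_power) simp
  let ?c = "lam_coeff t"
  have shift: "((\<lambda>k. ?c k / (q powi k) ^ i) has_sum jfun (t * q ^ (3 - i)) (q ^ 3)) UNIV" if "i \<le> 3" for i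
  proof -
    have "?c k / (q powi k) ^ i = gterm (- (t * q ^ (3 - i))) (q ^ 3) k" for k
    proof -
      have "(- t * q ^ 3) powi k = (- (t * q ^ (3 - i))) powi k * (q powi k) ^ i"
      proof -
        have "- t * q ^ 3 = - (t * q ^ (3 - i)) * q ^ i"
          using that by (simp flip: power_add)
        moreover have "(q ^ i) powi k = (q powi k) ^ i"
          using power_int_mult[of q "int i" k] power_int_mult[of q k "int i"] by (simp add: mult.commute)
        ultimately show ?thesis by (simp only: power_int_mult_distrib)
      qed
      then show ?thesis by (simp add: lam_coeff_def gterm_def)
    qed
    then show ?thesis using q3.jfun_has_sum[of "t * q ^ (3 - i)"] assms(1) by simp
  qed
  have l: "((\<lambda>k. ?c k / (1 - x * q powi k)) has_sum lambert3 t x q) UNIV"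
    unfolding lambert3_alt
    by (intro has_sum_infsum abs_summable_summable[OF lambert_summable_norm[OF lam_coeff_summable]] assms)
  have "((\<lambda>k. - (x ^ 3 / t) * (?c k / (1 - x * q powi k) + ?c k / (q powi k) ^ 1 / x + ?c k / (q powi k) ^ 2 / x ^ 2
      + ?c k / (q powi k) ^ 3 / x ^ 3))
    has_sum - (x ^ 3 / t) * (lambert3 t x q + jfun (t * q ^ (3 - 1)) (q ^ 3) / x
     + jfun (t * q ^ (3 - 2)) (q ^ 3) / x ^ 2 + jfun (t * q ^ (3 - 3)) (q ^ 3) / x ^ 3)) UNIV"
    by (intro has_sum_cmult_right has_sum_add has_sum_divide_const l shift) auto
  moreover have "- (x ^ 3 / t) * (?c k / (1 - x * q powi k) + ?c k / (q powi k) ^ 1 / x + ?c k / (q powi k) ^ 2 / x ^ 2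
      + ?c k / (q powi k) ^ 3 / x ^ 3) = ?c (k - 1) / (1 - q * x * q powi (k - 1))" for k
  proof -
    have "1 - x * q powi k \<noteq> 0" using assms(3) jfun_eq_0_iff[OF assms(2)] by auto
    moreover have e1: "?c k = - t * (q powi k) ^ 3 * ?c (k - 1)"
    proof -
      have "?c (k - 1 + 1) = (- t * q ^ 3) * (q ^ 3) powi (k - 1) * ?c (k - 1)"
        unfolding lam_coeff_def by (rule q3.gterm_Suc) (use assms(1) in auto)
      moreover have "q ^ 3 * (q ^ 3) powi (k - 1) = (q powi k) ^ 3"
        using power_int_mult[of q 3 k] power_int_mult[of q k 3] by (simp add: power_int_diff mult.commute)
      ultimately show ?thesis by (simp add: mult_ac)
    qed
    moreover have e2: "q * x * q powi (k - 1) = x * q powi k" by (simp add: power_int_diff)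
    moreover have "- (x ^ 3 / t) * (- t * w ^ 3 * d / (1 - x * w) + - t * w ^ 3 * d / w ^ 1 / x
        + - t * w ^ 3 * d / w ^ 2 / x ^ 2 + - t * w ^ 3 * d / w ^ 3 / x ^ 3) = d / (1 - x * w)"
      if "w \<noteq> 0" "1 - x * w \<noteq> 0" for w d
      using that assms by (simp add: divide_simps) (simp add: algebra_simps power2_eq_square power3_eq_cube)
    ultimately show ?thesis unfolding e1 e2 by simp
  qed
  ultimately have "((\<lambda>k. ?c (k - 1) / (1 - q * x * q powi (k - 1)))
    has_sum - (x ^ 3 / t) * (lambert3 t x q + jfun (t * q ^ (3 - 1)) (q ^ 3) / x
     + jfun (t * q ^ (3 - 2)) (q ^ 3) / x ^ 2 + jfun (t * q ^ (3 - 3)) (q ^ 3) / x ^ 3)) UNIV"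
    by simp
  moreover have "(\<Sum>\<^sub>\<infinity>k. ?c (k - 1) / (1 - q * x * q powi (k - 1))) = lambert3 t (q * x) q"
    unfolding lambert3_alt using infsum_shift[of "\<lambda>k. ?c k / (1 - q * x * q powi k)" "- 1"] by simp
  ultimately show ?thesis by (simp add: has_sum_iff)
qed

text \<open>Away from the zeros of j this is \<open>lambert3_mult_q\<close> times
  \<open>jfun_mult_q\<close>; both sides are continuous, which carries it over to the zeros.\<close>

lemma lambert3_ext_mult_q:
  assumes "t \<noteq> 0" "x \<noteq> 0"
  shows "lambert_ext q (lam_coeff t) (q * x) = x ^ 2 / t * (lambert_ext q (lam_coeff t) x
     + jfun x q * (jfun (t * q ^ 2) (q ^ 3) / x + jfun (t * q) (q ^ 3) / x ^ 2 + jfun t (q ^ 3) / x ^ 3))"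
    (is "?l x = ?r x")
proof -
  let ?M = "lambert_ext q (lam_coeff t)"
  note ext = lambert_ext[OF lam_coeff_summable[OF assms(1)]]
  have "?l y = ?r y" if y: "y \<noteq> 0" "jfun y q \<noteq> 0" for y
  proof -
    have "jfun (q * y) q \<noteq> 0" using y by (simp add: jfun_mult_q)
    then have "?l y = jfun (q * y) q * lambert3 t (q * y) q"
      using y ext(2)[of "q * y"] by (simp add: lambert3_alt)
    also have "\<dots> = - jfun y q / y * (- (y ^ 3 / t) * (lambert3 t y q + jfun (t * q ^ 2) (q ^ 3) / y
     + jfun (t * q) (q ^ 3) / y ^ 2 + jfun t (q ^ 3) / y ^ 3))"
      using y by (simp only: jfun_mult_q[OF y(1)] lambert3_mult_q[OF assms(1) y])
    also have "\<dots> = ?r y"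
    proof -
      have "- J / y * (- (y ^ 3 / t) * (L + a / y + b / y ^ 2 + c / y ^ 3))
        = y ^ 2 / t * (J * L + J * (a / y + b / y ^ 2 + c / y ^ 3))" for J L a b c
        using y assms(1) by (simp add: divide_simps) (simp add: algebra_simps power2_eq_square power3_eq_cube)
      then show ?thesis using y ext(2)[of y] by (simp add: lambert3_alt)
    qed
    finally show ?thesis .
  qed
  then have ev: "\<forall>\<^sub>F y in at x. ?l y = ?r y"
    using eventually_jfun_nz[OF assms(2)] eventually_neq_0[OF assms(2)] by (auto elim: eventually_elim2)
  have hol: "?l holomorphic_on - {0}" "?r holomorphic_on - {0}"
  proof -
    have "(?M \<circ> (\<lambda>x. q * x)) holomorphic_on - {0}"
      by (rule holomorphic_on_compose_gen[OF _ ext(1)]) (auto intro!: holomorphic_intros)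
    then show "?l holomorphic_on - {0}" by (simp add: o_def)
    show "?r holomorphic_on - {0}"
      by (intro holomorphic_intros ext(1) jfun_holomorphic) (use assms in auto)
  qed
  have "isCont ?l x" "isCont ?r x"
    using hol[THEN holomorphic_on_imp_continuous_on] assms(2) open_Compl[OF closed_singleton, of "0 :: complex"]
    by (simp_all add: continuous_on_eq_continuous_at)
  then have l: "(?l \<longlongrightarrow> ?l x) (at x)" and r: "(?r \<longlongrightarrow> ?r x) (at x)" by (simp_all add: isCont_def)
  show ?thesis
    by (rule tendsto_unique[OF at_neq_bot Lim_transform_eventually[OF l ev] r])
qed

text \<open>Multiplying the left-hand side minus the right-hand sum by the three theta functions
  gives an elliptic function without poles, that is, a constant. Its values at \<open>z = 1 / s\<close> and
  \<open>z = 1\<close> provide both the constant and the quintuple product identity.\<close>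

theorem lambert3_three_term:
  assumes s: "s \<noteq> 0" "jfun s q \<noteq> 0"
  shows "s\<^sup>2 * jfun (s ^ 3 * q ^ 2) (q ^ 3) + s * jfun (s ^ 3 * q) (q ^ 3) = s * jfun (s\<^sup>2) q / jfun s q * qpoch_inf q q"
    and "\<lbrakk>z \<noteq> 0; jfun z q \<noteq> 0; jfun (z * s) q \<noteq> 0; jfun (z / s) q \<noteq> 0\<rbrakk> \<Longrightarrow>
      s ^ 3 * lambert3 (s ^ 3) (z * s) q + lambert3 (1 / s ^ 3) (z / s) q =
      s * jfun (s\<^sup>2) q / jfun s q * lambert3 1 z q
        + qpoch_inf q q ^ 3 * jfun s q * jfun (s\<^sup>2) q / (jfun (z / s) q * jfun z q * jfun (z * s) q)"
proof -
  interpret q3: nome "q ^ 3" by (rule nome_power) simp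
  let ?P = "qpoch_inf q q"
  define M1 where "M1 = lambert_ext q (lam_coeff (s ^ 3))"
  define M2 where "M2 = lambert_ext q (lam_coeff (1 / s ^ 3))"
  define M3 where "M3 = lambert_ext q (lam_coeff 1)"
  define a where "a = jfun (s ^ 3 * q ^ 2) (q ^ 3)"
  define b where "b = jfun (s ^ 3 * q) (q ^ 3)"
  define c where "c = jfun (s ^ 3) (q ^ 3)"
  \<comment> \<open>This value is forced by periodicity. Up to the product of the three theta
    functions, the inhomogeneous terms of the first two summands of \<open>H\<close> add up to (s^2
    a + s b)(1/z + 1/z^2), the terms with c cancelling, and that of the third is \<kappa> (q)_inf
    (1/z + 1/z^2).\<close>
  define \<kappa> where "\<kappa> = (s\<^sup>2 * a + s * b) / ?P"
  define H where "H z = s ^ 3 * (jfun (z / s) q * jfun z q * M1 (z * s)) + jfun z q * jfun (z * s) q * M2 (z / s)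
     - \<kappa> * (jfun (z / s) q * jfun (z * s) q * M3 z)" for z
  have nz3: "s ^ 3 \<noteq> 0" "1 / s ^ 3 \<noteq> 0" using s by auto
  note ext1 = lambert_ext[OF lam_coeff_summable[OF nz3(1)], folded M1_def]
  note ext2 = lambert_ext[OF lam_coeff_summable[OF nz3(2)], folded M2_def]
  note ext3 = lambert_ext[OF lam_coeff_summable[OF one_neq_zero], folded M3_def]
  have c0: "lam_coeff t 0 = 1" for t by (simp add: lam_coeff_def gterm_def)
  have a2: "jfun (1 / s ^ 3 * q ^ 2) (q ^ 3) = b"
    using q3.jfun_q_div[of "s ^ 3 * q"] s by (simp add: b_def power2_eq_square power3_eq_cube)
  have b2: "jfun (1 / s ^ 3 * q) (q ^ 3) = a"
    using q3.jfun_q_div[of "s ^ 3 * q\<^sup>2"] s by (simp add: a_def power2_eq_square power3_eq_cube)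
  have c2: "jfun (1 / s ^ 3) (q ^ 3) = - c / s ^ 3"
    unfolding c_def by (rule q3.jfun_inverse[OF nz3(1)])
  have a3: "jfun (1 * q ^ 2) (q ^ 3) = ?P"
    using pentagonal q3.jfun_has_sum[of "q ^ 2"] by (auto intro: has_sum_unique)
  have b3: "jfun (1 * q) (q ^ 3) = ?P"
    using q3.jfun_q_div[of q] a3 by (simp add: power2_eq_square power3_eq_cube)
  have c3: "jfun 1 (q ^ 3) = 0" by (rule q3.jfun_1)
  have "H (q * z) = H z" if z: "z \<noteq> 0" for z
  proof -
    have zs: "z * s \<noteq> 0" "z / s \<noteq> 0" using z s by auto
    have j: "jfun (q * z / s) q = - jfun (z / s) q / (z / s)" "jfun (q * z * s) q = - jfun (z * s) q / (z * s)"
      "jfun (q * z) q = - jfun z q / z"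
      using jfun_mult_q[OF zs(1)] jfun_mult_q[OF zs(2)] jfun_mult_q[OF z] by (simp_all add: mult.assoc)
    have m1: "M1 (q * z * s) = (z * s) ^ 2 / s ^ 3 * (M1 (z * s) + jfun (z * s) q * (a / (z * s) + b / (z * s) ^ 2 + c / (z * s) ^ 3))"
      using lambert3_ext_mult_q[OF nz3(1) zs(1)] by (simp add: M1_def a_def b_def c_def mult.assoc)
    have m2: "M2 (q * z / s) = (z / s) ^ 2 / (1 / s ^ 3) * (M2 (z / s) + jfun (z / s) q * (b / (z / s) + a / (z / s) ^ 2 + (- c / s ^ 3) / (z / s) ^ 3))"
      using lambert3_ext_mult_q[OF nz3(2) zs(2)] unfolding a2 b2 c2 by (simp add: M2_def mult.assoc)
    have m3: "M3 (q * z) = z ^ 2 * (M3 z + jfun z q * (?P / z + ?P / z ^ 2))"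
      using lambert3_ext_mult_q[OF one_neq_zero z] unfolding a3 b3 c3 by (simp add: M3_def)
    have alg: "s ^ 3 * ((- A / (z / s)) * (- B / z) * ((z * s) ^ 2 / s ^ 3 * (m1 + C * (a / (z * s) + b / (z * s) ^ 2 + c / (z * s) ^ 3))))
       + (- B / z) * (- C / (z * s)) * ((z / s) ^ 2 / (1 / s ^ 3) * (m2 + A * (b / (z / s) + a / (z / s) ^ 2 + (- c / s ^ 3) / (z / s) ^ 3)))
       - \<kappa> * ((- A / (z / s)) * (- C / (z * s)) * (z ^ 2 * (m3 + B * (?P / z + ?P / z ^ 2))))
      = s ^ 3 * (A * B * m1) + B * C * m2 - \<kappa> * (A * C * m3)" for A B C m1 m2 m3
    proof -
      have 1: "s ^ 3 * ((- A / (z / s)) * (- B / z) * ((z * s) ^ 2 / s ^ 3 * (m1 + C * (a / (z * s) + b / (z * s) ^ 2 + c / (z * s) ^ 3))))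
        = s ^ 3 * (A * B * m1) + A * B * C * (s\<^sup>2 * a / z + s * b / z\<^sup>2 + c / z ^ 3)"
      proof -
        have 1: "s ^ 3 * ((- A / (z / s)) * (- B / z) * ((z * s) ^ 2 / s ^ 3 * X)) = s ^ 3 * (A * B * X)" for X
          using z s by (simp add: power2_eq_square power3_eq_cube)
        have "s ^ 3 * (a / (z * s) + b / (z * s) ^ 2 + c / (z * s) ^ 3) = s\<^sup>2 * a / z + s * b / z\<^sup>2 + c / z ^ 3"
          using z s by (simp add: distrib_left power2_eq_square power3_eq_cube mult_ac)
        from this[symmetric] show ?thesis unfolding 1 by (simp only:) (simp add: algebra_simps)
      qed
      have 2: "(- B / z) * (- C / (z * s)) * ((z / s) ^ 2 / (1 / s ^ 3) * (m2 + A * (b / (z / s) + a / (z / s) ^ 2 + (- c / s ^ 3) / (z / s) ^ 3)))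
        = B * C * m2 + A * B * C * (s * b / z + s\<^sup>2 * a / z\<^sup>2 - c / z ^ 3)"
      proof -
        have 1: "(- B / z) * (- C / (z * s)) * ((z / s) ^ 2 / (1 / s ^ 3) * X) = B * C * X" for X
          using z s by (simp add: power2_eq_square power3_eq_cube)
        have 2: "b / (z / s) + a / (z / s) ^ 2 + (- c / s ^ 3) / (z / s) ^ 3 = s * b / z + s\<^sup>2 * a / z\<^sup>2 - c / z ^ 3"
          using z s by (simp add: power2_eq_square power3_eq_cube mult_ac)
        show ?thesis unfolding 1 2 by (simp add: algebra_simps)
      qed
      have 3: "\<kappa> * ((- A / (z / s)) * (- C / (z * s)) * (z ^ 2 * (m3 + B * (?P / z + ?P / z ^ 2))))
        = \<kappa> * (A * C * m3) + A * B * C * (\<kappa> * ?P) * (1 / z + 1 / z\<^sup>2)"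
      proof -
        have 1: "(- A / (z / s)) * (- C / (z * s)) * (z ^ 2 * X) = A * C * X" for X
          using z s by (simp add: power2_eq_square)
        show ?thesis unfolding 1 by (simp add: algebra_simps)
      qed
      have 4: "\<kappa> * ?P = s\<^sup>2 * a + s * b" by (simp add: \<kappa>_def)
      show ?thesis unfolding 1 2 3 4 by (simp add: algebra_simps add_divide_distrib)
    qed
    show ?thesis unfolding H_def j m1 m2 m3 by (rule alg)
  qed
  moreover have "H holomorphic_on - {0}"
  proof -
    have im: "(\<lambda>z. z * s) ` (- {0}) \<subseteq> - {0}" "(\<lambda>z. z / s) ` (- {0}) \<subseteq> - {0}"
      using s by auto
    have "(M1 \<circ> (\<lambda>z. z * s)) holomorphic_on - {0}" "(M2 \<circ> (\<lambda>z. z / s)) holomorphic_on - {0}"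
      by (rule holomorphic_on_compose_gen[OF _ ext1(1) im(1)] holomorphic_on_compose_gen[OF _ ext2(1) im(2)],
          use s in \<open>auto intro!: holomorphic_intros\<close>)+
    then have "(\<lambda>z. M1 (z * s)) holomorphic_on - {0}" "(\<lambda>z. M2 (z / s)) holomorphic_on - {0}"
      by (simp_all add: o_def)
    then show ?thesis unfolding H_def
      by (intro holomorphic_intros jfun_holomorphic_compose ext3(1)) (use s in auto)
  qed
  ultimately have const: "H z = H w" if "z \<noteq> 0" "w \<noteq> 0" for z w
    using elliptic_constant[of H] that by blast
  \<comment> \<open>At z = 1 and at z = 1/s two of the three summands contain j(1) = 0, and the
    third is known from the value of \<open>lambert_ext\<close> at 1. Equating the two values
    evaluates \<kappa> as a theta quotient, which is the quintuple product identity.\<close>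
  have H1: "H 1 = \<kappa> * ?P ^ 3 * jfun s q ^ 2 / s"
    using s by (simp add: H_def ext3(3) c0 jfun_inverse power2_eq_square)
  have Hs: "H (1 / s) = ?P ^ 3 * jfun s q * jfun (s\<^sup>2) q"
  proof -
    have "jfun (1 / s / s) q = - jfun (s\<^sup>2) q / s\<^sup>2"
      using jfun_inverse[of "s\<^sup>2"] s by (simp add: power2_eq_square)
    then show ?thesis
      using s by (simp add: H_def ext1(3) c0 jfun_inverse power2_eq_square power3_eq_cube)
  qed
  have "\<kappa> * ?P ^ 3 * jfun s q ^ 2 / s = ?P ^ 3 * jfun s q * jfun (s\<^sup>2) q"
    using const[of 1 "1 / s"] s unfolding H1 Hs by simp
  then have \<kappa>: "\<kappa> = s * jfun (s\<^sup>2) q / jfun s q"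
    using s by (simp add: field_simps power2_eq_square)
  then show "s\<^sup>2 * jfun (s ^ 3 * q ^ 2) (q ^ 3) + s * jfun (s ^ 3 * q) (q ^ 3) = s * jfun (s\<^sup>2) q / jfun s q * ?P"
    unfolding \<kappa>_def a_def b_def by (simp add: field_simps)
  assume z: "z \<noteq> 0" "jfun z q \<noteq> 0" "jfun (z * s) q \<noteq> 0" "jfun (z / s) q \<noteq> 0"
  have "H z = jfun (z / s) q * jfun z q * jfun (z * s) q *
      (s ^ 3 * lambert3 (s ^ 3) (z * s) q + lambert3 (1 / s ^ 3) (z / s) q - \<kappa> * lambert3 1 z q)"
    using s z ext1(2)[of "z * s"] ext2(2)[of "z / s"] ext3(2)[of z] by (simp add: H_def lambert3_alt algebra_simps)
  moreover have "H z = ?P ^ 3 * jfun s q * jfun (s\<^sup>2) q"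
    using const[of z "1 / s"] z s Hs by simp
  ultimately have "s ^ 3 * lambert3 (s ^ 3) (z * s) q + lambert3 (1 / s ^ 3) (z / s) q - \<kappa> * lambert3 1 z q
    = ?P ^ 3 * jfun s q * jfun (s\<^sup>2) q / (jfun (z / s) q * jfun z q * jfun (z * s) q)"
    using z by (simp add: eq_divide_eq mult_ac)
  then show "s ^ 3 * lambert3 (s ^ 3) (z * s) q + lambert3 (1 / s ^ 3) (z / s) q =
      s * jfun (s\<^sup>2) q / jfun s q * lambert3 1 z q
        + ?P ^ 3 * jfun s q * jfun (s\<^sup>2) q / (jfun (z / s) q * jfun z q * jfun (z * s) q)"
    unfolding \<kappa> by (simp add: algebra_simps)
qed

end

section \<open>Dissections modulo seven\<close>

text \<open>The symmetric residue system allows the classes k and -k to be paired.\<close>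

lemma infsum_residues_7:
  fixes f :: "int \<Rightarrow> complex"
  assumes "f summable_on UNIV"
  shows "infsum f UNIV = (\<Sum>k\<in>{-3..3}. \<Sum>\<^sub>\<infinity>m. f (7 * m + k))"
proof -
  have inj: "inj (\<lambda>m::int. 7 * m + k)" for k by (auto simp: inj_on_def)
  have "(f has_sum (\<Sum>k\<in>{-3..3}. \<Sum>\<^sub>\<infinity>m. f (7 * m + k))) (\<Union>k\<in>{-3..3}. range (\<lambda>m. 7 * m + k))"
  proof (rule sum_has_sum)
    fix k :: int
    have "f summable_on range (\<lambda>m. 7 * m + k)"
      using assms by (rule summable_on_subset_banach) auto
    then have "((\<lambda>m. f (7 * m + k)) has_sum (\<Sum>\<^sub>\<infinity>m. f (7 * m + k))) UNIV"
      by (subst (asm) summable_on_reindex[OF inj]) (simp add: o_def)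
    then show "(f has_sum (\<Sum>\<^sub>\<infinity>m. f (7 * m + k))) (range (\<lambda>m. 7 * m + k))"
      by (subst has_sum_reindex[OF inj]) (simp add: o_def)
  next
    fix k l :: int assume "k \<in> {-3..3}" "l \<in> {-3..3}" "k \<noteq> l"
    then have "7 * m + k \<noteq> 7 * n + l" for m n by presburger
    then show "range (\<lambda>m. 7 * m + k) \<inter> range (\<lambda>m. 7 * m + l) = {}" by auto
  qed auto
  moreover have "(\<Union>k\<in>{-3..3}. range (\<lambda>m. 7 * m + k)) = (UNIV :: int set)"
  proof -
    have "\<exists>k\<in>{-3..3}. n \<in> range (\<lambda>m. 7 * m + k)" for n :: int
      by (rule bexI[of _ "(n + 3) mod 7 - 3"], rule image_eqI[of _ _ "(n + 3) div 7"]) (auto, presburger+)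
    then show ?thesis by blast
  qed
  ultimately show ?thesis by (simp add: infsumI)
qed

lemma sum_minus3_3:
  fixes f :: "int \<Rightarrow> complex"
  shows "sum f {-3..3} = f 0 + (f 1 + f (- 1)) + (f 2 + f (- 2)) + (f 3 + f (- 3))"
proof -
  have "{-3..3::int} = {0, 1, -1, 2, -2, 3, -3}" by auto
  then show ?thesis by (simp add: add.assoc)
qed

context nome
begin

lemma jld_mult_q:
  assumes "x \<noteq> 0" "jfun x q \<noteq> 0"
  shows "jld (q * x) q = jld x q - 1"
  using jld_q_div[of "1 / x"] jld_inverse[OF assms] assms by simp

text \<open>Since division by zero gives zero, \<open>lambert3 t 1 q\<close> is the Lambert series without its
  singular term.\<close>

lemma lambert3_three_term_limit:
  assumes s: "s \<noteq> 0" "jfun s q \<noteq> 0" "jfun (s\<^sup>2) q \<noteq> 0"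
  shows "s ^ 3 * lambert3 (s ^ 3) (s\<^sup>2) q + lambert3 (1 / s ^ 3) 1 q =
    s * jfun (s\<^sup>2) q / jfun s q * lambert3 1 s q + jld s q + jld (s\<^sup>2) q"
proof -
  let ?P = "qpoch_inf q q"
  let ?c = "lam_coeff (1 / s ^ 3)"
  let ?R = "\<lambda>y. \<Sum>\<^sub>\<infinity>k\<in>- {0}. ?c k / (1 - y * q powi k)"
  have t: "s ^ 3 \<noteq> 0" "1 / s ^ 3 \<noteq> 0" using s by auto
  have split: "lambert3 (1 / s ^ 3) y q = 1 / (1 - y) + ?R y" for y
  proof -
    have sm: "(\<lambda>k. ?c k / (1 - y * q powi k)) summable_on UNIV"
      by (rule abs_summable_summable[OF lambert_summable_norm[OF lam_coeff_summable[OF t(2)]]])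
    have "(\<Sum>\<^sub>\<infinity>k\<in>{0} \<union> - {0}. ?c k / (1 - y * q powi k)) = (\<Sum>\<^sub>\<infinity>k\<in>{0}. ?c k / (1 - y * q powi k)) + ?R y"
      by (rule infsum_Un_disjoint) (auto intro!: summable_on_subset_banach[OF sm])
    then show ?thesis by (simp add: lambert3_alt lam_coeff_def gterm_def)
  qed
  have cont: "((\<lambda>y. lambert3 u (v * y) q) \<longlongrightarrow> lambert3 u v q) (at 1)"
    if "u \<noteq> 0" "v \<noteq> 0" "jfun v q \<noteq> 0" for u v
  proof -
    have "(\<lambda>x. lambert3 u x q) analytic_on {v}"
      unfolding lambert3_alt by (rule lambert_analytic[OF lam_coeff_summable]) (use that jfun_eq_0_iff in auto)
    then have "isCont (\<lambda>x. lambert3 u x q) v" by (rule analytic_at_imp_isCont)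
    then have "isCont (\<lambda>x. lambert3 u x q) (v * 1)" by simp
    moreover have "((\<lambda>y. v * y) \<longlongrightarrow> v * 1) (at 1)" by (intro tendsto_intros)
    ultimately have "((\<lambda>y. lambert3 u (v * y) q) \<longlongrightarrow> lambert3 u (v * 1) q) (at 1)"
      by (rule isCont_tendsto_compose)
    then show ?thesis by simp
  qed
  have R: "(?R \<longlongrightarrow> lambert3 (1 / s ^ 3) 1 q) (at 1)"
  proof -
    have "?R analytic_on {1}"
      by (rule lambert_analytic[OF lam_coeff_summable[OF t(2)]]) (auto simp: powi_eq_1_iff)
    then have "(?R \<longlongrightarrow> ?R 1) (at 1)" using analytic_at_imp_isCont isCont_def by blast
    then show ?thesis using split[of 1] by simp
  qed
  \<comment> \<open>With z = s y, the theta quotient of the three-term identity is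
    \<open>N 1 / N y / (1 - y)\<close>. Its pole cancels the term 1/(1 - y) of the Lambert series,
    which leaves minus a difference quotient of \<open>N 1 / N\<close> and in the limit N'(1)/N(1).
    The factor \<open>jreg\<close> has derivative 0 at 1 and adds nothing to it.\<close>
  define N where "N y = jreg y q * jfun (s * y) q * jfun (s\<^sup>2 * y) q" for y
  have N1: "N 1 = ?P ^ 3 * jfun s q * jfun (s\<^sup>2) q" by (simp add: N_def jreg_1)
  then have N1_nz: "N 1 \<noteq> 0" using s by simp
  have jdv: "((\<lambda>y. jfun (v * y) q) has_field_derivative jd v q * v) (at 1)" if "v \<noteq> 0" for v
  proof -
    have "((\<lambda>y. jfun (v * y) q) has_field_derivative jd (v * 1) q * v) (at 1)"
      by (rule DERIV_chain2[OF jfun_deriv]) (use that in \<open>auto intro!: derivative_eq_intros\<close>)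
    then show ?thesis by simp
  qed
  have s2: "s\<^sup>2 \<noteq> 0" using s by simp
  have "(N has_field_derivative
     (0 * jfun (s * 1) q + jd s q * s * jreg 1 q) * jfun (s\<^sup>2 * 1) q + jd (s\<^sup>2) q * s\<^sup>2 * (jreg 1 q * jfun (s * 1) q)) (at 1)"
    unfolding N_def by (intro DERIV_mult jreg_deriv_1 jdv s(1) s2)
  moreover have "(0 * jfun (s * 1) q + jd s q * s * jreg 1 q) * jfun (s\<^sup>2 * 1) q + jd (s\<^sup>2) q * s\<^sup>2 * (jreg 1 q * jfun (s * 1) q)
     = N 1 * (jld s q + jld (s\<^sup>2) q)"
    using s by (simp add: N_def jld_def field_simps)
  ultimately have Nd: "(N has_field_derivative N 1 * (jld s q + jld (s\<^sup>2) q)) (at 1)" by simp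
  then have "((\<lambda>y. N 1 / N y) has_field_derivative - (jld s q + jld (s\<^sup>2) q)) (at 1)"
    using N1_nz by (auto intro!: derivative_eq_intros simp: field_simps)
  then have "((\<lambda>y. (N 1 / N y - N 1 / N 1) / (y - 1)) \<longlongrightarrow> - (jld s q + jld (s\<^sup>2) q)) (at 1)"
    by (simp add: has_field_derivative_iff)
  then have "((\<lambda>y. - ((N 1 / N y - N 1 / N 1) / (y - 1))) \<longlongrightarrow> - (- (jld s q + jld (s\<^sup>2) q))) (at 1)"
    by (rule tendsto_minus)
  then have lim0: "((\<lambda>y. - ((N 1 / N y - N 1 / N 1) / (y - 1))) \<longlongrightarrow> jld s q + jld (s\<^sup>2) q) (at 1)"
    by (simp only: minus_minus)
  have lim1: "((\<lambda>y. s * jfun (s\<^sup>2) q / jfun s q * lambert3 1 (s * y) q + - ((N 1 / N y - N 1 / N 1) / (y - 1))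
        - s ^ 3 * lambert3 (s ^ 3) (s\<^sup>2 * y) q) \<longlongrightarrow>
     s * jfun (s\<^sup>2) q / jfun s q * lambert3 1 s q + (jld s q + jld (s\<^sup>2) q) - s ^ 3 * lambert3 (s ^ 3) (s\<^sup>2) q) (at 1)"
    by (intro tendsto_diff[OF tendsto_add[OF _ lim0]] tendsto_mult[OF tendsto_const] cont one_neq_zero s t s2)
  have "\<forall>\<^sub>F y in at 1. y \<noteq> (0::complex) \<and> jfun y q \<noteq> 0 \<and> jfun (s * y) q \<noteq> 0 \<and> jfun (s\<^sup>2 * y) q \<noteq> 0"
  proof -
    have "\<forall>\<^sub>F y in at 1. jfun (v * y) q \<noteq> 0" if "v \<noteq> 0" "jfun v q \<noteq> 0" for v
      using tendsto_imp_eventually_ne[of "\<lambda>y. jfun (v * y) q" "jfun (v * 1) q" "at 1" 0]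
        DERIV_isCont[OF jdv[OF that(1)]] that by (simp add: isCont_def)
    then show ?thesis
      using s s2 eventually_neq_0[of 1] eventually_jfun_nz[of 1] by (intro eventually_conj) auto
  qed
  moreover have "\<forall>\<^sub>F y in at 1. y \<noteq> (1::complex)" by (simp add: eventually_at_filter)
  ultimately have "\<forall>\<^sub>F y in at 1. s * jfun (s\<^sup>2) q / jfun s q * lambert3 1 (s * y) q + - ((N 1 / N y - N 1 / N 1) / (y - 1))
        - s ^ 3 * lambert3 (s ^ 3) (s\<^sup>2 * y) q = ?R y"
  proof eventually_elim
    case (elim y)
    have zs: "s * y * s = s\<^sup>2 * y" "s * y / s = y" using s by (simp_all add: power2_eq_square)
    have h1: "s ^ 3 * lambert3 (s ^ 3) (s\<^sup>2 * y) q + lambert3 (1 / s ^ 3) y q =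
      s * jfun (s\<^sup>2) q / jfun s q * lambert3 1 (s * y) q
        + ?P ^ 3 * jfun s q * jfun (s\<^sup>2) q / (jfun y q * jfun (s * y) q * jfun (s\<^sup>2 * y) q)"
      using lambert3_three_term(2)[OF s(1,2), of "s * y"] elim s(1) unfolding zs by (simp only: mult_eq_0_iff simp_thms)
    have h2: "?P ^ 3 * jfun s q * jfun (s\<^sup>2) q / (jfun y q * jfun (s * y) q * jfun (s\<^sup>2 * y) q) = N 1 / N y / (1 - y)"
      by (simp add: N1[symmetric]) (simp add: N_def jfun_reg[of y] mult_ac)
    have h3: "(N 1 / N y - N 1 / N 1) / (y - 1) = 1 / (1 - y) - N 1 / N y / (1 - y)"
      using elim N1_nz by (simp add: divide_simps) (simp add: algebra_simps)
    have lin: "u + (d + r) = k + n \<Longrightarrow> k + - (d - n) - u = r" for u d r k n :: complex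
      by (simp add: algebra_simps)
    show ?case unfolding h3 by (rule lin) (use h1 in \<open>simp only: h2 split[of y]\<close>)
  qed
  with lim1 have "(?R \<longlongrightarrow>
     s * jfun (s\<^sup>2) q / jfun s q * lambert3 1 s q + (jld s q + jld (s\<^sup>2) q) - s ^ 3 * lambert3 (s ^ 3) (s\<^sup>2) q) (at 1)"
    by (rule Lim_transform_eventually)
  from tendsto_unique[OF at_neq_bot R this] show ?thesis by (simp add: algebra_simps)
qed

text \<open>The sum over n \<noteq> 0 of (-1)^n q^(n(3n+1)/2 + bn) / (1 - q^(7n)), as studied by
  Atkin and Swinnerton-Dyer; the term n = 0 is zero because division by zero gives zero.\<close>

definition rank_sum :: "int \<Rightarrow> complex" where
  "rank_sum b = (\<Sum>\<^sub>\<infinity>n. gterm (- (q powi (b + 2))) (q ^ 3) n / (1 - (q ^ 7) powi n))"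

lemma gterm_neg_powi: "gterm (- (q powi i)) (q ^ j) n = (- 1) powi n * q powi (i * n + int j * tri n)"
proof -
  have "(- (q powi i)) powi n = (- 1) powi n * q powi (i * n)"
    using power_int_mult_distrib[of "- 1" "q powi i" n] by (simp add: power_int_mult)
  moreover have "(q ^ j) powi tri n = q powi (int j * tri n)"
    by (simp add: power_int_mult)
  ultimately show ?thesis by (simp add: gterm_def power_int_add)
qed

lemma rank_sum_summable: "(\<lambda>n. norm (gterm (- (q powi i)) (q ^ 3) n / (1 - (q ^ 7) powi n))) summable_on UNIV"
proof -
  interpret w: nome "q ^ 7" by (rule nome_power) simp
  show ?thesis
    using w.lambert_summable_norm[of "gterm (- (q powi i)) (q ^ 3)" UNIV 1] gterm_cube_summable[of "- (q powi i)"]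
    by simp
qed

text \<open>Substitute -n for n. Hence the sum for b = 3 vanishes and b = 0, 1, 2 determine those
  for b = 4, 5, 6.\<close>

lemma rank_sum_reflect: "rank_sum (6 - b) = - rank_sum b"
proof -
  have "rank_sum (6 - b) = (\<Sum>\<^sub>\<infinity>n. gterm (- (q powi (6 - b + 2))) (q ^ 3) (- n) / (1 - (q ^ 7) powi (- n)))"
    unfolding rank_sum_def
    by (rule infsum_reindex_bij_betw[symmetric]) (rule bij_betwI[of _ _ _ uminus], auto)
  also have "\<dots> = (\<Sum>\<^sub>\<infinity>n. - (gterm (- (q powi (b + 2))) (q ^ 3) n / (1 - (q ^ 7) powi n)))"
  proof (rule infsum_cong)
    fix n :: int
    have w: "(q ^ 7) powi n = q powi (7 * n)" for n by (simp add: power_int_mult)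
    have "q powi ((6 - b + 2) * - n + int 3 * tri (- n)) = q powi ((b + 2) * n + int 3 * tri n) * q powi (- (7 * n))"
      by (simp add: tri_minus algebra_simps flip: power_int_add)
    moreover have "(- 1) powi (- n) = ((- 1) powi n :: complex)"
      by (simp add: power_int_minus_one_minus)
    moreover have "q powi (- (7 * n)) / (1 - q powi (- (7 * n))) = - (1 / (1 - q powi (7 * n)))"
    proof -
      have "x / (1 - x) = - (1 / (1 - inverse x))" if "x \<noteq> 0" for x :: complex
        using that by (cases "x = 1") (simp_all add: field_simps)
      from this[of "q powi (- (7 * n))"] show ?thesis by (simp add: power_int_minus)
    qed
    ultimately show "gterm (- (q powi (6 - b + 2))) (q ^ 3) (- n) / (1 - (q ^ 7) powi (- n)) =
       - (gterm (- (q powi (b + 2))) (q ^ 3) n / (1 - (q ^ 7) powi n))"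
      unfolding gterm_neg_powi w by (metis (no_types, lifting) minus_mult_right mult.assoc mult.right_neutral mult_minus_right times_divide_eq_right)
  qed
  also have "\<dots> = - rank_sum b"
    unfolding rank_sum_def by (rule infsum_uminus)
  finally show ?thesis .
qed

text \<open>The numerators differ by the factor q^(7n), so the difference cancels the denominator.
  The constant 1 is the term n = 0, which the pentagonal series has and \<open>rank_sum\<close>
  omits.\<close>

lemma rank_sum_shift: "rank_sum 7 = rank_sum 0 - qpoch_inf q q + 1"
proof -
  let ?f = "\<lambda>i n. gterm (- (q powi i)) (q ^ 3) n"
  have s: "(\<lambda>n. ?f i n / (1 - (q ^ 7) powi n)) summable_on UNIV" for i
    by (rule abs_summable_summable[OF rank_sum_summable])
  have "rank_sum 0 - rank_sum 7 = (\<Sum>\<^sub>\<infinity>n. ?f 2 n / (1 - (q ^ 7) powi n) - ?f 9 n / (1 - (q ^ 7) powi n))"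
    unfolding rank_sum_def using s[of 2] s[of 9] by (simp add: infsum_diff)
  also have "\<dots> = (\<Sum>\<^sub>\<infinity>n. ?f 2 n - (if n = 0 then 1 else 0))"
  proof (rule infsum_cong)
    fix n :: int
    have w: "(q ^ 7) powi n = q powi (7 * n)" by (simp add: power_int_mult)
    have "?f 9 n = ?f 2 n * q powi (7 * n)"
      unfolding gterm_neg_powi by (simp add: mult.assoc flip: power_int_add)
    have "n \<noteq> 0 \<Longrightarrow> 1 - q powi (7 * n) \<noteq> 0" by (simp add: powi_eq_1_iff)
    show "?f 2 n / (1 - (q ^ 7) powi n) - ?f 9 n / (1 - (q ^ 7) powi n) = ?f 2 n - (if n = 0 then 1 else 0)"
    proof (cases "n = 0")
      case False
      have alg: "x / (1 - p) - x * p / (1 - p) = x" if "1 - p \<noteq> 0" for x p :: complex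
      proof -
        have "x / (1 - p) - x * p / (1 - p) = x * (1 - p) / (1 - p)"
          by (simp add: diff_divide_distrib right_diff_distrib)
        then show ?thesis using that by simp
      qed
      show ?thesis
        unfolding \<open>?f 9 n = _\<close> w using alg[OF \<open>n \<noteq> 0 \<Longrightarrow> 1 - q powi (7 * n) \<noteq> 0\<close>[OF False]] False by simp
    qed (simp add: gterm_def)
  qed
  also have "\<dots> = qpoch_inf q q - 1"
  proof -
    have "((\<lambda>n::int. if n = 0 then 1 else 0 :: complex) has_sum 1) UNIV"
      by (rule has_sum_finite_neutralI[of "{0}"]) auto
    from has_sum_diff[OF pentagonal this] show ?thesis by (simp add: infsumI)
  qed
  finally show ?thesis by (simp add: algebra_simps)
qed

text \<open>Put n = 7m + k + a. For b = 10 - 3a the offset a drops out of the coefficients of k and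
  m in the exponent. The inner series then has parameter s^3 and argument z s with s = q^(7k), z =
  q^(7a) and nome q^49, as in the three-term identity. The choices a = 1, 2, 3 give b = 7, 4, 1,
  which shift and reflection convert to 0, 2, 1.\<close>

lemma rank_sum_dissect:
  assumes E: "2 * E = 3 * a * (7 - a)"
  shows "rank_sum (10 - 3 * a) = (- 1) powi a * q powi E * (\<Sum>k\<in>{-3..3}.
    (- 1) powi k * q powi (3 * (tri k + 4 * k)) * lambert3 (q powi (21 * k)) (q powi (7 * (a + k))) (q ^ 49))"
proof -
  let ?f = "\<lambda>n. gterm (- (q powi (12 - 3 * a))) (q ^ 3) n / (1 - (q ^ 7) powi n)"
  have s: "?f summable_on UNIV" by (rule abs_summable_summable[OF rank_sum_summable])
  have s': "(\<lambda>n. ?f (n + a)) summable_on UNIV"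
  proof -
    have "(\<lambda>n. ?f (n + a)) summable_on UNIV \<longleftrightarrow> ?f summable_on UNIV"
      by (rule summable_on_reindex_bij_betw) (rule bij_betwI[of _ _ _ "\<lambda>k. k - a"], auto)
    then show ?thesis using s by blast
  qed
  have "rank_sum (10 - 3 * a) = (\<Sum>\<^sub>\<infinity>n. ?f (n + a))"
    unfolding rank_sum_def infsum_shift[of ?f a] by simp
  also have "\<dots> = (\<Sum>k\<in>{-3..3}. \<Sum>\<^sub>\<infinity>m. ?f (7 * m + k + a))"
    by (rule infsum_residues_7[OF s'])
  also have "\<dots> = (\<Sum>k\<in>{-3..3}. (- 1) powi a * q powi E * ((- 1) powi k * q powi (3 * (tri k + 4 * k)) *
      lambert3 (q powi (21 * k)) (q powi (7 * (a + k))) (q ^ 49)))"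
  proof (rule sum.cong[OF refl])
    fix k :: int
    have "?f (7 * m + k + a) = (- 1) powi a * q powi E * ((- 1) powi k * q powi (3 * (tri k + 4 * k))) *
      (gterm (- (q powi (21 * k)) * (q ^ 49) ^ 3) ((q ^ 49) ^ 3) m / (1 - q powi (7 * (a + k)) * (q ^ 49) powi m))" for m
    proof -
      have e1: "(- 1) powi (7 * m + k + a) = (- 1) powi a * (- 1) powi k * ((- 1) powi m :: complex)"
        using power_int_mult[of "- 1 :: complex" 7 m] by (simp add: power_int_add mult_ac)
      have e2: "(12 - 3 * a) * (7 * m + k + a) + int 3 * tri (7 * m + k + a)
          = E + 3 * (tri k + 4 * k) + ((21 * k + 147) * m + int 147 * tri m)"
      proof -
        have "2 * ((12 - 3 * a) * (7 * m + k + a) + int 3 * tri (7 * m + k + a))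
          = 2 * (E + 3 * (tri k + 4 * k) + ((21 * k + 147) * m + int 147 * tri m))"
          using E two_tri[of "7 * m + k + a"] two_tri[of k] two_tri[of m] by (simp add: algebra_simps)
        then show ?thesis by simp
      qed
      have e3: "- (q powi (21 * k)) * (q ^ 49) ^ 3 = - (q powi (21 * k + 147))"
        by (simp add: power_int_add flip: power_mult)
      have e4: "(q ^ 49) ^ 3 = q ^ 147" by (simp flip: power_mult)
      have e5: "(q ^ 7) powi (7 * m + k + a) = q powi (7 * (a + k)) * (q ^ 49) powi m"
      proof -
        have "(q ^ 7) powi (7 * m + k + a) = q powi (7 * (7 * m + k + a))"
          using power_int_mult[of q 7 "7 * m + k + a"] by simp
        moreover have "(q ^ 49) powi m = q powi (49 * m)" by (simp add: power_int_mult)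
        ultimately show ?thesis by (simp add: algebra_simps flip: power_int_add)
      qed
      show ?thesis
        unfolding e3 unfolding e4 e5 gterm_neg_powi e1 e2 unfolding power_int_add[OF disjI1[OF q_nz]] by (simp add: mult_ac)
    qed
    then have "(\<Sum>\<^sub>\<infinity>m. ?f (7 * m + k + a)) = (\<Sum>\<^sub>\<infinity>m. (- 1) powi a * q powi E * ((- 1) powi k * q powi (3 * (tri k + 4 * k))) *
      (gterm (- (q powi (21 * k)) * (q ^ 49) ^ 3) ((q ^ 49) ^ 3) m / (1 - q powi (7 * (a + k)) * (q ^ 49) powi m)))"
      by simp
    also have "\<dots> = (- 1) powi a * q powi E * ((- 1) powi k * q powi (3 * (tri k + 4 * k))) *
       lambert3 (q powi (21 * k)) (q powi (7 * (a + k))) (q ^ 49)"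
      unfolding lambert3_def by (rule infsum_cmult_right')
    finally show "(\<Sum>\<^sub>\<infinity>m. ?f (7 * m + k + a)) = (- 1) powi a * q powi E * ((- 1) powi k * q powi (3 * (tri k + 4 * k)) *
      lambert3 (q powi (21 * k)) (q powi (7 * (a + k))) (q ^ 49))"
      by (simp add: mult.assoc)
  qed
  also have "\<dots> = (- 1) powi a * q powi E * (\<Sum>k\<in>{-3..3}.
    (- 1) powi k * q powi (3 * (tri k + 4 * k)) * lambert3 (q powi (21 * k)) (q powi (7 * (a + k))) (q ^ 49))"
    by (rule sum_distrib_left[symmetric])
  finally show ?thesis .
qed

text \<open>The offset 1 in n = 7m + k + 1 is what brings the terms for k and -k into the form of
  the quintuple product with s = q^(7k).\<close>

lemma euler_dissect:
  "qpoch_inf q q = - (q ^ 2) * (\<Sum>k\<in>{-3..3}.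
    (- 1) powi k * q powi (3 * tri k + 5 * k) * jfun (q powi (21 * k) * (q ^ 49) ^ 2) ((q ^ 49) ^ 3))"
proof -
  interpret Q: nome "q ^ 49" by (rule nome_power) simp
  interpret Q3: nome "(q ^ 49) ^ 3" by (rule Q.nome_power) simp
  let ?f = "\<lambda>n. gterm (- (q powi 2)) (q ^ 3) n"
  have s: "?f summable_on UNIV" by (rule abs_summable_summable[OF gterm_cube_summable]) simp
  have s': "(\<lambda>n. ?f (n + 1)) summable_on UNIV"
  proof -
    have "(\<lambda>n. ?f (n + 1)) summable_on UNIV \<longleftrightarrow> ?f summable_on UNIV"
      by (rule summable_on_reindex_bij_betw) (rule bij_betwI[of _ _ _ "\<lambda>k. k - 1"], auto)
    then show ?thesis using s by blast
  qed
  have "qpoch_inf q q = (\<Sum>\<^sub>\<infinity>n. ?f (n + 1))"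
    unfolding infsum_shift[of ?f 1] using infsumI[OF pentagonal] by simp
  also have "\<dots> = (\<Sum>k\<in>{-3..3}. \<Sum>\<^sub>\<infinity>m. ?f (7 * m + k + 1))"
    by (rule infsum_residues_7[OF s'])
  also have "\<dots> = (\<Sum>k\<in>{-3..3}. - (q ^ 2) * ((- 1) powi k * q powi (3 * tri k + 5 * k) *
      jfun (q powi (21 * k) * (q ^ 49) ^ 2) ((q ^ 49) ^ 3)))"
  proof (rule sum.cong[OF refl])
    fix k :: int
    have "?f (7 * m + k + 1) = - (q ^ 2) * ((- 1) powi k * q powi (3 * tri k + 5 * k)) *
      gterm (- (q powi (21 * k) * (q ^ 49) ^ 2)) ((q ^ 49) ^ 3) m" for m
    proof -
      have e1: "(- 1) powi (7 * m + k + 1) = - ((- 1) powi k * ((- 1) powi m :: complex))"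
        using power_int_mult[of "- 1 :: complex" 7 m] by (simp add: power_int_add mult_ac)
      have e2: "2 * (7 * m + k + 1) + int 3 * tri (7 * m + k + 1)
          = 2 + (3 * tri k + 5 * k) + ((21 * k + 98) * m + int 147 * tri m)"
      proof -
        have "2 * (2 * (7 * m + k + 1) + int 3 * tri (7 * m + k + 1))
          = 2 * (2 + (3 * tri k + 5 * k) + ((21 * k + 98) * m + int 147 * tri m))"
          using two_tri[of "7 * m + k + 1"] two_tri[of k] two_tri[of m] by (simp add: algebra_simps)
        then show ?thesis by simp
      qed
      have e3: "q powi (21 * k) * (q ^ 49) ^ 2 = q powi (21 * k + 98)"
        by (simp add: power_int_add flip: power_mult)
      have e4: "(q ^ 49) ^ 3 = q ^ 147" by (simp flip: power_mult)
      show ?thesis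
        unfolding e3 e4 gterm_neg_powi e1 e2 unfolding power_int_add[OF disjI1[OF q_nz]] by (simp add: mult_ac)
    qed
    then have "(\<Sum>\<^sub>\<infinity>m. ?f (7 * m + k + 1)) = (\<Sum>\<^sub>\<infinity>m. - (q ^ 2) * ((- 1) powi k * q powi (3 * tri k + 5 * k)) *
      gterm (- (q powi (21 * k) * (q ^ 49) ^ 2)) ((q ^ 49) ^ 3) m)"
      by simp
    also have "\<dots> = - (q ^ 2) * ((- 1) powi k * q powi (3 * tri k + 5 * k)) *
      jfun (q powi (21 * k) * (q ^ 49) ^ 2) ((q ^ 49) ^ 3)"
      by (subst infsum_cmult_right', subst infsumI[OF Q3.jfun_has_sum]) auto
    finally show "(\<Sum>\<^sub>\<infinity>m. ?f (7 * m + k + 1)) = - (q ^ 2) * ((- 1) powi k * q powi (3 * tri k + 5 * k) *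
      jfun (q powi (21 * k) * (q ^ 49) ^ 2) ((q ^ 49) ^ 3))"
      by (simp add: mult.assoc)
  qed
  also have "\<dots> = - (q ^ 2) * (\<Sum>k\<in>{-3..3}.
    (- 1) powi k * q powi (3 * tri k + 5 * k) * jfun (q powi (21 * k) * (q ^ 49) ^ 2) ((q ^ 49) ^ 3))"
    by (rule sum_distrib_left[symmetric])
  finally show ?thesis .
qed

end

context nome
begin

section \<open>Pairing the residues k and -k; theta functions with nome q^49\<close>

definition jq :: "int \<Rightarrow> complex" where "jq n = jfun (q powi n) (q ^ 49)"

definition jl :: "int \<Rightarrow> complex" where "jl n = jld (q powi n) (q ^ 49)"

text \<open>The left-hand side of \<open>lambert3_three_term\<close> for s = q^(7k), z = q^(7a) and
  nome q^49.\<close>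

definition pair_sum :: "int \<Rightarrow> int \<Rightarrow> complex" where
  "pair_sum a k = (q powi (7 * k)) ^ 3 * lambert3 ((q powi (7 * k)) ^ 3) (q powi (7 * a) * q powi (7 * k)) (q ^ 49)
     + lambert3 (1 / (q powi (7 * k)) ^ 3) (q powi (7 * a) / q powi (7 * k)) (q ^ 49)"

text \<open>The coefficient s j(s^2)/j(s) at s = q^(7k), common to the three-term identity and the
  quintuple product.\<close>

definition kap :: "int \<Rightarrow> complex" where
  "kap k = q powi (7 * k) * jq (14 * k) / jq (7 * k)"

lemma nome_49: "nome (q ^ 49)"
  by (rule nome_power) simp

lemma powi_square: "(q powi n)\<^sup>2 = q powi (2 * n)"
  using power_int_mult[of q n 2] by (simp add: mult.commute)

lemma powi_cube: "(q powi n) ^ 3 = q powi (3 * n)"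
  using power_int_mult[of q n 3] by (simp add: mult.commute)

lemma jq_nz: "\<not> 49 dvd n \<Longrightarrow> jq n \<noteq> 0"
proof
  interpret Q: nome "q ^ 49" by (rule nome_49)
  assume n: "\<not> 49 dvd n" and "jq n = 0"
  then obtain k where "q powi n * (q ^ 49) powi k = 1"
    by (auto simp: jq_def Q.jfun_eq_0_iff)
  moreover have "(q ^ 49) powi k = q powi (49 * k)" using power_int_mult[of q 49 k] by simp
  ultimately have "q powi (n + 49 * k) = 1" by (simp add: power_int_add)
  then have "n = 49 * (- k)" by (simp add: powi_eq_1_iff)
  then show False using n by simp
qed

lemma jq_reflect: "jq (49 - n) = jq n"
  using nome.jfun_q_div[OF nome_49, of "q powi n"] by (simp add: jq_def power_int_diff)

lemma jq_minus: "jq (- n) = - jq n / q powi n"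
  using nome.jfun_inverse[OF nome_49, of "q powi n"] by (simp add: jq_def power_int_minus_divide)

lemma jl_reflect: "jl (49 - n) = - jl n"
  using nome.jld_q_div[OF nome_49, of "q powi n"] by (simp add: jl_def power_int_diff)

lemma pair_sum_eq:
  assumes "\<not> 7 dvd k" "\<not> 7 dvd a" "\<not> 7 dvd (a + k)" "\<not> 7 dvd (a - k)"
  shows "pair_sum a k = kap k * lambert3 1 (q powi (7 * a)) (q ^ 49)
    + qpoch_inf (q ^ 49) (q ^ 49) ^ 3 * jq (7 * k) * jq (14 * k) / (jq (7 * a - 7 * k) * jq (7 * a) * jq (7 * a + 7 * k))"
proof -
  have "\<not> 49 dvd 7 * k" "\<not> 49 dvd 7 * a" "\<not> 49 dvd 7 * a + 7 * k" "\<not> 49 dvd 7 * a - 7 * k"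
    using assms by presburger+
  then have "jq (7 * k) \<noteq> 0" "jq (7 * a) \<noteq> 0" "jq (7 * a + 7 * k) \<noteq> 0" "jq (7 * a - 7 * k) \<noteq> 0"
    by (simp_all only: jq_nz not_False_eq_True)
  then show ?thesis
    using nome.lambert3_three_term(2)[OF nome_49, of "q powi (7 * k)" "q powi (7 * a)"]
    by (simp add: pair_sum_def kap_def jq_def power_int_add power_int_diff powi_square)
qed

text \<open>The collision z = s: the theta quotient of \<open>pair_sum_eq\<close> would have the
  denominator j(1) = 0, and its finite part is a sum of two logarithmic derivatives.\<close>

lemma pair_sum_diag:
  assumes "\<not> 7 dvd k" "\<not> 7 dvd (2 * k)"
  shows "pair_sum k k = kap k * lambert3 1 (q powi (7 * k)) (q ^ 49) + jl (7 * k) + jl (14 * k)"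
proof -
  have "\<not> 49 dvd 7 * k" "\<not> 49 dvd 14 * k"
    using assms by presburger+
  then have "jq (7 * k) \<noteq> 0" "jq (14 * k) \<noteq> 0"
    by (simp_all only: jq_nz not_False_eq_True)
  then show ?thesis
    using nome.lambert3_three_term_limit[OF nome_49, of "q powi (7 * k)"]
    by (simp add: pair_sum_def kap_def jq_def jl_def powi_square power2_eq_square[symmetric])
qed

text \<open>The prefactors of k and -k differ by q^(21k) = s^3, as \<open>pair_sum\<close> requires.
  The common exponent 3(\<open>tri k\<close> - 3k) equals -9, -15, -18 for k = 1, 2, 3.\<close>

lemma rank_sum_pairs:
  assumes "2 * E = 3 * a * (7 - a)"
  shows "rank_sum (10 - 3 * a) = (- 1) powi a * q powi E * (lambert3 1 (q powi (7 * a)) (q ^ 49)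
     - q powi (- 9) * pair_sum a 1 + q powi (- 15) * pair_sum a 2 - q powi (- 18) * pair_sum a 3)"
proof -
  let ?f = "\<lambda>k. (- 1) powi k * q powi (3 * (tri k + 4 * k)) * lambert3 (q powi (21 * k)) (q powi (7 * (a + k))) (q ^ 49)"
  have pair: "?f k + ?f (- k) = (- 1) powi k * q powi (3 * (tri k - 3 * k)) * pair_sum a k" for k
  proof -
    have "3 * (tri k + 4 * k) = 3 * (tri k - 3 * k) + 21 * k" by simp
    then have 1: "q powi (3 * (tri k + 4 * k)) = q powi (3 * (tri k - 3 * k)) * q powi (21 * k)"
      by (simp only: power_int_add[OF disjI1[OF q_nz]])
    have 2: "3 * (tri (- k) + 4 * (- k)) = 3 * (tri k - 3 * k)" by (simp add: tri_minus)
    have 3: "(q powi (7 * k)) ^ 3 = q powi (21 * k)" by (simp add: powi_cube)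
    have 4: "(- 1) powi (- k) = ((- 1) powi k :: complex)" by (simp add: power_int_minus_one_minus)
    have 5: "q powi (7 * (a + k)) = q powi (7 * a) * q powi (7 * k)" "q powi (7 * (a + - k)) = q powi (7 * a) / q powi (7 * k)"
      "q powi (21 * - k) = 1 / q powi (21 * k)"
      by (simp_all add: distrib_left right_diff_distrib power_int_add power_int_diff power_int_minus_divide)
    show ?thesis
      unfolding pair_sum_def 1 2 3 4 5 by (simp add: algebra_simps)
  qed
  have t: "tri 1 = 0" "tri 2 = 1" "tri 3 = 3" by (simp_all add: tri_def)
  show ?thesis
    unfolding rank_sum_dissect[OF assms] sum_minus3_3 pair by (simp add: t)
qed

text \<open>The quintuple product turns each pair k, -k into \<open>kap k\<close> times
  (q^49;q^49)_inf. The bracket agrees with the total coefficient of \<open>lambert3 1\<close> that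
  arises from \<open>rank_sum_pairs\<close>.\<close>

lemma euler_product_dissect:
  "qpoch_inf q q = - (q ^ 2) * qpoch_inf (q ^ 49) (q ^ 49) *
     (1 - q powi (- 9) * kap 1 + q powi (- 15) * kap 2 - q powi (- 18) * kap 3)"
proof -
  interpret Q: nome "q ^ 49" by (rule nome_49)
  interpret Q3: nome "(q ^ 49) ^ 3" by (rule Q.nome_power) simp
  let ?P = "qpoch_inf (q ^ 49) (q ^ 49)"
  let ?f = "\<lambda>k. (- 1) powi k * q powi (3 * tri k + 5 * k) * jfun (q powi (21 * k) * (q ^ 49) ^ 2) ((q ^ 49) ^ 3)"
  have pair: "?f k + ?f (- k) = (- 1) powi k * q powi (3 * (tri k - 3 * k)) * (kap k * ?P)" if "\<not> 7 dvd k" for k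
  proof -
    let ?s = "q powi (7 * k)"
    have nz: "jfun ?s (q ^ 49) \<noteq> 0"
    proof -
      have "\<not> 49 dvd 7 * k" using that by presburger
      then show ?thesis using jq_nz[of "7 * k"] by (simp add: jq_def)
    qed
    have s3: "?s ^ 3 = q powi (21 * k)" by (simp add: powi_cube)
    have "x ^ 3 / (r * x) = 1 / r * x ^ 2" if "x \<noteq> 0" for r x :: complex
      using that by (simp add: power2_eq_square power3_eq_cube)
    from this[of "q ^ 49" "q powi (21 * k)"]
    have "(q ^ 49) ^ 3 / (q powi (21 * k) * q ^ 49) = 1 / q powi (21 * k) * (q ^ 49) ^ 2"
      by (simp only: power_eq_0_iff q_nz simp_thms)
    moreover have "q powi (21 * - k) = 1 / q powi (21 * k)" by (simp add: power_int_minus_divide)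
    ultimately have "jfun (q powi (21 * - k) * (q ^ 49) ^ 2) ((q ^ 49) ^ 3) = jfun (q powi (21 * k) * q ^ 49) ((q ^ 49) ^ 3)"
      using Q3.jfun_q_div[of "q powi (21 * k) * q ^ 49"] by (simp only:)
    moreover have "3 * tri k + 5 * k = 3 * (tri k - 3 * k) + 2 * (7 * k)" "3 * tri (- k) + 5 * (- k) = 3 * (tri k - 3 * k) + 7 * k"
      by (simp_all add: tri_minus)
    then have "q powi (3 * tri k + 5 * k) = q powi (3 * (tri k - 3 * k)) * ?s\<^sup>2"
      "q powi (3 * tri (- k) + 5 * (- k)) = q powi (3 * (tri k - 3 * k)) * ?s"
      by (simp_all only: power_int_add[OF disjI1[OF q_nz]] powi_square)
    moreover have "(- 1) powi (- k) = ((- 1) powi k :: complex)" by (simp add: power_int_minus_one_minus)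
    ultimately have "?f k + ?f (- k) = (- 1) powi k * q powi (3 * (tri k - 3 * k)) *
       (?s\<^sup>2 * jfun (?s ^ 3 * (q ^ 49) ^ 2) ((q ^ 49) ^ 3) + ?s * jfun (?s ^ 3 * q ^ 49) ((q ^ 49) ^ 3))"
      unfolding s3 by (simp only:) (simp only: algebra_simps)
    also have "\<dots> = (- 1) powi k * q powi (3 * (tri k - 3 * k)) * (kap k * ?P)"
      using Q.lambert3_three_term(1)[of ?s] nz by (simp add: kap_def jq_def powi_square)
    finally show ?thesis .
  qed
  have f0: "?f 0 = ?P"
  proof -
    have "jfun ((q ^ 49) ^ 2) ((q ^ 49) ^ 3) = ?P"
      using Q3.jfun_has_sum[of "(q ^ 49) ^ 2"] Q.pentagonal by (auto intro: has_sum_unique)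
    then show ?thesis by (simp del: power_mult_numeral)
  qed
  have t: "tri 1 = 0" "tri 2 = 1" "tri 3 = 3" by (simp_all add: tri_def)
  have d: "\<not> (7::int) dvd 1" "\<not> (7::int) dvd 2" "\<not> (7::int) dvd 3" by auto
  have "qpoch_inf q q = - (q ^ 2) * (?P + (- 1) powi 1 * q powi (3 * (tri 1 - 3 * 1)) * (kap 1 * ?P)
     + (- 1) powi 2 * q powi (3 * (tri 2 - 3 * 2)) * (kap 2 * ?P) + (- 1) powi 3 * q powi (3 * (tri 3 - 3 * 3)) * (kap 3 * ?P))"
    using euler_dissect unfolding sum_minus3_3 f0 pair[OF d(1)] pair[OF d(2)] pair[OF d(3)] .
  then show ?thesis by (simp add: t algebra_simps)
qed

lemma jq_values:
  "jq 28 = jq 21" "jq 35 = jq 14" "jq 42 = jq 7" "jq (- 7) = - jq 7 / q ^ 7" "jq (- 14) = - jq 14 / q ^ 14"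
  using jq_reflect[of 21] jq_reflect[of 14] jq_reflect[of 7] jq_minus[of 7] jq_minus[of 14] by simp_all

lemma jl_values: "jl 28 = - jl 21" "jl 35 = - jl 14" "jl 42 = - jl 7"
  using jl_reflect[of 21] jl_reflect[of 14] jl_reflect[of 7] by simp_all

lemma jq_nonzero: "jq 7 \<noteq> 0" "jq 14 \<noteq> 0" "jq 21 \<noteq> 0"
  by (rule jq_nz, simp)+

lemma qpoch_inf_49_nz: "qpoch_inf (q ^ 49) (q ^ 49) \<noteq> 0"
  by (rule nome.qpoch_inf_q_nz[OF nome_49])

lemma gmock_lambert3:
  assumes "\<not> 7 dvd a"
  shows "lambert3 1 (q powi (7 * a)) (q ^ 49) = qpoch_inf (q ^ 49) (q ^ 49) * gmock (q powi (7 * a)) (q ^ 49)"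
proof -
  interpret Q: nome "q ^ 49" by (rule nome_49)
  have "jq (7 * a) \<noteq> 0" by (rule jq_nz) (use assms in presburger)
  then have "q powi (7 * a) * (q ^ 49) powi k \<noteq> 1" for k
    unfolding jq_def by (subst (asm) Q.jfun_eq_0_iff) auto
  then show ?thesis
    using Q.gmock_eq_lambert3[of "q powi (7 * a)"] by simp
qed

text \<open>The coefficients of \<open>lambert3 1\<close> add up to the bracket \<open>X\<close> of
  the Euler product, so this series becomes (q)_inf times \<open>gmock\<close> and a power of q. The
  exponents 7, 13, 16 are E - 2 for E = 9, 15, 18. One of the three pairs is the collision k = a,
  the other two give theta quotients.\<close>

lemma rank_sum_values:
  fixes P J A B C
  defines "P \<equiv> qpoch_inf q q" and "J \<equiv> qpoch_inf (q ^ 49) (q ^ 49)"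
    and "A \<equiv> jq 21" and "B \<equiv> jq 14" and "C \<equiv> jq 7"
  shows "rank_sum 7 = q ^ 7 * P * gmock (q ^ 7) (q ^ 49) + (jl 7 + jl 14) + q * (J ^ 3 * B / C\<^sup>2) - q ^ 5 * (J ^ 3 / B)"
    and "rank_sum 4 = - (q ^ 13) * P * gmock (q ^ 14) (q ^ 49) + (jl 14 - jl 21) - q ^ 6 * (J ^ 3 / A) + q ^ 4 * (J ^ 3 * A / B\<^sup>2)"
    and "rank_sum 1 = q ^ 16 * P * gmock (q ^ 21) (q ^ 49) + (jl 21 - jl 7) + q ^ 9 * (J ^ 3 * C / A\<^sup>2) - q ^ 3 * (J ^ 3 / C)"
proof -
  have nz: "A \<noteq> 0" "B \<noteq> 0" "C \<noteq> 0" "J \<noteq> 0"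
    using jq_nonzero qpoch_inf_49_nz by (auto simp: A_def B_def C_def J_def)
  define X where "X = 1 - q powi (- 9) * kap 1 + q powi (- 15) * kap 2 - q powi (- 18) * kap 3"
  have P: "P = - (q ^ 2) * J * X"
    unfolding P_def J_def X_def by (rule euler_product_dissect)
  have p: "q powi (- 9) = 1 / q ^ 9" "q powi (- 15) = 1 / q ^ 15" "q powi (- 18) = 1 / q ^ 18"
    by (simp_all add: power_int_minus_divide)
  have pw: "q ^ 9 = q ^ 7 * q\<^sup>2" "q ^ 15 = q ^ 13 * q\<^sup>2" "q ^ 18 = q ^ 16 * q\<^sup>2"
      "q ^ 15 = q ^ 9 * q ^ 6" "q ^ 7 = q ^ 6 * q" "q ^ 18 = q ^ 9 * q ^ 9" "q ^ 14 = q ^ 9 * q ^ 5"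
      "q ^ 18 = q ^ 15 * q ^ 3" "q ^ 7 = q ^ 3 * q ^ 4"
    by (simp_all flip: power_add power_Suc2)
  have t1: "- (q ^ 9) * (J * g * X) = q ^ 7 * P * g" "q ^ 15 * (J * g * X) = - (q ^ 13) * P * g"
    "- (q ^ 18) * (J * g * X) = q ^ 16 * P * g" for g
    unfolding P pw(1-3) by (simp_all only: mult_minus_left mult_minus_right mult_ac minus_minus)
  have t2: "q ^ 9 * (1 / q ^ 15 * (J ^ 3 * B * A / (- C / q ^ 7 * C * A))) = - (q * (J ^ 3 * B / C\<^sup>2))"
    unfolding pw(4,5) using nz by (simp add: field_simps power2_eq_square)
  have t3: "q ^ 9 * (1 / q ^ 18 * (J ^ 3 * A * C / (- B / q ^ 14 * C * A))) = - (q ^ 5 * (J ^ 3 / B))"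
    unfolding pw(6,7) using nz by (simp add: field_simps)
  have t4: "q ^ 15 * (1 / q ^ 9 * (J ^ 3 * C * B / (C * B * A))) = q ^ 6 * (J ^ 3 / A)"
    unfolding pw(4) using nz by (simp add: field_simps)
  have t5: "q ^ 15 * (1 / q ^ 18 * (J ^ 3 * A * C / (- C / q ^ 7 * B * B))) = - (q ^ 4 * (J ^ 3 * A / B\<^sup>2))"
    unfolding pw(8,9) using nz by (simp add: field_simps power2_eq_square)
  have t6: "q ^ 18 * (1 / q ^ 9 * (J ^ 3 * C * B / (B * A * A))) = q ^ 9 * (J ^ 3 * C / A\<^sup>2)"
    unfolding pw(6) using nz by (simp add: field_simps power2_eq_square)
  have t7: "q ^ 18 * (1 / q ^ 15 * (J ^ 3 * B * A / (C * A * B))) = q ^ 3 * (J ^ 3 / C)"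
    unfolding pw(8) using nz by (simp add: field_simps)
  have lin: "- u * (x - 1 / u * l + y - z) = - u * x + l - u * y + u * z"
    "u * (x - y + 1 / u * l - z) = u * x - u * y + l - u * z"
    "- u * (x - y + z - 1 / u * l) = - u * x + u * y - u * z + l" if "u \<noteq> 0" "u \<noteq> 0" for u x y z l :: complex
    using that by (simp_all add: algebra_simps)
  have gen: "u * (L - a * (k1 * L + t1) + b * (k2 * L + t2) - c * (k3 * L + t3))
     = u * (L * (1 - a * k1 + b * k2 - c * k3) - a * t1 + b * t2 - c * t3)" for u L a b c k1 k2 k3 t1 t2 t3 :: complex
    by (simp add: algebra_simps)
  have X: "1 - 1 / q ^ 9 * kap 1 + 1 / q ^ 15 * kap 2 - 1 / q ^ 18 * kap 3 = X"
    by (simp add: X_def p)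
  have u: "q ^ 9 \<noteq> 0" "q ^ 15 \<noteq> 0" "q ^ 18 \<noteq> 0" by simp_all
  show "rank_sum 7 = q ^ 7 * P * gmock (q ^ 7) (q ^ 49) + (jl 7 + jl 14) + q * (J ^ 3 * B / C\<^sup>2) - q ^ 5 * (J ^ 3 / B)"
  proof -
    let ?L = "J * gmock (q ^ 7) (q ^ 49)"
    have L: "lambert3 1 (q ^ 7) (q ^ 49) = ?L"
      using gmock_lambert3[of 1] by (simp add: J_def)
    have d1: "pair_sum 1 1 = kap 1 * ?L + (jl 7 + jl 14)"
      using pair_sum_diag[of 1] by (simp add: L jl_values)
    have d2: "pair_sum 1 2 = kap 2 * ?L + J ^ 3 * B * A / (- C / q ^ 7 * C * A)"
      using pair_sum_eq[of 2 1] by (simp add: L jq_values A_def B_def C_def J_def)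
    have d3: "pair_sum 1 3 = kap 3 * ?L + J ^ 3 * A * C / (- B / q ^ 14 * C * A)"
      using pair_sum_eq[of 3 1] by (simp add: L jq_values A_def B_def C_def J_def)
    have "rank_sum 7 = - (q ^ 9) * (?L - 1 / q ^ 9 * pair_sum 1 1 + 1 / q ^ 15 * pair_sum 1 2 - 1 / q ^ 18 * pair_sum 1 3)"
      using rank_sum_pairs[of 9 1] unfolding p by (simp add: L)
    then show ?thesis
      unfolding d1 d2 d3 gen X lin(1)[OF u(1) u(1)] by (simp only: t1 t2 t3) (simp add: algebra_simps)
  qed
  show "rank_sum 4 = - (q ^ 13) * P * gmock (q ^ 14) (q ^ 49) + (jl 14 - jl 21) - q ^ 6 * (J ^ 3 / A) + q ^ 4 * (J ^ 3 * A / B\<^sup>2)"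
  proof -
    let ?L = "J * gmock (q ^ 14) (q ^ 49)"
    have L: "lambert3 1 (q ^ 14) (q ^ 49) = ?L"
      using gmock_lambert3[of 2] by (simp add: J_def)
    have d1: "pair_sum 2 1 = kap 1 * ?L + J ^ 3 * C * B / (C * B * A)"
      using pair_sum_eq[of 1 2] by (simp add: L jq_values A_def B_def C_def J_def)
    have d2: "pair_sum 2 2 = kap 2 * ?L + (jl 14 - jl 21)"
      using pair_sum_diag[of 2] by (simp add: L jl_values)
    have d3: "pair_sum 2 3 = kap 3 * ?L + J ^ 3 * A * C / (- C / q ^ 7 * B * B)"
      using pair_sum_eq[of 3 2] by (simp add: L jq_values A_def B_def C_def J_def)
    have "rank_sum 4 = q ^ 15 * (?L - 1 / q ^ 9 * pair_sum 2 1 + 1 / q ^ 15 * pair_sum 2 2 - 1 / q ^ 18 * pair_sum 2 3)"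
      using rank_sum_pairs[of 15 2] unfolding p by (simp add: L)
    then show ?thesis
      unfolding d1 d2 d3 gen X lin(2)[OF u(2) u(2)] by (simp only: t1 t4 t5) (simp add: algebra_simps)
  qed
  show "rank_sum 1 = q ^ 16 * P * gmock (q ^ 21) (q ^ 49) + (jl 21 - jl 7) + q ^ 9 * (J ^ 3 * C / A\<^sup>2) - q ^ 3 * (J ^ 3 / C)"
  proof -
    let ?L = "J * gmock (q ^ 21) (q ^ 49)"
    have L: "lambert3 1 (q ^ 21) (q ^ 49) = ?L"
      using gmock_lambert3[of 3] by (simp add: J_def)
    have d1: "pair_sum 3 1 = kap 1 * ?L + J ^ 3 * C * B / (B * A * A)"
      using pair_sum_eq[of 1 3] by (simp add: L jq_values A_def B_def C_def J_def)
    have d2: "pair_sum 3 2 = kap 2 * ?L + J ^ 3 * B * A / (C * A * B)"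
      using pair_sum_eq[of 2 3] by (simp add: L jq_values A_def B_def C_def J_def)
    have d3: "pair_sum 3 3 = kap 3 * ?L + (jl 21 - jl 7)"
      using pair_sum_diag[of 3] by (simp add: L jl_values)
    have "rank_sum 1 = - (q ^ 18) * (?L - 1 / q ^ 9 * pair_sum 3 1 + 1 / q ^ 15 * pair_sum 3 2 - 1 / q ^ 18 * pair_sum 3 3)"
      using rank_sum_pairs[of 18 3] unfolding p by (simp add: L)
    then show ?thesis
      unfolding d1 d2 d3 gen X lin(3)[OF u(3) u(3)] by (simp only: t1 t6 t7) (simp add: algebra_simps)
  qed
qed

end

section \<open>Values at the seventh roots of unity\<close>

lemma theta7_diff:
  "theta7 a0 a1 a2 a3 a4 a6 q - theta7 b0 b1 b2 b3 b4 b6 q =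
   theta7 (a0 - b0) (a1 - b1) (a2 - b2) (a3 - b3) (a4 - b4) (a6 - b6) q"
  by (simp add: theta7_def algebra_simps)

lemma G7_diff: "G7 a0 a2 a6 q - G7 b0 b2 b6 q = G7 (a0 - b0) (a2 - b2) (a6 - b6) q"
  by (simp add: G7_def algebra_simps)

lemma theta7_0: "theta7 0 0 0 0 0 0 q = 0"
  by (simp add: theta7_def)

lemma G7_0: "G7 0 0 0 q = 0"
  by (simp add: G7_def)

lemma seventh_root_sum:
  fixes z :: complex
  assumes "z ^ 7 = 1" "z \<noteq> 1"
  shows "1 + z + z ^ 2 + z ^ 3 + z ^ 4 + z ^ 5 + z ^ 6 = 0"
proof -
  have "(z - 1) * (1 + z + z ^ 2 + z ^ 3 + z ^ 4 + z ^ 5 + z ^ 6) = z ^ 7 - 1"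
    by (simp add: algebra_simps eval_nat_numeral)
  then show ?thesis using assms by simp
qed

text \<open>The cubic Gaussian periods: every product of them reduces to a linear
  expression.\<close>

lemma seventh_root_periods:
  fixes z :: complex
  assumes "z ^ 7 = 1" "z \<noteq> 1"
  defines "\<alpha> \<equiv> z + z ^ 6" and "\<beta> \<equiv> z ^ 2 + z ^ 5" and "\<gamma> \<equiv> z ^ 3 + z ^ 4"
  shows "\<alpha> + \<beta> + \<gamma> = - 1" "\<alpha> * \<beta> = \<alpha> + \<gamma>" "\<beta> * \<gamma> = \<alpha> + \<beta>" "\<alpha> * \<gamma> = \<beta> + \<gamma>" "\<beta> * \<beta> = \<gamma> + 2"
proof -
  show "\<alpha> + \<beta> + \<gamma> = - 1"
    using seventh_root_sum[OF assms(1,2)] unfolding \<alpha>_def \<beta>_def \<gamma>_def by algebra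
  show "\<alpha> * \<beta> = \<alpha> + \<gamma>" "\<beta> * \<gamma> = \<alpha> + \<beta>" "\<alpha> * \<gamma> = \<beta> + \<gamma>" "\<beta> * \<beta> = \<gamma> + 2"
    using assms(1) unfolding \<alpha>_def \<beta>_def \<gamma>_def by algebra+
qed

context nome
begin

lemma jq_add: "jq (49 + n) = - jq n / q powi n"
  using nome.jfun_mult_q[OF nome_49, of "q powi n"] by (simp add: jq_def power_int_add)

lemma jl_add: "jq n \<noteq> 0 \<Longrightarrow> jl (49 + n) = jl n - 1"
  using nome.jld_mult_q[OF nome_49, of "q powi n"] by (simp add: jq_def jl_def power_int_add)

lemma jl_sum:
  assumes "jq n \<noteq> 0" "jq (2 * n) \<noteq> 0" "jq (4 * n) \<noteq> 0"
  shows "qpoch_inf (q ^ 49) (q ^ 49) ^ 3 * jq (3 * n) ^ 2 =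
    jq n ^ 2 * jq (4 * n) * (1 - 2 * jl n - jl (2 * n) + jl (4 * n))"
proof -
  have "(q powi n) ^ 4 = q powi (4 * n)"
    using power_int_mult[of q n 4] by (simp add: mult.commute)
  then show ?thesis
    using nome.jld_sum[OF nome_49, of "q powi n"] assms
    by (simp add: jq_def jl_def powi_square powi_cube)
qed

text \<open>\<open>jfun_quartic\<close> at x = q^7 with nome q^49. It is the one algebraic relation
  between the three theta functions used in matching the rank sums with
  \<open>theta7\<close>.\<close>

lemma klein_relation: "q ^ 7 * jq 14 * jq 7 ^ 3 = jq 21 * jq 14 ^ 3 - jq 21 ^ 3 * jq 7"
  using nome.jfun_quartic[OF nome_49, of "q ^ 7"] jq_reflect[of 14] jq_reflect[of 21]
  by (simp add: jq_def flip: power_mult)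

text \<open>\<open>jl_sum\<close> at n = 7, 21, 14. The indices 56, 63, 84 are reduced by the period
  49; for the logarithmic derivatives this subtracts 1, which cancels the constant in the second and
  third relation but not in the first.\<close>

lemma jl_values_theta:
  fixes T A B C
  defines "T \<equiv> qpoch_inf (q ^ 49) (q ^ 49) ^ 3" and "A \<equiv> jq 21" and "B \<equiv> jq 14" and "C \<equiv> jq 7"
  shows "T * A / C\<^sup>2 = 1 - 2 * jl 7 - jl 14 - jl 21"
    and "q ^ 7 * (T * B / A\<^sup>2) = 2 * jl 21 - jl 7 + jl 14"
    and "q ^ 7 * (T * C / B\<^sup>2) = 2 * jl 14 - jl 21 - jl 7"
proof -
  have nz: "A \<noteq> 0" "B \<noteq> 0" "C \<noteq> 0"
    using jq_nonzero by (auto simp: A_def B_def C_def)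
  have v: "jq 56 = - C / q ^ 7" "jq 63 = - B / q ^ 14" "jq 84 = - B / q ^ 35" "jl 56 = jl 7 - 1" "jl 84 = - jl 14 - 1"
    using jq_add[of 7] jq_add[of 14] jq_add[of 35] jl_add[of 7] jl_add[of 35] jq_nonzero
    by (simp_all add: jq_values jl_values B_def C_def)
  have 1: "T * A\<^sup>2 = C\<^sup>2 * A * (1 - 2 * jl 7 - jl 14 - jl 21)"
    using jl_sum[of 7] nz by (simp add: jq_values jl_values T_def A_def B_def C_def)
  then show "T * A / C\<^sup>2 = 1 - 2 * jl 7 - jl 14 - jl 21"
    using nz by (simp add: divide_eq_eq power2_eq_square mult_ac)
  have 2: "T * (- B / q ^ 14)\<^sup>2 = A\<^sup>2 * (- B / q ^ 35) * (1 - 2 * jl 21 + jl 7 + (- jl 14 - 1))"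
    using jl_sum[of 21] nz jq_nonzero v unfolding T_def[symmetric] by (simp add: jq_values jl_values A_def)
  have cancel: "w * (T * b / a\<^sup>2) = - Y"
    if eq: "T * (- b / p)\<^sup>2 = a\<^sup>2 * (- b / (p\<^sup>2 * w)) * Y" and nz: "a \<noteq> 0" "b \<noteq> 0" "p \<noteq> 0" "w \<noteq> 0" for a b p w Y :: complex
  proof -
    have "w * (T * b / a\<^sup>2) = (T * (- b / p)\<^sup>2) * (p\<^sup>2 * w / (b * a\<^sup>2))"
      using nz by (simp add: power2_eq_square divide_simps)
    also have "\<dots> = - Y"
      unfolding eq using nz by (simp add: power2_eq_square divide_simps)
    finally show ?thesis .
  qed
  have "q ^ 35 = (q ^ 14)\<^sup>2 * q ^ 7" by (simp flip: power_add power_mult)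
  from cancel[OF 2[unfolded this]] nz show "q ^ 7 * (T * B / A\<^sup>2) = 2 * jl 21 - jl 7 + jl 14"
    by (simp add: algebra_simps)
  have 3: "T * C\<^sup>2 = B\<^sup>2 * (- C / q ^ 7) * (1 - 2 * jl 14 + jl 21 + (jl 7 - 1))"
    using jl_sum[of 14] nz jq_nonzero v unfolding T_def[symmetric] by (simp add: jq_values jl_values B_def C_def)
  then have "T * (- C / 1)\<^sup>2 = B\<^sup>2 * (- C / (1\<^sup>2 * q ^ 7)) * (1 - 2 * jl 14 + jl 21 + (jl 7 - 1))" by simp
  from cancel[OF this] nz show "q ^ 7 * (T * C / B\<^sup>2) = 2 * jl 14 - jl 21 - jl 7"
    by (simp add: algebra_simps)
qed

text \<open>The classical dissection of (q)_inf modulo 7, obtained by inserting the three values of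
  \<open>kap\<close>.\<close>

lemma euler_quotient:
  "qpoch_inf q q = qpoch_inf (q ^ 49) (q ^ 49) * (jq 14 / jq 7 - q * jq 21 / jq 14 - q ^ 2 + q ^ 5 * jq 7 / jq 21)"
proof -
  have k: "kap 1 = q ^ 7 * (jq 14 / jq 7)" "kap 2 = q ^ 14 * (jq 21 / jq 14)" "kap 3 = q ^ 21 * (jq 7 / jq 21)"
    by (simp_all add: kap_def jq_values)
  have p: "q powi (- 9) = 1 / (q\<^sup>2 * q ^ 7)" "q powi (- 15) = q / (q\<^sup>2 * q ^ 14)" "q powi (- 18) = q ^ 5 / (q\<^sup>2 * q ^ 21)"
    by (simp_all add: power_int_minus_divide divide_simps flip: power_add power_Suc)
  have gen: "- s * J * (1 - 1 / (s * u) * (u * b) + x / (s * v) * (v * a) - y / (s * w) * (w * c)) = J * (b - x * a - s + y * c)"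
    if "s \<noteq> 0" "u \<noteq> 0" "v \<noteq> 0" "w \<noteq> 0" for s u v w J a b c x y :: complex
    using that by (simp add: field_simps)
  show ?thesis
    unfolding euler_product_dissect k p by (subst gen) simp_all
qed

section \<open>Matching the rank sums with quadratic forms in theta functions\<close>

lemma Jam_jq: "Jam 21 49 q = jq 21" "Jam 14 49 q = jq 14" "Jam 7 49 q = jq 7"
  by (simp_all add: Jam_def jq_def)

text \<open>The factors 1 - q^(7i) are sorted by i modulo 7. The six nonzero classes form three
  theta functions, which contain (q^49;q^49)_inf three times against once on the left; this explains
  the square.\<close>

lemma Jm_7: "Jm 7 q * qpoch_inf (q ^ 49) (q ^ 49) ^ 2 = jq 21 * jq 14 * jq 7"
proof -
  interpret w: nome "q ^ 7" by (rule nome_power) simp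
  have "qpoch_inf (q ^ 7) (q ^ 7) = (\<Prod>r<7. qpoch_inf (q ^ (7 * r + 7)) (q ^ 49))"
    using w.qpoch_inf_split[of 7 "q ^ 7"] by (simp flip: power_mult power_add)
  also have "\<dots> = qpoch_inf (q ^ 7) (q ^ 49) * qpoch_inf (q ^ 14) (q ^ 49) * qpoch_inf (q ^ 21) (q ^ 49)
     * qpoch_inf (q ^ 28) (q ^ 49) * qpoch_inf (q ^ 35) (q ^ 49) * qpoch_inf (q ^ 42) (q ^ 49) * qpoch_inf (q ^ 49) (q ^ 49)"
    by (simp add: lessThan_nat_numeral lessThan_Suc mult_ac)
  finally have 1: "Jm 7 q = \<dots>" by (simp add: Jm_def)
  have 2: "q ^ 49 / q ^ 7 = q ^ 42" "q ^ 49 / q ^ 14 = q ^ 35" "q ^ 49 / q ^ 21 = q ^ 28"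
    by (simp_all add: divide_simps flip: power_add)
  have 3: "jq 7 = jfun (q ^ 7) (q ^ 49)" "jq 14 = jfun (q ^ 14) (q ^ 49)" "jq 21 = jfun (q ^ 21) (q ^ 49)"
    by (simp_all add: jq_def)
  show ?thesis unfolding 1 3 jfun_def 2 by (simp add: power2_eq_square mult_ac)
qed

lemma theta7_jq:
  "qpoch_inf q q * theta7 a0 a1 a2 a3 a4 a6 q = qpoch_inf (q ^ 49) (q ^ 49) ^ 3 / 7 *
    ((jq 14 / jq 7 - q * jq 21 / jq 14 - q ^ 2 + q ^ 5 * jq 7 / jq 21) *
      (a0 * jq 21 ^ 2 + a1 * q * jq 14 * jq 21 + a2 * q ^ 2 * jq 14 ^ 2 + a3 * q ^ 3 * jq 7 * jq 21
        + a4 * q ^ 4 * jq 7 * jq 14 + a6 * q ^ 6 * jq 7 ^ 2) / (jq 21 * jq 14 * jq 7))"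
proof -
  let ?J = "qpoch_inf (q ^ 49) (q ^ 49)"
  have "Jm 7 q = jq 21 * jq 14 * jq 7 / ?J ^ 2"
    using Jm_7 qpoch_inf_49_nz by (simp add: field_simps)
  then have e: "1 / (7 * Jm 7 q) = ?J ^ 2 / 7 / (jq 21 * jq 14 * jq 7)" by simp
  have alg: "J * X * (J ^ 2 / 7 / D * Y) = J ^ 3 / 7 * (X * Y / D)" for J X D Y :: complex
    by (simp add: power2_eq_square power3_eq_cube)
  show ?thesis
    unfolding theta7_def Jam_jq e euler_quotient[of] by (rule alg)
qed

text \<open>With denominators cleared these are polynomial identities modulo \<open>K\<close>. On
  the right, the multiples of A/C^2, q^7 B/A^2, q^7 C/B^2 are those that
  \<open>jl_values_theta\<close> turns into 7(\<open>jl 7 + jl 14\<close>) - 4,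
  7(\<open>jl 21 - jl 7\<close>) + 2 and 7(\<open>jl 21 - jl 14\<close>) + 1; the terms with
  coefficient \<plusminus>7 are the theta quotients in \<open>rank_sum_values\<close>.\<close>

lemma theta_quotients:
  fixes A B C :: complex
  assumes nz: "A \<noteq> 0" "B \<noteq> 0" "C \<noteq> 0" and K: "q ^ 7 * B * C ^ 3 = A * B ^ 3 - A ^ 3 * C"
  defines "F \<equiv> B / C - q * A / B - q ^ 2 + q ^ 5 * C / A"
    and "M a0 a1 a2 a3 a4 a6 \<equiv> a0 * A ^ 2 + a1 * q * B * A + a2 * q ^ 2 * B ^ 2 + a3 * q ^ 3 * C * A
        + a4 * q ^ 4 * C * B + a6 * q ^ 6 * C ^ 2"
  shows "F * M (- 4) 3 (- 1) 2 1 (- 2) / (A * B * C) =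
      - 4 * (A / C\<^sup>2) - q ^ 7 * (B / A\<^sup>2) + 2 * (q ^ 7 * (C / B\<^sup>2)) + 7 * (q * (B / C\<^sup>2)) - 7 * (q ^ 5 * (1 / B))"
    and "F * M 2 2 4 (- 1) 3 1 / (A * B * C) =
      2 * (A / C\<^sup>2) + 4 * (q ^ 7 * (B / A\<^sup>2)) - q ^ 7 * (C / B\<^sup>2) + 7 * (q ^ 9 * (C / A\<^sup>2)) - 7 * (q ^ 3 * (1 / C))"
    and "F * M 1 1 2 3 (- 2) 4 / (A * B * C) =
      A / C\<^sup>2 + 2 * (q ^ 7 * (B / A\<^sup>2)) - 4 * (q ^ 7 * (C / B\<^sup>2)) - 7 * (q ^ 4 * (A / B\<^sup>2)) + 7 * (q ^ 6 * (1 / A))"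
proof -
  let ?G = "A * B ^ 2 - q * A ^ 2 * C - q ^ 2 * A * B * C + q ^ 5 * B * C ^ 2"
  have F: "F = ?G / (A * B * C)"
    using nz by (simp add: F_def divide_simps) (simp add: algebra_simps power2_eq_square)
  have FM: "F * m / (A * B * C) = R / (A\<^sup>2 * B\<^sup>2 * C\<^sup>2)" if "?G * m = R" for m R
    unfolding F that[symmetric] by (simp add: power2_eq_square mult_ac)
  have m1: "?G * M (- 4) 3 (- 1) 2 1 (- 2) =
    - 4 * A ^ 3 * B ^ 2 - q ^ 7 * B ^ 3 * C ^ 2 + 2 * q ^ 7 * A ^ 2 * C ^ 3 + 7 * q * A ^ 2 * B ^ 3 - 7 * q ^ 5 * A ^ 2 * B * C ^ 2"
    using K unfolding M_def by algebra
  have m2: "?G * M 2 2 4 (- 1) 3 1 =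
    2 * A ^ 3 * B ^ 2 + 4 * q ^ 7 * B ^ 3 * C ^ 2 - q ^ 7 * A ^ 2 * C ^ 3 + 7 * q ^ 9 * B ^ 2 * C ^ 3 - 7 * q ^ 3 * A ^ 2 * B ^ 2 * C"
    using K unfolding M_def by algebra
  have m3: "?G * M 1 1 2 3 (- 2) 4 =
    A ^ 3 * B ^ 2 + 2 * q ^ 7 * B ^ 3 * C ^ 2 - 4 * q ^ 7 * A ^ 2 * C ^ 3 - 7 * q ^ 4 * A ^ 3 * C ^ 2 + 7 * q ^ 6 * A * B ^ 2 * C ^ 2"
    using K unfolding M_def by algebra
  have d: "A / C\<^sup>2 = A ^ 3 * B ^ 2 / (A\<^sup>2 * B\<^sup>2 * C\<^sup>2)" "B / A\<^sup>2 = B ^ 3 * C ^ 2 / (A\<^sup>2 * B\<^sup>2 * C\<^sup>2)"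
    "C / B\<^sup>2 = A ^ 2 * C ^ 3 / (A\<^sup>2 * B\<^sup>2 * C\<^sup>2)" "B / C\<^sup>2 = A ^ 2 * B ^ 3 / (A\<^sup>2 * B\<^sup>2 * C\<^sup>2)"
    "1 / B = A ^ 2 * B * C ^ 2 / (A\<^sup>2 * B\<^sup>2 * C\<^sup>2)" "C / A\<^sup>2 = B ^ 2 * C ^ 3 / (A\<^sup>2 * B\<^sup>2 * C\<^sup>2)"
    "1 / C = A ^ 2 * B ^ 2 * C / (A\<^sup>2 * B\<^sup>2 * C\<^sup>2)" "A / B\<^sup>2 = A ^ 3 * C ^ 2 / (A\<^sup>2 * B\<^sup>2 * C\<^sup>2)"
    "1 / A = A * B ^ 2 * C ^ 2 / (A\<^sup>2 * B\<^sup>2 * C\<^sup>2)"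
    using nz by (simp_all add: power2_eq_square power3_eq_cube)
  show "F * M (- 4) 3 (- 1) 2 1 (- 2) / (A * B * C) =
      - 4 * (A / C\<^sup>2) - q ^ 7 * (B / A\<^sup>2) + 2 * (q ^ 7 * (C / B\<^sup>2)) + 7 * (q * (B / C\<^sup>2)) - 7 * (q ^ 5 * (1 / B))"
    unfolding FM[OF m1] d by (simp add: add_divide_distrib diff_divide_distrib mult.assoc)
  show "F * M 2 2 4 (- 1) 3 1 / (A * B * C) =
      2 * (A / C\<^sup>2) + 4 * (q ^ 7 * (B / A\<^sup>2)) - q ^ 7 * (C / B\<^sup>2) + 7 * (q ^ 9 * (C / A\<^sup>2)) - 7 * (q ^ 3 * (1 / C))"
    unfolding FM[OF m2] d by (simp add: add_divide_distrib diff_divide_distrib mult.assoc)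
  show "F * M 1 1 2 3 (- 2) 4 / (A * B * C) =
      A / C\<^sup>2 + 2 * (q ^ 7 * (B / A\<^sup>2)) - 4 * (q ^ 7 * (C / B\<^sup>2)) - 7 * (q ^ 4 * (A / B\<^sup>2)) + 7 * (q ^ 6 * (1 / A))"
    unfolding FM[OF m3] d by (simp add: add_divide_distrib diff_divide_distrib mult.assoc)
qed

text \<open>The constants are those left by the logarithmic derivatives, namely -4/7, 2/7, 1/7. In
  the first line \<open>rank_sum_shift\<close>, used to pass from b = 7 to b = 0, raises -4/7 to 3/7
  and also supplies the 1 next to g in \<open>G7\<close>.\<close>

theorem rank_sum_theta7:
  "qpoch_inf q q * (theta7 (- 4) 3 (- 1) 2 1 (- 2) q + G7 1 0 0 q) = rank_sum 0 + 3 / 7"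
  "qpoch_inf q q * (theta7 2 2 4 (- 1) 3 1 q + G7 0 1 0 q) = rank_sum 1 + 2 / 7"
  "qpoch_inf q q * (theta7 1 1 2 3 (- 2) 4 q + G7 0 0 1 q) = rank_sum 2 + 1 / 7"
proof -
  let ?T = "qpoch_inf (q ^ 49) (q ^ 49) ^ 3"
  note tq = theta_quotients[OF jq_nonzero(3,2,1) klein_relation]
  note tv = jl_values_theta
  note rv = rank_sum_values
  have out: "T / 7 * (a * x + b) = (a * (T * x)) / 7 + T / 7 * b" for T a b x :: complex
    by (simp add: algebra_simps)
  have 1: "qpoch_inf q q * theta7 (- 4) 3 (- 1) 2 1 (- 2) q =
    (- 4 * (?T * jq 21 / (jq 7)\<^sup>2) - q ^ 7 * (?T * jq 14 / (jq 21)\<^sup>2) + 2 * (q ^ 7 * (?T * jq 7 / (jq 14)\<^sup>2))) / 7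
     + q * (?T * jq 14 / (jq 7)\<^sup>2) - q ^ 5 * (?T / jq 14)"
    unfolding theta7_jq tq(1) by (simp add: algebra_simps add_divide_distrib diff_divide_distrib)
  have 2: "qpoch_inf q q * theta7 2 2 4 (- 1) 3 1 q =
    (2 * (?T * jq 21 / (jq 7)\<^sup>2) + 4 * (q ^ 7 * (?T * jq 14 / (jq 21)\<^sup>2)) - q ^ 7 * (?T * jq 7 / (jq 14)\<^sup>2)) / 7
     + q ^ 9 * (?T * jq 7 / (jq 21)\<^sup>2) - q ^ 3 * (?T / jq 7)"
    unfolding theta7_jq tq(2) by (simp add: algebra_simps add_divide_distrib diff_divide_distrib)
  have 3: "qpoch_inf q q * theta7 1 1 2 3 (- 2) 4 q =
    (?T * jq 21 / (jq 7)\<^sup>2 + 2 * (q ^ 7 * (?T * jq 14 / (jq 21)\<^sup>2)) - 4 * (q ^ 7 * (?T * jq 7 / (jq 14)\<^sup>2))) / 7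
     - q ^ 4 * (?T * jq 21 / (jq 14)\<^sup>2) + q ^ 6 * (?T / jq 21)"
    unfolding theta7_jq tq(3) by (simp add: algebra_simps add_divide_distrib diff_divide_distrib)
  have r: "rank_sum 0 = rank_sum 7 + qpoch_inf q q - 1" "rank_sum 2 = - rank_sum 4"
    using rank_sum_shift rank_sum_reflect[of 4] by (simp_all add: algebra_simps)
  show "qpoch_inf q q * (theta7 (- 4) 3 (- 1) 2 1 (- 2) q + G7 1 0 0 q) = rank_sum 0 + 3 / 7"
    unfolding distrib_left 1 tv G7_def r rv by (simp add: field_simps)
  show "qpoch_inf q q * (theta7 2 2 4 (- 1) 3 1 q + G7 0 1 0 q) = rank_sum 1 + 2 / 7"
    unfolding distrib_left 2 tv G7_def rv by (simp add: field_simps)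
  show "qpoch_inf q q * (theta7 1 1 2 3 (- 2) 4 q + G7 0 0 1 q) = rank_sum 2 + 1 / 7"
    unfolding distrib_left 3 tv G7_def r rv by (simp add: field_simps)
qed

text \<open>For p = q^n, (zp)^7 = p^7, so 1/(1 - zp) is the sum of z^b p^b / (1 - p^7) over b < 7.
  This fails for n = 0, a term that \<open>rank_sum\<close> omits and that contributes 1/(1 - z)
  separately.\<close>

theorem rank_lambert_root:
  assumes z: "z ^ 7 = 1" "z \<noteq> 1"
  shows "(1 - z) * rank_lambert z q = 1 + (2 - (z + z ^ 6)) * rank_sum 0
     + (z + z ^ 6 - (z ^ 2 + z ^ 5)) * rank_sum 1 + (z ^ 2 + z ^ 5 - (z ^ 3 + z ^ 4)) * rank_sum 2"
proof -
  interpret w: nome "q ^ 7" by (rule nome_power) simp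
  let ?g = "\<lambda>b n. gterm (- (q powi (b + 2))) (q ^ 3) n"
  let ?t = "\<lambda>b n. ?g b n / (1 - (q ^ 7) powi n)"
  have s: "(\<lambda>n. ?t b n) summable_on UNIV" for b
    by (rule abs_summable_summable[OF rank_sum_summable])
  have hs: "((\<lambda>n. ?t b n) has_sum rank_sum b) UNIV" for b
    unfolding rank_sum_def by (rule has_sum_infsum[OF s])
  have "((\<lambda>n. (if n = 0 then 1 / (1 - z) else 0) + (?t 0 n + z * ?t 1 n + z ^ 2 * ?t 2 n + z ^ 3 * ?t 3 n + z ^ 4 * ?t 4 n
      + z ^ 5 * ?t 5 n + z ^ 6 * ?t 6 n)) has_sum
     (1 / (1 - z) + (rank_sum 0 + z * rank_sum 1 + z ^ 2 * rank_sum 2 + z ^ 3 * rank_sum 3 + z ^ 4 * rank_sum 4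
      + z ^ 5 * rank_sum 5 + z ^ 6 * rank_sum 6))) UNIV"
  proof (intro has_sum_add has_sum_cmult_right hs)
    show "((\<lambda>n::int. if n = 0 then 1 / (1 - z) else 0) has_sum 1 / (1 - z)) UNIV"
      by (rule has_sum_finite_neutralI[of "{0}"]) auto
  qed
  moreover have "(if n = 0 then 1 / (1 - z) else 0) + (?t 0 n + z * ?t 1 n + z ^ 2 * ?t 2 n + z ^ 3 * ?t 3 n + z ^ 4 * ?t 4 n
      + z ^ 5 * ?t 5 n + z ^ 6 * ?t 6 n) = gterm (- (q ^ 2)) (q ^ 3) n / (1 - z * q powi n)" for n
  proof (cases "n = 0")
    case True
    then show ?thesis by (simp add: gterm_def)
  next
    case False
    let ?p = "q powi n"
    have w: "(q ^ 7) powi n = ?p ^ 7"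
      using power_int_mult[of q 7 n] power_int_mult[of q n 7] by (simp add: mult.commute)
    have nz: "1 - ?p ^ 7 \<noteq> 0"
      using w.powi_eq_1_iff[of n] False unfolding w by simp
    have "(1 - z * ?p) * (1 + z * ?p + (z * ?p) ^ 2 + (z * ?p) ^ 3 + (z * ?p) ^ 4 + (z * ?p) ^ 5 + (z * ?p) ^ 6) = 1 - (z * ?p) ^ 7"
      by (simp add: algebra_simps eval_nat_numeral)
    also have "\<dots> = 1 - ?p ^ 7" using z(1) by (simp add: power_mult_distrib)
    finally have geo: "(1 - z * ?p) * (1 + z * ?p + (z * ?p) ^ 2 + (z * ?p) ^ 3 + (z * ?p) ^ 4 + (z * ?p) ^ 5 + (z * ?p) ^ 6) = 1 - ?p ^ 7" .
    have g: "?g (int b) n = gterm (- (q ^ 2)) (q ^ 3) n * ?p ^ b" for b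
    proof -
      have "q powi (int b * n) = ?p ^ b"
        using power_int_mult[of q n "int b"] by (simp add: mult.commute)
      moreover have "gterm (- (q ^ 2)) (q ^ 3) n = (- 1) powi n * q powi (2 * n + int 3 * tri n)"
        using gterm_neg_powi[of 2 3 n] by simp
      ultimately show ?thesis
        unfolding gterm_neg_powi unfolding distrib_right power_int_add[OF disjI1[OF q_nz]] by (simp only: mult_ac)
    qed
    have "?t (int b) n = gterm (- (q ^ 2)) (q ^ 3) n / (1 - ?p ^ 7) * ?p ^ b" for b
      unfolding g w by simp
    from this[of 0] this[of 1] this[of 2] this[of 3] this[of 4] this[of 5] this[of 6]
    have "(?t 0 n + z * ?t 1 n + z ^ 2 * ?t 2 n + z ^ 3 * ?t 3 n + z ^ 4 * ?t 4 n + z ^ 5 * ?t 5 n + z ^ 6 * ?t 6 n)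
      = gterm (- (q ^ 2)) (q ^ 3) n / (1 - ?p ^ 7) * (1 + z * ?p + (z * ?p) ^ 2 + (z * ?p) ^ 3 + (z * ?p) ^ 4 + (z * ?p) ^ 5 + (z * ?p) ^ 6)"
      by (simp only: of_nat_0 of_nat_1 of_nat_numeral) (simp add: power_mult_distrib algebra_simps)
    also have "\<dots> = gterm (- (q ^ 2)) (q ^ 3) n / (1 - z * ?p)"
    proof -
      have "G / N * Y = G / d" if "d * Y = N" "N \<noteq> 0" for G N Y d :: complex
        using that by (auto simp: divide_simps)
      from this[OF geo nz] show ?thesis .
    qed
    finally show ?thesis using False by simp
  qed
  ultimately have "rank_lambert z q = 1 / (1 - z) + (rank_sum 0 + z * rank_sum 1 + z ^ 2 * rank_sum 2 + z ^ 3 * rank_sum 3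
      + z ^ 4 * rank_sum 4 + z ^ 5 * rank_sum 5 + z ^ 6 * rank_sum 6)"
    unfolding rank_lambert_def by (intro infsumI) (simp only:)
  moreover have "rank_sum 3 = 0" "rank_sum 4 = - rank_sum 2" "rank_sum 5 = - rank_sum 1" "rank_sum 6 = - rank_sum 0"
    using rank_sum_reflect[of 3] rank_sum_reflect[of 2] rank_sum_reflect[of 1] rank_sum_reflect[of 0] by simp_all
  ultimately have "rank_lambert z q = 1 / (1 - z) + (rank_sum 0 * (1 - z ^ 6)
      + rank_sum 1 * (z - z ^ 5) + rank_sum 2 * (z ^ 2 - z ^ 4))"
    by (simp add: algebra_simps)
  then have "(1 - z) * rank_lambert z q = (1 - z) * (1 / (1 - z)) + (1 - z) * (rank_sum 0 * (1 - z ^ 6)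
      + rank_sum 1 * (z - z ^ 5) + rank_sum 2 * (z ^ 2 - z ^ 4))"
    by (simp only: distrib_left)
  also have "(1 - z) * (1 / (1 - z)) = 1" using z by simp
  finally have "(1 - z) * rank_lambert z q = 1 + (1 - z) * (rank_sum 0 * (1 - z ^ 6)
      + rank_sum 1 * (z - z ^ 5) + rank_sum 2 * (z ^ 2 - z ^ 4))" .
  then show ?thesis using z(1) by algebra
qed

text \<open>Together with the leading 1 of \<open>rank_lambert_root\<close>, the constants 3/7, 2/7,
  1/7 contribute (1 + z + ... + z^6)/7 = 0.\<close>

theorem rank_root:
  assumes z: "z ^ 7 = 1" "z \<noteq> 1"
  shows "(1 - z) * rank_lambert z q / qpoch_inf q q =
    2 * theta7 (- 4) 3 (- 1) 2 1 (- 2) q + 2 * G7 1 0 0 q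
    + (theta7 6 (- 1) 5 (- 3) 2 3 q + G7 (- 1) 1 0 q) * (z + z ^ 6)
    + (theta7 (- 1) (- 1) (- 2) 4 (- 5) 3 q + G7 0 (- 1) 1 q) * (z ^ 2 + z ^ 5)
    + (theta7 (- 1) (- 1) (- 2) (- 3) 2 (- 4) q + G7 0 0 (- 1) q) * (z ^ 3 + z ^ 4)"
proof -
  let ?P = "qpoch_inf q q"
  define s0 where "s0 = theta7 (- 4) 3 (- 1) 2 1 (- 2) q + G7 1 0 0 q"
  define s1 where "s1 = theta7 2 2 4 (- 1) 3 1 q + G7 0 1 0 q"
  define s2 where "s2 = theta7 1 1 2 3 (- 2) 4 q + G7 0 0 1 q"
  have t1: "theta7 6 (- 1) 5 (- 3) 2 3 q + G7 (- 1) 1 0 q = s1 - s0"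
    using theta7_diff[of 2 2 4 "- 1" 3 1 q "- 4" 3 "- 1" 2 1 "- 2"] G7_diff[of 0 1 0 q 1 0 0]
    by (simp add: s0_def s1_def algebra_simps)
  have t2: "theta7 (- 1) (- 1) (- 2) 4 (- 5) 3 q + G7 0 (- 1) 1 q = s2 - s1"
    using theta7_diff[of 1 1 2 3 "- 2" 4 q 2 2 4 "- 1" 3 1] G7_diff[of 0 0 1 q 0 1 0]
    by (simp add: s2_def s1_def algebra_simps)
  have t3: "theta7 (- 1) (- 1) (- 2) (- 3) 2 (- 4) q + G7 0 0 (- 1) q = - s2"
    using theta7_diff[of 0 0 0 0 0 0 q 1 1 2 3 "- 2" 4] G7_diff[of 0 0 0 q 0 0 1]
    by (simp add: s2_def theta7_0 G7_0)
  have r: "rank_sum 0 = ?P * s0 - 3 / 7" "rank_sum 1 = ?P * s1 - 2 / 7" "rank_sum 2 = ?P * s2 - 1 / 7"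
    using rank_sum_theta7 by (simp_all add: s0_def s1_def s2_def)
  have "(1 - z) * rank_lambert z q = ?P * (2 * s0 + (s1 - s0) * (z + z ^ 6) + (s2 - s1) * (z ^ 2 + z ^ 5) + (- s2) * (z ^ 3 + z ^ 4))
     + (1 + z + z ^ 2 + z ^ 3 + z ^ 4 + z ^ 5 + z ^ 6) / 7"
    unfolding rank_lambert_root[OF z] r by (simp add: algebra_simps add_divide_distrib)
  also have "\<dots> = ?P * (2 * s0 + (s1 - s0) * (z + z ^ 6) + (s2 - s1) * (z ^ 2 + z ^ 5) + (- s2) * (z ^ 3 + z ^ 4))"
    using seventh_root_sum[OF z] by simp
  finally show ?thesis unfolding t1 t2 t3 by (simp add: s0_def)
qed

text \<open>As z^7 = 1, the power z^n depends only on n modulo 7, so each residue class of the theta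
  series is a theta function in q alone. The class -3 gives j(1) = 0; the other six reduce to three
  functions by reflection, and a factor 1 - z splits off.\<close>

lemma jreg_root:
  assumes z: "z ^ 7 = 1" "z \<noteq> 1"
  shows "jreg z q = jq 21 - q * jq 14 * (1 + (z + z ^ 6)) + q ^ 3 * jq 7 * (1 + (z + z ^ 6) + (z ^ 2 + z ^ 5))"
proof -
  interpret Q: nome "q ^ 49" by (rule nome_49)
  have z0: "z \<noteq> 0" using z by auto
  have "jfun z q = (\<Sum>\<^sub>\<infinity>n. gterm (- z) q n)"
    using jfun_has_sum[OF z0] by (rule infsumI[symmetric])
  also have "\<dots> = (\<Sum>k\<in>{-3..3}. \<Sum>\<^sub>\<infinity>m. gterm (- z) q (7 * m + k))"
    by (rule infsum_residues_7[OF gterm_summable]) (use z0 in simp)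
  also have "\<dots> = (\<Sum>k\<in>{-3..3}. (- 1) powi k * z powi k * q powi tri k * jq (7 * (k + 3)))"
  proof (rule sum.cong[OF refl])
    fix k :: int
    have "gterm (- z) q (7 * m + k) = ((- 1) powi k * z powi k * q powi tri k) * gterm (- (q powi (7 * (k + 3)))) (q ^ 49) m" for m
    proof -
      have z7: "z powi (7 * m) = 1" using power_int_mult[of z 7 m] z(1) by simp
      have e1: "(- z) powi (7 * m + k) = (- 1) powi k * z powi k * ((- 1) powi m)"
      proof -
        have "(- z) powi (7 * m + k) = (- 1) powi (7 * m + k) * z powi (7 * m + k)"
          using power_int_mult_distrib[of "- 1" z "7 * m + k"] by simp
        then show ?thesis using power_int_mult[of "- 1 :: complex" 7 m] z7 z0 by (simp add: power_int_add mult_ac)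
      qed
      have e2: "tri (7 * m + k) = tri k + (7 * (k + 3) * m + int 49 * tri m)"
      proof -
        have "2 * tri (7 * m + k) = 2 * (tri k + (7 * (k + 3) * m + int 49 * tri m))"
          using two_tri[of "7 * m + k"] two_tri[of k] two_tri[of m] by (simp add: algebra_simps)
        then show ?thesis by simp
      qed
      show ?thesis
        unfolding gterm_neg_powi unfolding gterm_def e1 e2
        by (simp only: power_int_add[OF disjI1[OF q_nz]] mult_ac)
    qed
    then have "(\<Sum>\<^sub>\<infinity>m. gterm (- z) q (7 * m + k)) = (\<Sum>\<^sub>\<infinity>m. ((- 1) powi k * z powi k * q powi tri k) * gterm (- (q powi (7 * (k + 3)))) (q ^ 49) m)"
      by simp
    also have "\<dots> = (- 1) powi k * z powi k * q powi tri k * jq (7 * (k + 3))"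
      unfolding jq_def by (subst infsum_cmult_right', subst infsumI[OF Q.jfun_has_sum]) auto
    finally show "(\<Sum>\<^sub>\<infinity>m. gterm (- z) q (7 * m + k)) = (- 1) powi k * z powi k * q powi tri k * jq (7 * (k + 3))" .
  qed
  also have "\<dots> = jq 21 + (- z * jq 21 - z powi (- 1) * q * jq 14) + (z\<^sup>2 * q * jq 14 + z powi (- 2) * q ^ 3 * jq 7)
     - z ^ 3 * q ^ 3 * jq 7"
  proof -
    have t: "tri (- 1) = 1" "tri 2 = 1" "tri (- 2) = 3" "tri 3 = 3" by (simp_all add: tri_def)
    have j0: "jq 0 = 0" by (simp add: jq_def)
    show ?thesis unfolding sum_minus3_3 by (simp add: t j0 jq_values)
  qed
  also have "z powi (- 1) = z ^ 6"
    using z0 z(1) by (simp add: power_int_minus field_simps flip: power_Suc)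
  also have "z powi (- 2) = z ^ 5"
    using z0 z(1) by (simp add: power_int_minus_divide divide_eq_eq flip: power_add)
  finally have "(1 - z) * jreg z q = jq 21 + (- z * jq 21 - z ^ 6 * q * jq 14) + (z\<^sup>2 * q * jq 14 + z ^ 5 * q ^ 3 * jq 7)
     - z ^ 3 * q ^ 3 * jq 7"
    by (simp add: jfun_reg)
  also have "\<dots> = (1 - z) * (jq 21 - q * jq 14 * (1 + (z + z ^ 6)) + q ^ 3 * jq 7 * (1 + (z + z ^ 6) + (z ^ 2 + z ^ 5)))"
    using z(1) by algebra
  finally show ?thesis using z(2) by simp
qed

text \<open>Factor by factor, the product of 1 - z^k x over k < 7 is 1 - x^7. Pairing k with 7 - k
  leaves quadratics whose linear coefficients are the periods, so only their elementary symmetric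
  functions -1, -2, 1 enter.\<close>

lemma qpoch_inf_roots:
  assumes z: "z ^ 7 = 1" "z \<noteq> 1"
  shows "qpoch_inf q q * (qpoch_inf (z * q) q * qpoch_inf (z ^ 6 * q) q) * (qpoch_inf (z ^ 2 * q) q * qpoch_inf (z ^ 5 * q) q)
     * (qpoch_inf (z ^ 3 * q) q * qpoch_inf (z ^ 4 * q) q) = Jm 7 q"
proof (rule LIMSEQ_unique)
  interpret w: nome "q ^ 7" by (rule nome_power) simp
  let ?f = "\<lambda>n. qpoch q q n * (qpoch (z * q) q n * qpoch (z ^ 6 * q) q n) * (qpoch (z ^ 2 * q) q n * qpoch (z ^ 5 * q) q n)
     * (qpoch (z ^ 3 * q) q n * qpoch (z ^ 4 * q) q n)"
  show "?f \<longlonglongrightarrow> qpoch_inf q q * (qpoch_inf (z * q) q * qpoch_inf (z ^ 6 * q) q) * (qpoch_inf (z ^ 2 * q) q * qpoch_inf (z ^ 5 * q) q)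
     * (qpoch_inf (z ^ 3 * q) q * qpoch_inf (z ^ 4 * q) q)"
    by (intro tendsto_mult qpoch_tendsto)
  have "?f n = qpoch (q ^ 7) (q ^ 7) n" for n
  proof (induction n)
    case (Suc n)
    let ?x = "q ^ Suc n"
    have fac: "(1 - x) * ((1 - z * x) * (1 - z ^ 6 * x)) * ((1 - z ^ 2 * x) * (1 - z ^ 5 * x)) * ((1 - z ^ 3 * x) * (1 - z ^ 4 * x)) = 1 - x ^ 7" for x
    proof -
      define \<alpha> where "\<alpha> = z + z ^ 6"
      define \<beta> where "\<beta> = z ^ 2 + z ^ 5"
      define \<gamma> where "\<gamma> = z ^ 3 + z ^ 4"
      have "(1 - z * x) * (1 - z ^ 6 * x) = 1 - \<alpha> * x + x ^ 2" "(1 - z ^ 2 * x) * (1 - z ^ 5 * x) = 1 - \<beta> * x + x ^ 2"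
        "(1 - z ^ 3 * x) * (1 - z ^ 4 * x) = 1 - \<gamma> * x + x ^ 2"
        using z(1) unfolding \<alpha>_def \<beta>_def \<gamma>_def by algebra+
      note factors = this
      note per = seventh_root_periods[OF z, folded \<alpha>_def \<beta>_def \<gamma>_def]
      have e2: "\<alpha> * \<beta> + \<beta> * \<gamma> + \<alpha> * \<gamma> = - 2"
        unfolding per(2,3,4) using per(1) by (simp add: algebra_simps)
      have "\<alpha> * \<beta> * \<gamma> = \<beta> * (\<alpha> * \<gamma>)" by simp
      also have "\<dots> = (\<alpha> + \<beta> + \<gamma>) + 2" unfolding per(4) distrib_left per(3,5) by simp
      finally have e3: "\<alpha> * \<beta> * \<gamma> = 1" by (simp add: per(1))
      have "(y - \<alpha> * x) * (y - \<beta> * x) * (y - \<gamma> * x) = y ^ 3 - (\<alpha> + \<beta> + \<gamma>) * (y ^ 2 * x)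
          + (\<alpha> * \<beta> + \<beta> * \<gamma> + \<alpha> * \<gamma>) * (y * x ^ 2) - \<alpha> * \<beta> * \<gamma> * x ^ 3" for y
        by (simp add: algebra_simps eval_nat_numeral)
      then have "(y - \<alpha> * x) * (y - \<beta> * x) * (y - \<gamma> * x) = y ^ 3 + y ^ 2 * x - 2 * (y * x ^ 2) - x ^ 3" for y
        unfolding per(1) e2 e3 by simp
      from this[of "1 + x ^ 2"] have prod: "(1 - \<alpha> * x + x ^ 2) * (1 - \<beta> * x + x ^ 2) * (1 - \<gamma> * x + x ^ 2)
          = (1 + x ^ 2) ^ 3 + (1 + x ^ 2) ^ 2 * x - 2 * ((1 + x ^ 2) * x ^ 2) - x ^ 3"
        by (simp add: algebra_simps)
      have "(1 - x) * (1 - \<alpha> * x + x ^ 2) * (1 - \<beta> * x + x ^ 2) * (1 - \<gamma> * x + x ^ 2)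
          = (1 - x) * ((1 - \<alpha> * x + x ^ 2) * (1 - \<beta> * x + x ^ 2) * (1 - \<gamma> * x + x ^ 2))"
        by (simp only: mult.assoc)
      also have "\<dots> = 1 - x ^ 7" unfolding prod by algebra
      finally show ?thesis unfolding factors .
    qed
    have "?f (Suc n) = ?f n * ((1 - ?x) * ((1 - z * ?x) * (1 - z ^ 6 * ?x)) * ((1 - z ^ 2 * ?x) * (1 - z ^ 5 * ?x)) * ((1 - z ^ 3 * ?x) * (1 - z ^ 4 * ?x)))"
      by (simp add: qpoch_Suc mult_ac)
    also have "\<dots> = qpoch (q ^ 7) (q ^ 7) n * (1 - ?x ^ 7)"
      unfolding fac Suc.IH ..
    also have "?x ^ 7 = (q ^ 7) ^ n * q ^ 7"
      by (simp add: power_mult_distrib mult.commute flip: power_mult)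
    finally show ?case by (simp add: qpoch_Suc)
  qed simp
  then show "?f \<longlonglongrightarrow> Jm 7 q" unfolding Jm_def by (simp only: w.qpoch_tendsto)
qed

text \<open>By \<open>qpoch_inf_roots\<close> the crank product is the product of
  \<open>jreg\<close> at z^2 and z^3 divided by J_7, so multiplying two instances of
  \<open>jreg_root\<close> suffices.\<close>

theorem crank_root:
  assumes z: "z ^ 7 = 1" "z \<noteq> 1"
  shows "qpoch_inf q q / (qpoch_inf (z * q) q * qpoch_inf (q / z) q) =
    2 * theta7 3 (- 4) (- 1) 2 1 (- 2) q
    + theta7 (- 1) 6 (- 2) (- 3) (- 5) 3 q * (z + z ^ 6)
    + theta7 (- 1) (- 1) 5 (- 3) 2 (- 4) q * (z ^ 2 + z ^ 5)
    + theta7 (- 1) (- 1) (- 2) 4 2 3 q * (z ^ 3 + z ^ 4)"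
proof -
  interpret w: nome "q ^ 7" by (rule nome_power) simp
  define \<alpha> where "\<alpha> = z + z ^ 6"
  define \<beta> where "\<beta> = z ^ 2 + z ^ 5"
  define \<gamma> where "\<gamma> = z ^ 3 + z ^ 4"
  note per = seventh_root_periods[OF z, folded \<alpha>_def \<beta>_def \<gamma>_def]
  have z0: "z \<noteq> 0" using z by auto
  have J7: "Jm 7 q \<noteq> 0" by (simp add: Jm_def)
  have inv: "q / z = z ^ 6 * q" "q / z ^ 2 = z ^ 5 * q" "q / z ^ 3 = z ^ 4 * q"
    using z0 z(1) by (simp_all add: divide_eq_eq mult_ac flip: power_Suc power_add)
  have r2: "(z ^ 2) ^ 7 = 1" "z ^ 2 \<noteq> 1" and r3: "(z ^ 3) ^ 7 = 1" "z ^ 3 \<noteq> 1"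
  proof -
    show "(z ^ 2) ^ 7 = 1" "(z ^ 3) ^ 7 = 1" using z(1) by (metis power_commutes power_mult power_one mult.commute)+
    show "z ^ 2 \<noteq> 1" "z ^ 3 \<noteq> 1" using z by algebra+
  qed
  have pw: "(z ^ 2) ^ 6 = z ^ 5" "(z ^ 2) ^ 2 = z ^ 4" "(z ^ 2) ^ 5 = z ^ 3"
    "(z ^ 3) ^ 6 = z ^ 4" "(z ^ 3) ^ 2 = z ^ 6" "(z ^ 3) ^ 5 = z"
    using z(1) power_mult[of z 7 2] power_add[of z 7 5] power_add[of z 7 3] power_add[of z 14 4] power_add[of z 14 1]
    by (simp_all flip: power_mult)
  have j2: "jreg (z ^ 2) q = jq 21 - q * jq 14 * (1 + \<beta>) + q ^ 3 * jq 7 * (1 + \<beta> + \<gamma>)"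
    using jreg_root[OF r2] unfolding pw by (simp add: \<beta>_def \<gamma>_def add_ac)
  have j3: "jreg (z ^ 3) q = jq 21 - q * jq 14 * (1 + \<gamma>) + q ^ 3 * jq 7 * (1 + \<gamma> + \<alpha>)"
    using jreg_root[OF r3] unfolding pw by (simp add: \<alpha>_def \<gamma>_def add_ac)
  have "qpoch_inf q q * (qpoch_inf (z * q) q * qpoch_inf (q / z) q) * (qpoch_inf (z ^ 2 * q) q * qpoch_inf (q / z ^ 2) q)
     * (qpoch_inf (z ^ 3 * q) q * qpoch_inf (q / z ^ 3) q) = Jm 7 q"
    unfolding inv by (rule qpoch_inf_roots[OF z])
  then have "qpoch_inf q q / (qpoch_inf (z * q) q * qpoch_inf (q / z) q) = jreg (z ^ 2) q * jreg (z ^ 3) q / Jm 7 q"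
  proof -
    assume *: "qpoch_inf q q * (qpoch_inf (z * q) q * qpoch_inf (q / z) q) * (qpoch_inf (z ^ 2 * q) q * qpoch_inf (q / z ^ 2) q)
     * (qpoch_inf (z ^ 3 * q) q * qpoch_inf (q / z ^ 3) q) = Jm 7 q"
    have "P / m = (c * P) * (d * P) / J" if "P * m * c * d = J" "J \<noteq> 0" for P m c d J :: complex
      using that by (auto simp: divide_simps)
    from this[OF * J7] show ?thesis by (simp add: jreg_def mult.commute[of q])
  qed
  \<comment> \<open>Since 1 + \<alpha> + \<beta> + \<gamma> = 0, the expansion is unique only up to
    adding the same form to all four coefficients (the doubled form counting as one). Here the four
    displayed forms add up to 0, as the value at z = 1 will demand; the price is the factor
    7.\<close>
  also have "7 * (jreg (z ^ 2) q * jreg (z ^ 3) q) = 2 * (3 * jq 21 ^ 2 + - 4 * q * jq 14 * jq 21 + - 1 * q ^ 2 * jq 14 ^ 2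
       + 2 * q ^ 3 * jq 7 * jq 21 + 1 * q ^ 4 * jq 7 * jq 14 + - 2 * q ^ 6 * jq 7 ^ 2)
     + (- 1 * jq 21 ^ 2 + 6 * q * jq 14 * jq 21 + - 2 * q ^ 2 * jq 14 ^ 2 + - 3 * q ^ 3 * jq 7 * jq 21 + - 5 * q ^ 4 * jq 7 * jq 14 + 3 * q ^ 6 * jq 7 ^ 2) * \<alpha>
     + (- 1 * jq 21 ^ 2 + - 1 * q * jq 14 * jq 21 + 5 * q ^ 2 * jq 14 ^ 2 + - 3 * q ^ 3 * jq 7 * jq 21 + 2 * q ^ 4 * jq 7 * jq 14 + - 4 * q ^ 6 * jq 7 ^ 2) * \<beta>
     + (- 1 * jq 21 ^ 2 + - 1 * q * jq 14 * jq 21 + - 2 * q ^ 2 * jq 14 ^ 2 + 4 * q ^ 3 * jq 7 * jq 21 + 2 * q ^ 4 * jq 7 * jq 14 + 3 * q ^ 6 * jq 7 ^ 2) * \<gamma>"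
  proof -
    have \<gamma>: "\<gamma> = - 1 - \<alpha> - \<beta>" using per(1) by (simp add: algebra_simps)
    have ab: "\<alpha> * \<beta> = - 1 - \<beta>" "\<beta> * \<beta> = 1 - \<alpha> - \<beta>" using per(2,5) unfolding \<gamma> by simp_all
    have aa: "\<alpha> * \<alpha> = \<beta> + 2" using per(4) ab(1) unfolding \<gamma> by (simp add: algebra_simps)
    have c: "1 + \<beta> + \<gamma> = - \<alpha>" "1 + \<gamma> + \<alpha> = - \<beta>" "1 + \<gamma> = - (\<alpha> + \<beta>)" unfolding \<gamma> by simp_all
    have ex: "(a - q * b * x + q ^ 3 * c * (- u)) * (a - q * b * (- y) + q ^ 3 * c * (- v)) =
      a ^ 2 + (y - x) * (q * b * a) - x * y * (q ^ 2 * b ^ 2) - (u + v) * (q ^ 3 * c * a) + (x * v - u * y) * (q ^ 4 * c * b) + u * v * (q ^ 6 * c ^ 2)"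
      for a b c x y u v :: complex
      by (simp add: algebra_simps eval_nat_numeral)
    have co: "\<alpha> + \<beta> - (1 + \<beta>) = \<alpha> - 1" "(1 + \<beta>) * (\<alpha> + \<beta>) = - \<beta>" "(1 + \<beta>) * \<beta> - \<alpha> * (\<alpha> + \<beta>) = - \<alpha>"
      by (simp_all add: algebra_simps ab aa)
    show ?thesis
      unfolding j2 j3 c(1,2) unfolding c(3) ex co ab(1) unfolding \<gamma> by (simp add: algebra_simps)
  qed
  then have "jreg (z ^ 2) q * jreg (z ^ 3) q / Jm 7 q = 2 * theta7 3 (- 4) (- 1) 2 1 (- 2) q
    + theta7 (- 1) 6 (- 2) (- 3) (- 5) 3 q * \<alpha>
    + theta7 (- 1) (- 1) 5 (- 3) 2 (- 4) q * \<beta>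
    + theta7 (- 1) (- 1) (- 2) 4 2 3 q * \<gamma>"
  proof -
    assume *: "7 * (jreg (z ^ 2) q * jreg (z ^ 3) q) = 2 * (3 * jq 21 ^ 2 + - 4 * q * jq 14 * jq 21 + - 1 * q ^ 2 * jq 14 ^ 2
       + 2 * q ^ 3 * jq 7 * jq 21 + 1 * q ^ 4 * jq 7 * jq 14 + - 2 * q ^ 6 * jq 7 ^ 2)
     + (- 1 * jq 21 ^ 2 + 6 * q * jq 14 * jq 21 + - 2 * q ^ 2 * jq 14 ^ 2 + - 3 * q ^ 3 * jq 7 * jq 21 + - 5 * q ^ 4 * jq 7 * jq 14 + 3 * q ^ 6 * jq 7 ^ 2) * \<alpha>
     + (- 1 * jq 21 ^ 2 + - 1 * q * jq 14 * jq 21 + 5 * q ^ 2 * jq 14 ^ 2 + - 3 * q ^ 3 * jq 7 * jq 21 + 2 * q ^ 4 * jq 7 * jq 14 + - 4 * q ^ 6 * jq 7 ^ 2) * \<beta>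
     + (- 1 * jq 21 ^ 2 + - 1 * q * jq 14 * jq 21 + - 2 * q ^ 2 * jq 14 ^ 2 + 4 * q ^ 3 * jq 7 * jq 21 + 2 * q ^ 4 * jq 7 * jq 14 + 3 * q ^ 6 * jq 7 ^ 2) * \<gamma>"
    have "X / J = 2 * (1 / (7 * J) * m0) + 1 / (7 * J) * m1 * a + 1 / (7 * J) * m2 * b + 1 / (7 * J) * m3 * c"
      if "7 * X = 2 * m0 + m1 * a + m2 * b + m3 * c" for X J m0 m1 m2 m3 a b c :: complex
    proof -
      have X: "X = (2 * m0 + m1 * a + m2 * b + m3 * c) / 7" using that by (simp add: mult.commute[of X])
      show ?thesis unfolding X by (simp add: add_divide_distrib)
    qed
    from this[OF *] show ?thesis unfolding theta7_def Jam_jq .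
  qed
  finally show ?thesis unfolding \<alpha>_def \<beta>_def \<gamma>_def .
qed

end

section \<open>Generating functions of rank and crank\<close>

lemma has_sum_fibers:
  fixes f :: "'a \<Rightarrow> complex"
  assumes f: "(f has_sum S) A" and K: "key ` A \<subseteq> K"
    and g: "\<And>k. k \<in> K \<Longrightarrow> (f has_sum g k) {x \<in> A. key x = k}"
  shows "(g has_sum S) K"
proof (rule has_sum_SigmaD)
  have "bij_betw (\<lambda>x. (key x, x)) A (Sigma K (\<lambda>k. {x \<in> A. key x = k}))"
    by (rule bij_betwI[of _ _ _ snd]) (use K in auto)
  from has_sum_reindex_bij_betw[OF this, of "\<lambda>(k, x). f x" S]
  show "((\<lambda>(k, x). f x) has_sum S) (Sigma K (\<lambda>k. {x \<in> A. key x = k}))"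
    using f by simp
  show "((\<lambda>y. case (k, y) of (k, x) \<Rightarrow> f x) has_sum g k) {x \<in> A. key x = k}" if "k \<in> K" for k
    using g[OF that] by simp
qed

section \<open>Partitions as multisets and Euler products\<close>

definition msets :: "nat set \<Rightarrow> nat multiset set" where
  "msets A = {P. set_mset P \<subseteq> A}"

text \<open>Induction on the set of admissible parts: the multiplicity of a new part runs through a
  geometric series.\<close>

lemma msets_prod_has_sum_finite:
  fixes f :: "nat \<Rightarrow> complex"
  assumes "finite A" "\<And>x. x \<in> A \<Longrightarrow> norm (f x) < 1"
  shows "((\<lambda>P. \<Prod>x\<in>#P. f x) has_sum (\<Prod>x\<in>A. 1 / (1 - f x))) (msets A)"
  using assms
proof (induction A rule: finite_induct)
  case empty
  have "msets {} = {{#}}" by (auto simp: msets_def)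
  then show ?case using has_sum_finite[of "{{#}}" "\<lambda>P. \<Prod>x\<in>#P. f x"] by simp
next
  case (insert a A)
  let ?g = "\<lambda>P. \<Prod>x\<in>#P. f x"
  have gs: "(?g has_sum (\<Prod>x\<in>A. 1 / (1 - f x))) (msets A)"
    using insert by auto
  have geo: "((\<lambda>n. f a ^ n) has_sum (1 / (1 - f a))) UNIV"
  proof (rule norm_summable_imp_has_sum)
    show "summable (\<lambda>n. norm (f a ^ n))"
      using insert.prems[of a] by (simp add: norm_power summable_geometric)
    show "(\<lambda>n. f a ^ n) sums (1 / (1 - f a))"
      using insert.prems[of a] by (intro geometric_sums) auto
  qed
  have "((\<lambda>(n, P). f a ^ n * ?g P) has_sum (1 / (1 - f a) * (\<Prod>x\<in>A. 1 / (1 - f x)))) (UNIV \<times> msets A)"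
    using geo gs has_sum_imp_summable[OF geo] has_sum_imp_summable[OF gs]
    by (intro has_sum_Times_mult) (simp_all add: summable_on_iff_abs_summable_on_complex)
  moreover have "bij_betw (\<lambda>(n, P). replicate_mset n a + P) (UNIV \<times> msets A) (msets (insert a A))"
  proof (rule bij_betwI[of _ _ _ "\<lambda>P. (count P a, filter_mset (\<lambda>x. x \<noteq> a) P)"])
    show "(\<lambda>(n, P). replicate_mset n a + P) \<in> UNIV \<times> msets A \<rightarrow> msets (insert a A)"
      by (auto simp: msets_def dest: in_replicate_mset[THEN iffD1] split: if_splits)
    show "(\<lambda>P. (count P a, filter_mset (\<lambda>x. x \<noteq> a) P)) \<in> msets (insert a A) \<rightarrow> UNIV \<times> msets A"
      by (auto simp: msets_def)
    fix p :: "nat \<times> nat multiset" assume "p \<in> UNIV \<times> msets A"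
    then obtain n P where p: "p = (n, P)" "set_mset P \<subseteq> A" by (auto simp: msets_def)
    then have "a \<notin># P" using insert.hyps by auto
    then show "(\<lambda>P. (count P a, filter_mset (\<lambda>x. x \<noteq> a) P)) ((\<lambda>(n, P). replicate_mset n a + P) p) = p"
      using \<open>a \<notin># P\<close> by (auto simp: p(1) not_in_iff intro!: multiset_eqI)
  next
    fix P :: "nat multiset"
    show "(\<lambda>(n, P). replicate_mset n a + P) (count P a, filter_mset (\<lambda>x. x \<noteq> a) P) = P"
      by (rule multiset_eqI) auto
  qed
  ultimately have "(?g has_sum (1 / (1 - f a) * (\<Prod>x\<in>A. 1 / (1 - f x)))) (msets (insert a A))"
    by (subst has_sum_reindex_bij_betw[symmetric, where g = "\<lambda>(n, P). replicate_mset n a + P"])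
       (auto simp: case_prod_unfold)
  then show ?case using insert.hyps by simp
qed

text \<open>A multiplicative weight that counts the parts with property Q: all parts for the rank,
  the parts above the number of ones for the crank.\<close>

lemma prod_mset_weights:
  fixes q u :: complex
  shows "(\<Prod>x\<in>#P. q ^ x * (if Q x then u else 1)) = q ^ sum_mset P * u ^ size (filter_mset Q P)"
  by (induction P) (auto simp: power_add mult_ac)

lemma finite_partitions: "finite (partitions n)"
proof (rule finite_subset)
  show "partitions n \<subseteq> mset ` {xs. set xs \<subseteq> {..n} \<and> length xs \<le> n}"
  proof
    fix P assume P: "P \<in> partitions n"
    obtain xs where xs: "mset xs = P" using ex_mset by blast
    have "length xs \<le> sum_list xs" if "\<forall>x\<in>set xs. 0 < x" for xs :: "nat list"
      using that by (induction xs) auto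
    moreover have "sum_list xs = n" "\<forall>x\<in>set xs. 0 < x"
      using P xs by (auto simp: partitions_def sum_mset_sum_list)
    moreover have "x \<le> n" if "x \<in> set xs" for x
      using member_le_sum_list[OF that] \<open>sum_list xs = n\<close> by simp
    ultimately show "P \<in> mset ` {xs. set xs \<subseteq> {..n} \<and> length xs \<le> n}"
      using xs by auto
  qed
  show "finite (mset ` {xs. set xs \<subseteq> {..n} \<and> length xs \<le> n})"
    by (intro finite_imageI finite_lists_length_le) auto
qed

lemma partitions_msets: "partitions n = {P \<in> msets {1..}. sum_mset P = n}"
  by (auto simp: partitions_def msets_def Suc_le_eq)

definition max_part :: "nat multiset \<Rightarrow> nat" where
  "max_part P = (if P = {#} then 0 else Max (set_mset P))"

lemma max_part_fiber:
  assumes "k \<le> l" "0 < k"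
  shows "{P \<in> msets {k..}. max_part P = l} = add_mset l ` msets {k..l}"
proof (intro equalityI subsetI)
  fix P assume P: "P \<in> {P \<in> msets {k..}. max_part P = l}"
  then have "P \<noteq> {#}" "Max (set_mset P) = l" using assms by (auto simp: max_part_def split: if_splits)
  then have "l \<in># P" "\<And>x. x \<in># P \<Longrightarrow> x \<le> l"
    using Max_in[of "set_mset P"] Max_ge[of "set_mset P"] by auto
  moreover have "k \<le> x" if "x \<in># P" for x using P that by (auto simp: msets_def)
  ultimately have "P = add_mset l (P - {#l#})" "P - {#l#} \<in> msets {k..l}"
    by (auto simp: msets_def dest: in_diffD simp del: insert_DiffM2)
  then show "P \<in> add_mset l ` msets {k..l}" by blast
next
  fix P assume "P \<in> add_mset l ` msets {k..l}"
  then obtain R where R: "P = add_mset l R" "set_mset R \<subseteq> {k..l}" by (auto simp: msets_def)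
  have "Max (set_mset P) = l" using R by (intro Max_eqI) auto
  then show "P \<in> {P \<in> msets {k..}. max_part P = l}"
    using R assms by (auto simp: max_part_def msets_def)
qed

lemma max_part_0: "k > 0 \<Longrightarrow> {P \<in> msets {k..}. max_part P = 0} = {{#}}"
proof (intro equalityI subsetI)
  fix P assume "k > 0" and P: "P \<in> {P \<in> msets {k..}. max_part P = 0}"
  have "P = {#}"
  proof (rule ccontr)
    assume "P \<noteq> {#}"
    then have "Max (set_mset P) \<in># P" using Max_in[of "set_mset P"] by auto
    then have "k \<le> Max (set_mset P)" using P by (auto simp: msets_def)
    then show False using P \<open>P \<noteq> {#}\<close> \<open>k > 0\<close> by (auto simp: max_part_def)
  qed
  then show "P \<in> {{#}}" by simp
qed (auto simp: msets_def max_part_def)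

text \<open>On the empty multiset \<open>rank\<close> and \<open>crank\<close> involve the
  unspecified \<open>Max {}\<close>; the value 0 there is the convention for n = 0.\<close>

definition rank0 :: "nat multiset \<Rightarrow> int" where
  "rank0 P = (if P = {#} then 0 else rank P)"

definition crank0 :: "nat multiset \<Rightarrow> int" where
  "crank0 P = (if P = {#} then 0 else crank P)"

context nome
begin

lemma norm_power_less_1: "x > 0 \<Longrightarrow> norm q ^ x < 1"
  using norm_q by (simp add: power_less_one_iff)

lemma norm_one_minus_ge: "norm u \<le> 1 \<Longrightarrow> 1 - norm q ^ x \<le> norm (1 - q ^ x * u)"
proof -
  assume "norm u \<le> 1"
  then have "norm (q ^ x * u) \<le> norm q ^ x" by (simp add: norm_mult norm_power mult_left_le)
  then show ?thesis using norm_triangle_ineq2[of 1 "q ^ x * u"] by simp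
qed

text \<open>The bound is the value of the product for the nome \<open>\<bar>q\<bar>\<close>.\<close>

lemma inverse_prod_bounded:
  obtains B where "B > 0"
    "\<And>A. finite A \<Longrightarrow> A \<subseteq> {1..} \<Longrightarrow> (\<Prod>x\<in>A. 1 / (1 - norm q ^ x)) \<le> B"
proof -
  interpret r: nome "complex_of_real (norm q)"
    by unfold_locales (use norm_q in auto)
  obtain B where B: "B > 0" "\<And>m. norm (rq (complex_of_real (norm q)) m) \<le> B"
    using r.rq_bounded by blast
  have 1: "1 / (1 - norm q ^ x) \<ge> 1" if "x > 0" for x
    using norm_power_less_1[OF that] by (simp add: field_simps)
  have "(\<Prod>x\<in>A. 1 / (1 - norm q ^ x)) \<le> B" if A: "finite A" "A \<subseteq> {1..}" for A
  proof -
    obtain N where N: "A \<subseteq> {1..N}" using A finite_nat_set_iff_bounded_le[of A] by fastforce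
    have "(\<Prod>x\<in>A. 1 / (1 - norm q ^ x)) \<le> (\<Prod>x\<in>{1..N}. 1 / (1 - norm q ^ x))"
      by (rule prod_mono2) (use N 1 order_trans[OF zero_le_one 1] in auto)
    also have "\<dots> = norm (rq (complex_of_real (norm q)) (int N))"
    proof -
      have "qpoch (complex_of_real (norm q)) (complex_of_real (norm q)) N = complex_of_real (\<Prod>x\<in>{1..N}. 1 - norm q ^ x)"
        unfolding qpoch_def of_real_prod
        by (rule prod.reindex_bij_witness[of _ "\<lambda>x. x - 1" Suc]) (auto simp: mult.commute simp flip: power_Suc2)
      moreover have "0 \<le> (\<Prod>x\<in>{1..N}. 1 - norm q ^ x)"
        by (intro prod_nonneg) (use norm_power_less_1 in \<open>auto intro: less_imp_le\<close>)
      ultimately show ?thesis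
        by (simp add: rq_def prod_dividef norm_inverse divide_inverse prod_inversef[symmetric] o_def del: of_real_prod)
    qed
    also have "\<dots> \<le> B" by (rule B)
    finally show ?thesis .
  qed
  then show ?thesis using that B(1) by blast
qed

text \<open>Finitely many multisets use only finitely many different parts, so each finite partial
  sum is at most a finite Euler product in |q|, and these are uniformly bounded.\<close>

lemma msets_prod_summable:
  fixes f :: "nat \<Rightarrow> complex"
  assumes A: "A \<subseteq> {1..}" and f: "\<And>x. x \<in> A \<Longrightarrow> norm (f x) \<le> norm q ^ x"
  shows "(\<lambda>P. norm (\<Prod>x\<in>#P. f x)) summable_on msets A"
proof -
  obtain B where B: "B > 0"
    "\<And>A. finite A \<Longrightarrow> A \<subseteq> {1..} \<Longrightarrow> (\<Prod>x\<in>A. 1 / (1 - norm q ^ x)) \<le> B"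
    using inverse_prod_bounded by blast
  let ?r = "\<lambda>x. complex_of_real (norm q ^ x)"
  have wt: "norm (\<Prod>x\<in>#P. f x) \<le> norm (\<Prod>x\<in>#P. ?r x)" if "P \<in> msets A" for P
  proof -
    have "set_mset P \<subseteq> A" using that by (simp add: msets_def)
    then show ?thesis
    proof (induction P)
      case (add x P)
      have "norm (f x) * norm (\<Prod>x\<in>#P. f x) \<le> norm q ^ x * norm (\<Prod>x\<in>#P. ?r x)"
        using add f[of x] by (intro mult_mono) auto
      then show ?case by (simp add: norm_mult norm_power)
    qed simp
  qed
  show ?thesis
  proof (rule nonneg_bdd_above_summable_on)
    show "bdd_above (sum (\<lambda>P. norm (\<Prod>x\<in>#P. f x)) ` {F. F \<subseteq> msets A \<and> finite F})"
    proof (rule bdd_aboveI2)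
      fix F assume "F \<in> {F. F \<subseteq> msets A \<and> finite F}"
      then have F: "F \<subseteq> msets A" "finite F" by auto
      define A' where "A' = (\<Union>P\<in>F. set_mset P)"
      have A': "finite A'" "A' \<subseteq> A" "F \<subseteq> msets A'"
        using F by (auto simp: A'_def msets_def)
      have hs: "((\<lambda>P. \<Prod>x\<in>#P. ?r x) has_sum (\<Prod>x\<in>A'. 1 / (1 - ?r x))) (msets A')"
      proof (rule msets_prod_has_sum_finite[OF A'(1)])
        fix x assume "x \<in> A'"
        then have "x > 0" using A A'(2) by fastforce
        then show "norm (?r x) < 1" using norm_power_less_1 by (simp add: norm_power)
      qed
      have nn: "(\<Prod>x\<in>#P. ?r x) = complex_of_real (norm (\<Prod>x\<in>#P. ?r x))" for P
        by (induction P) (auto simp: norm_mult norm_power)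
      have "((\<lambda>P. complex_of_real (norm (\<Prod>x\<in>#P. ?r x))) has_sum complex_of_real (\<Prod>x\<in>A'. 1 / (1 - norm q ^ x))) (msets A')"
        using hs nn by simp
      then have hr: "((\<lambda>P. norm (\<Prod>x\<in>#P. ?r x)) has_sum (\<Prod>x\<in>A'. 1 / (1 - norm q ^ x))) (msets A')"
        by (simp only: has_sum_of_real_iff)
      have "sum (\<lambda>P. norm (\<Prod>x\<in>#P. f x)) F \<le> sum (\<lambda>P. norm (\<Prod>x\<in>#P. ?r x)) F"
        using F by (intro sum_mono wt) auto
      also have "\<dots> \<le> (\<Prod>x\<in>A'. 1 / (1 - norm q ^ x))"
        by (rule finite_sum_le_has_sum[OF hr]) (use F A' in auto)
      also have "\<dots> \<le> B" using A A' by (intro B) auto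
      finally show "sum (\<lambda>P. norm (\<Prod>x\<in>#P. f x)) F \<le> B" .
    qed
  qed auto
qed

text \<open>Restrict to parts of size at most N, where the finite product formula applies, and let N
  grow under dominated convergence.\<close>

lemma msets_prod_has_sum:
  fixes f :: "nat \<Rightarrow> complex"
  assumes A: "A \<subseteq> {1..}" and f: "\<And>x. x \<in> A \<Longrightarrow> norm (f x) \<le> norm q ^ x"
    and L: "(\<lambda>N. \<Prod>x\<in>A \<inter> {..N}. 1 / (1 - f x)) \<longlonglongrightarrow> L"
  shows "((\<lambda>P. \<Prod>x\<in>#P. f x) has_sum L) (msets A)"
proof -
  let ?w = "\<lambda>P. \<Prod>x\<in>#P. f x"
  have s: "(\<lambda>P. norm (?w P)) summable_on msets A"
    by (rule msets_prod_summable[OF A f])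
  have "(\<lambda>N. \<Sum>\<^sub>\<infinity>P\<in>msets A. if P \<in> msets {..N} then ?w P else 0) \<longlonglongrightarrow> (\<Sum>\<^sub>\<infinity>P\<in>msets A. ?w P)"
  proof (rule infsum_tendsto_dominated[OF _ s])
    show "norm (if P \<in> msets {..N} then ?w P else 0) \<le> norm (?w P)" for N P by simp
    fix P
    have "\<forall>\<^sub>F N in sequentially. ?w P = (if P \<in> msets {..N} then ?w P else 0)"
    proof -
      obtain M where "set_mset P \<subseteq> {..M}"
        using finite_nat_set_iff_bounded_le[of "set_mset P"] by auto
      then show ?thesis
        by (auto simp: eventually_sequentially msets_def intro!: exI[of _ M])
    qed
    then show "(\<lambda>N. if P \<in> msets {..N} then ?w P else 0) \<longlonglongrightarrow> ?w P"
      by (rule Lim_transform_eventually[OF tendsto_const])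
  qed
  moreover have "(\<Sum>\<^sub>\<infinity>P\<in>msets A. if P \<in> msets {..N} then ?w P else 0) = (\<Prod>x\<in>A \<inter> {..N}. 1 / (1 - f x))" for N
  proof -
    have "(\<Sum>\<^sub>\<infinity>P\<in>msets A. if P \<in> msets {..N} then ?w P else 0) = (\<Sum>\<^sub>\<infinity>P\<in>msets (A \<inter> {..N}). ?w P)"
      by (rule infsum_cong_neutral) (auto simp: msets_def)
    also have "\<dots> = (\<Prod>x\<in>A \<inter> {..N}. 1 / (1 - f x))"
    proof (rule infsumI, rule msets_prod_has_sum_finite)
      fix x assume x: "x \<in> A \<inter> {..N}"
      then have "x > 0" using A by auto
      then show "norm (f x) < 1" using f[of x] norm_power_less_1[of x] x by auto
    qed simp
    finally show ?thesis .
  qed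
  ultimately have "(\<Sum>\<^sub>\<infinity>P\<in>msets A. ?w P) = L"
    using L LIMSEQ_unique by (simp only:) blast
  then show ?thesis using abs_summable_summable[OF s] has_sum_infsum by blast
qed

lemma partitions_summable:
  assumes "\<And>P. norm (h P) \<le> 1" "A \<subseteq> {1..}"
  shows "(\<lambda>P. h P * q ^ sum_mset P) summable_on msets A"
proof -
  have s: "(\<lambda>P. norm (\<Prod>x\<in>#P. q ^ x)) summable_on msets A"
    by (rule msets_prod_summable[OF assms(2)]) (simp add: norm_power)
  have w: "(\<Prod>x\<in>#P. q ^ x) = q ^ sum_mset P" for P
    by (induction P) (auto simp: power_add)
  show ?thesis
    by (rule abs_summable_summable, rule Infinite_Sum.abs_summable_on_comparison_test'[OF s])
       (use assms in \<open>auto simp: w norm_mult intro: mult_left_le_one_le\<close>)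
qed

lemma partitions_sums:
  assumes "\<And>P. norm (h P) \<le> 1"
  shows "(\<lambda>n. (\<Sum>P\<in>partitions n. h P) * q ^ n) sums (\<Sum>\<^sub>\<infinity>P\<in>msets {1..}. h P * q ^ sum_mset P)"
proof (rule has_sum_imp_sums, rule has_sum_fibers)
  show "((\<lambda>P. h P * q ^ sum_mset P) has_sum (\<Sum>\<^sub>\<infinity>P\<in>msets {1..}. h P * q ^ sum_mset P)) (msets {1..})"
    by (rule has_sum_infsum[OF partitions_summable[OF assms]]) auto
  show "((\<lambda>P. h P * q ^ sum_mset P) has_sum (\<Sum>P\<in>partitions n. h P) * q ^ n) {P \<in> msets {1..}. sum_mset P = n}" for n
    unfolding partitions_msets[symmetric]
    by (rule has_sum_finiteI[OF finite_partitions]) (auto simp: sum_distrib_right partitions_def)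
qed auto

section \<open>The rank: from the series by largest part to the series by Durfee squares\<close>

lemma qpoch_bounded_below:
  obtains B where "B > 0" "\<And>j u n. norm u \<le> 1 \<Longrightarrow> norm (1 / qpoch (q ^ Suc j * u) q n) \<le> B"
proof -
  obtain B where B: "B > 0"
    "\<And>A. finite A \<Longrightarrow> A \<subseteq> {1..} \<Longrightarrow> (\<Prod>x\<in>A. 1 / (1 - norm q ^ x)) \<le> B"
    using inverse_prod_bounded by blast
  have "norm (1 / qpoch (q ^ Suc j * u) q n) \<le> B" if u: "norm u \<le> 1" for j u n
  proof -
    have "norm (1 / qpoch (q ^ Suc j * u) q n) = (\<Prod>i<n. 1 / norm (1 - q ^ (i + Suc j) * u))"
      by (simp add: qpoch_def norm_divide prod_norm prod_dividef power_add mult_ac)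
    also have "\<dots> \<le> (\<Prod>i<n. 1 / (1 - norm q ^ (i + Suc j)))"
    proof (intro prod_mono conjI)
      fix i
      have "0 < 1 - norm q ^ (i + Suc j)" using norm_power_less_1[of "i + Suc j"] by simp
      then show "1 / norm (1 - q ^ (i + Suc j) * u) \<le> 1 / (1 - norm q ^ (i + Suc j))"
        using norm_one_minus_ge[OF u, of "i + Suc j"] by (intro divide_left_mono mult_pos_pos) auto
    qed auto
    also have "\<dots> = (\<Prod>x\<in>{Suc j..<n + Suc j}. 1 / (1 - norm q ^ x))"
      by (rule prod.reindex_bij_witness[of _ "\<lambda>x. x - Suc j" "\<lambda>i. i + Suc j"]) auto
    also have "\<dots> \<le> B" by (rule B) auto
    finally show ?thesis .
  qed
  then show ?thesis using that B(1) by blast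
qed

lemma qpoch_unit_nz:
  assumes "norm u \<le> 1"
  shows "1 - q ^ Suc j * u \<noteq> 0"
  using norm_one_minus_ge[OF assms, of "Suc j"] norm_power_less_1[of "Suc j"] by auto

text \<open>For j = 0 this is, up to the factor q/(1 - q/z), the sum over nonempty partitions by
  largest part; larger j arise in the iteration.\<close>

definition fine_sum :: "complex \<Rightarrow> nat \<Rightarrow> complex" where
  "fine_sum z j = (\<Sum>n. (z * q ^ Suc j) ^ n / qpoch (q ^ Suc (Suc j) / z) q n)"

lemma fine_sum_bound:
  obtains B where "\<And>z j. norm z = 1 \<Longrightarrow> norm (fine_sum z j) \<le> B"
    "\<And>z j. norm z = 1 \<Longrightarrow> summable (\<lambda>n. (z * q ^ Suc j) ^ n / qpoch (q ^ Suc (Suc j) / z) q n)"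
proof -
  obtain B where B: "B > 0" "\<And>j u n. norm u \<le> 1 \<Longrightarrow> norm (1 / qpoch (q ^ Suc j * u) q n) \<le> B"
    using qpoch_bounded_below by blast
  have t: "norm ((z * q ^ Suc j) ^ n / qpoch (q ^ Suc (Suc j) / z) q n) \<le> norm q ^ n * B" if z: "norm z = 1" for z j n
  proof -
    have "norm (1 / qpoch (q ^ Suc (Suc j) / z) q n) \<le> B"
      using B(2)[of "1 / z" "Suc j" n] z by (simp add: norm_divide)
    moreover have "norm ((z * q ^ Suc j) ^ n) \<le> norm q ^ n"
    proof -
      have "norm (z * q ^ Suc j) \<le> norm q"
        using z norm_q by (simp add: norm_mult norm_power mult_left_le power_le_one)
      then show ?thesis unfolding norm_power by (rule power_mono) simp
    qed
    ultimately have "norm ((z * q ^ Suc j) ^ n) * norm (1 / qpoch (q ^ Suc (Suc j) / z) q n) \<le> norm q ^ n * B"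
      by (intro mult_mono) auto
    then show ?thesis by (simp add: norm_divide)
  qed
  have sB: "summable (\<lambda>n. norm q ^ n * B)"
    using norm_q by (intro summable_mult2 summable_geometric) auto
  have s: "summable (\<lambda>n. (z * q ^ Suc j) ^ n / qpoch (q ^ Suc (Suc j) / z) q n)" if "norm z = 1" for z j
    by (rule summable_comparison_test'[OF sB]) (rule t[OF that])
  have "norm (fine_sum z j) \<le> (\<Sum>n. norm q ^ n * B)" if "norm z = 1" for z j
    unfolding fine_sum_def by (rule norm_suminf_le) (use t[OF that] sB in auto)
  then show ?thesis using that s by blast
qed

text \<open>Write t = z q^(j+1) and b = q^(j+2)/z. Term n + 1 minus t times term n equals t^(n+1)
  q^n b / (b)_(n+1), and z cancels in t b = q^(2j+3); what is left is a multiple of the series for j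
  + 1.\<close>

lemma fine_sum_step:
  assumes z: "norm z = 1"
  shows "(1 - z * q ^ Suc j) * fine_sum z j = 1 + q ^ (2 * j + 3) / (1 - q ^ Suc (Suc j) / z) * fine_sum z (Suc j)"
proof -
  let ?t = "z * q ^ Suc j" and ?b = "q ^ Suc (Suc j) / z"
  have z0: "z \<noteq> 0" using z by auto
  have s: "\<And>j. summable (\<lambda>n. (z * q ^ Suc j) ^ n / qpoch (q ^ Suc (Suc j) / z) q n)"
    using fine_sum_bound z by metis
  have bn: "1 - q ^ n * ?b \<noteq> 0" for n
    using qpoch_unit_nz[of "1 / z" "n + Suc j"] z by (simp add: norm_divide power_add mult_ac)
  have nz: "qpoch ?b q n \<noteq> 0" for n using bn by (simp add: qpoch_def del: right_minus_eq)
  have sums: "(\<lambda>n. ?t ^ n / qpoch ?b q n) sums fine_sum z j"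
    unfolding fine_sum_def using s by (rule summable_sums)
  then have "(\<lambda>n. ?t ^ Suc n / qpoch ?b q (Suc n)) sums (fine_sum z j - 1)"
    using sums_Suc_iff[of "\<lambda>n. ?t ^ n / qpoch ?b q n" "fine_sum z j - 1"] by simp
  moreover have "(\<lambda>n. ?t * (?t ^ n / qpoch ?b q n)) sums (?t * fine_sum z j)"
    by (rule sums_mult[OF sums])
  ultimately have 1: "(\<lambda>n. ?t ^ Suc n / qpoch ?b q (Suc n) - ?t * (?t ^ n / qpoch ?b q n)) sums (fine_sum z j - 1 - ?t * fine_sum z j)"
    by (rule sums_diff)
  have "?t ^ Suc n / qpoch ?b q (Suc n) - ?t * (?t ^ n / qpoch ?b q n)
      = q ^ (2 * j + 3) / (1 - ?b) * ((z * q ^ Suc (Suc j)) ^ n / qpoch (q ^ Suc (Suc (Suc j)) / z) q n)" for n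
  proof -
    have 1: "?t ^ Suc n / qpoch ?b q (Suc n) - ?t * (?t ^ n / qpoch ?b q n) = ?t ^ Suc n * (q ^ n * ?b) / qpoch ?b q (Suc n)"
    proof -
      have "T ^ Suc n / (Q * (1 - c)) - T * (T ^ n / Q) = T ^ Suc n * c / (Q * (1 - c))"
        if "Q \<noteq> 0" "1 - c \<noteq> 0" for T Q c :: complex
        using that by (simp add: field_simps)
      from this[OF nz[of n] bn[of n]] show ?thesis by (simp add: qpoch_Suc)
    qed
    have 2: "qpoch ?b q (Suc n) = (1 - ?b) * qpoch (q ^ Suc (Suc (Suc j)) / z) q n"
      by (simp add: qpoch_Suc_left)
    have 3: "?t ^ Suc n * (q ^ n * ?b) = q ^ (2 * j + 3) * (z * q ^ Suc (Suc j)) ^ n"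
    proof -
      have "q ^ (2 * j + 3) = q ^ Suc j * q ^ Suc (Suc j)"
        unfolding power_add[symmetric] by (rule arg_cong[where f = "power q"]) simp
      moreover have "(z * q ^ Suc (Suc j)) ^ n = ?t ^ n * q ^ n" by (simp add: power_mult_distrib mult_ac)
      ultimately show ?thesis using z0 by simp
    qed
    show ?thesis unfolding 1 unfolding 2 3 by simp
  qed
  with 1 have "(\<lambda>n. q ^ (2 * j + 3) / (1 - ?b) * ((z * q ^ Suc (Suc j)) ^ n / qpoch (q ^ Suc (Suc (Suc j)) / z) q n))
     sums (fine_sum z j - 1 - ?t * fine_sum z j)" by simp
  moreover have "(\<lambda>n. q ^ (2 * j + 3) / (1 - ?b) * ((z * q ^ Suc (Suc j)) ^ n / qpoch (q ^ Suc (Suc (Suc j)) / z) q n))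
     sums (q ^ (2 * j + 3) / (1 - ?b) * fine_sum z (Suc j))"
    unfolding fine_sum_def by (intro sums_mult summable_sums s)
  ultimately have "fine_sum z j - 1 - ?t * fine_sum z j = q ^ (2 * j + 3) / (1 - ?b) * fine_sum z (Suc j)"
    by (rule sums_unique2)
  then show ?thesis by (simp add: algebra_simps)
qed

text \<open>Rogers--Fine iteration: it turns the series by largest part into the series by Durfee
  squares, one square at a time.\<close>

lemma fine_iterate:
  assumes z: "norm z = 1"
  shows "1 + q / (1 - q / z) * fine_sum z 0 = (\<Sum>n\<le>N. q ^ (n\<^sup>2) / (qpoch (z * q) q n * qpoch (q / z) q n))
     + q ^ ((Suc N)\<^sup>2) / (qpoch (z * q) q N * qpoch (q / z) q (Suc N)) * fine_sum z N"
proof (induction N)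
  case 0
  then show ?case by (simp add: qpoch_Suc)
next
  case (Suc N)
  let ?A = "qpoch (z * q) q" and ?B = "qpoch (q / z) q"
  have t: "1 - z * q ^ Suc N \<noteq> 0"
    using qpoch_unit_nz[of z N] z by (simp add: mult.commute)
  have A: "?A (Suc N) = ?A N * (1 - z * q ^ Suc N)" by (simp add: qpoch_Suc mult_ac)
  have B: "?B (Suc (Suc N)) = ?B (Suc N) * (1 - q ^ Suc (Suc N) / z)" by (simp add: qpoch_Suc[of _ _ "Suc N"] mult_ac)
  have "fine_sum z N = (1 + q ^ (2 * N + 3) / (1 - q ^ Suc (Suc N) / z) * fine_sum z (Suc N)) / (1 - z * q ^ Suc N)"
    using fine_sum_step[OF z, of N] t by (simp add: eq_divide_eq mult.commute)
  then have "q ^ ((Suc N)\<^sup>2) / (?A N * ?B (Suc N)) * fine_sum z N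
     = q ^ ((Suc N)\<^sup>2) / (?A (Suc N) * ?B (Suc N)) + q ^ ((Suc N)\<^sup>2) * q ^ (2 * N + 3) / (?A (Suc N) * ?B (Suc (Suc N))) * fine_sum z (Suc N)"
    unfolding A B by (simp add: add_divide_distrib distrib_left mult_ac)
  also have "q ^ ((Suc N)\<^sup>2) * q ^ (2 * N + 3) = q ^ ((Suc (Suc N))\<^sup>2)"
    unfolding power_add[symmetric] by (rule arg_cong[where f = "power q"]) (simp add: power2_eq_square)
  finally show ?case using Suc by simp
qed

text \<open>The remainder in \<open>fine_iterate\<close> vanishes in the limit, as q^((N+1)^2) is
  multiplied by bounded factors. The limit series is \<open>rank_series\<close> times 1 - z, because
  (z)_(n+1) = (1 - z) (zq)_n.\<close>

lemma fine_sum_rank: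
  assumes z: "norm z = 1" "z \<noteq> 1"
  shows "1 + q / (1 - q / z) * fine_sum z 0 = (1 - z) * rank_lambert z q / qpoch_inf q q"
proof -
  have z0: "z \<noteq> 0" using z by auto
  have zq: "z * q powi k \<noteq> 1" for k
  proof
    assume *: "z * q powi k = 1"
    then have "norm (q powi k) = 1" using z norm_mult[of z "q powi k"] by simp
    then have "norm q powi k = 1" by (simp add: norm_power_int)
    then have "k = 0" using norm_q power_eq_1_iff[of "norm q"] by (cases k rule: int_cases2) (auto simp: power_int_minus)
    then show False using * z by simp
  qed
  let ?t = "\<lambda>n. q ^ (n\<^sup>2) / (qpoch (z * q) q n * qpoch (q / z) q n)"
  have "(\<lambda>n. (1 - z) * (q ^ (n\<^sup>2) / (qpoch z q (n + 1) * qpoch (q / z) q n))) sums ((1 - z) * (rank_lambert z q / qpoch_inf q q))"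
    by (intro sums_mult has_sum_imp_sums rank_series z0 zq)
  moreover have "(1 - z) * (q ^ (n\<^sup>2) / (qpoch z q (n + 1) * qpoch (q / z) q n)) = ?t n" for n
    using z by (simp add: qpoch_Suc_left mult.commute[of q])
  ultimately have "?t sums ((1 - z) * (rank_lambert z q / qpoch_inf q q))" by simp
  then have lim: "(\<lambda>N. \<Sum>n\<le>N. ?t n) \<longlonglongrightarrow> (1 - z) * (rank_lambert z q / qpoch_inf q q)"
    by (simp add: sums_def_le)
  obtain B where B: "B > 0" "\<And>j u n. norm u \<le> 1 \<Longrightarrow> norm (1 / qpoch (q ^ Suc j * u) q n) \<le> B"
    using qpoch_bounded_below by blast
  obtain F where F: "\<And>j. norm (fine_sum z j) \<le> F" using fine_sum_bound z(1) by metis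
  have F0: "F \<ge> 0" using F[of 0] norm_ge_zero order_trans by blast
  let ?r = "\<lambda>N. q ^ ((Suc N)\<^sup>2) / (qpoch (z * q) q N * qpoch (q / z) q (Suc N)) * fine_sum z N"
  have "?r \<longlonglongrightarrow> 0"
  proof (rule Lim_null_comparison)
    show "\<forall>\<^sub>F N in sequentially. norm (?r N) \<le> norm q ^ N * (B * B * F)"
    proof (intro always_eventually allI)
      fix N
      have "norm (q ^ ((Suc N)\<^sup>2)) \<le> norm q ^ N"
        unfolding norm_power using norm_q by (intro power_decreasing) (auto simp: power2_eq_square)
      moreover have "norm (1 / qpoch (z * q) q N) \<le> B" "norm (1 / qpoch (q / z) q (Suc N)) \<le> B"
        using B(2)[of z 0 N] B(2)[of "1 / z" 0 "Suc N"] z by (simp_all add: norm_divide mult.commute)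
      ultimately have "norm (q ^ ((Suc N)\<^sup>2)) * (norm (1 / qpoch (z * q) q N) * norm (1 / qpoch (q / z) q (Suc N)) * norm (fine_sum z N))
         \<le> norm q ^ N * (B * B * F)"
        using B(1) F F0 by (intro mult_mono) auto
      then show "norm (?r N) \<le> norm q ^ N * (B * B * F)"
        by (simp add: norm_mult norm_divide)
    qed
    have "(\<lambda>N. norm q ^ N * (B * B * F)) \<longlonglongrightarrow> 0 * (B * B * F)"
      using norm_q by (intro tendsto_intros LIMSEQ_power_zero) auto
    then show "(\<lambda>N. norm q ^ N * (B * B * F)) \<longlonglongrightarrow> 0" by simp
  qed
  with lim have "(\<lambda>N. (\<Sum>n\<le>N. ?t n) + ?r N) \<longlonglongrightarrow> (1 - z) * (rank_lambert z q / qpoch_inf q q) + 0"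
    by (rule tendsto_add)
  then have "(\<lambda>N::nat. 1 + q / (1 - q / z) * fine_sum z 0) \<longlonglongrightarrow> (1 - z) * (rank_lambert z q / qpoch_inf q q)"
    unfolding fine_iterate[OF z(1), symmetric] by simp
  then show ?thesis by (simp add: LIMSEQ_const_iff)
qed

text \<open>Group by the largest part l. One copy of it contributes z^(l-1) q^l, being itself one of
  the parts counted with minus sign; every further part x \<le> l contributes q^x / z.\<close>

theorem rank_generating_function:
  assumes z: "norm z = 1" "z \<noteq> 1"
  shows "(\<Sum>\<^sub>\<infinity>P\<in>msets {1..}. z powi rank0 P * q ^ sum_mset P) = (1 - z) * rank_lambert z q / qpoch_inf q q"
proof -
  have z0: "z \<noteq> 0" using z by auto
  let ?f = "\<lambda>P. z powi rank0 P * q ^ sum_mset P"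
  let ?g = "\<lambda>l. if l = 0 then 1 else z ^ (l - 1) * q ^ l / qpoch (q / z) q l"
  have "(?g has_sum infsum ?f (msets {1..})) UNIV"
  proof (rule has_sum_fibers[where key = max_part])
    show "(?f has_sum infsum ?f (msets {1..})) (msets {1..})"
      by (intro has_sum_infsum partitions_summable) (use z in \<open>auto simp: norm_power_int\<close>)
    fix l :: nat
    show "(?f has_sum ?g l) {P \<in> msets {1..}. max_part P = l}"
    proof (cases "l = 0")
      case True
      have e: "{P \<in> msets {1..}. max_part P = l} = {{#}}" unfolding True by (rule max_part_0) simp
      show ?thesis unfolding e by (rule has_sum_finiteI) (auto simp: True rank0_def)
    next
      case False
      then have "1 \<le> l" "(0::nat) < 1" by auto
      note fib = max_part_fiber[OF this]
      let ?w = "\<lambda>x. q ^ x * (if True then 1 / z else 1)"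
      have fin: "((\<lambda>P. \<Prod>x\<in>#P. ?w x) has_sum (\<Prod>x\<in>{1..l}. 1 / (1 - ?w x))) (msets {1..l})"
        by (rule msets_prod_has_sum_finite) (use z norm_power_less_1 in \<open>auto simp: norm_divide norm_power norm_mult\<close>)
      have prod: "(\<Prod>x\<in>{1..l}. 1 / (1 - ?w x)) = 1 / qpoch (q / z) q l"
      proof -
        have "qpoch (q / z) q l = (\<Prod>x\<in>{1..l}. 1 - ?w x)"
          unfolding qpoch_def by (rule prod.reindex_bij_witness[of _ "\<lambda>x. x - 1" Suc]) (auto simp: mult.commute simp flip: power_Suc2)
        then show ?thesis by (simp add: prod_dividef)
      qed
      have "?f (add_mset l P) = z ^ (l - 1) * q ^ l * (\<Prod>x\<in>#P. ?w x)" if "P \<in> msets {1..l}" for P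
      proof -
        have "Max (set_mset (add_mset l P)) = l" using that by (intro Max_eqI) (auto simp: msets_def)
        then have "rank0 (add_mset l P) = int (l - 1) + - int (size P)"
          using False by (simp add: rank0_def rank_def of_nat_diff)
        then have "z powi rank0 (add_mset l P) = z ^ (l - 1) * (1 / z) ^ size P"
          using z0 by (simp only: power_int_add[OF disjI1[OF z0]]) (simp add: power_int_minus power_inverse divide_inverse)
        then show ?thesis unfolding prod_mset_weights by (simp add: power_add mult_ac)
      qed
      then have "((\<lambda>P. ?f (add_mset l P)) has_sum (z ^ (l - 1) * q ^ l * (1 / qpoch (q / z) q l))) (msets {1..l}) \<longleftrightarrow>
        ((\<lambda>P. z ^ (l - 1) * q ^ l * (\<Prod>x\<in>#P. ?w x)) has_sum (z ^ (l - 1) * q ^ l * (1 / qpoch (q / z) q l))) (msets {1..l})"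
        by (rule has_sum_cong)
      moreover have "((\<lambda>P. z ^ (l - 1) * q ^ l * (\<Prod>x\<in>#P. ?w x)) has_sum (z ^ (l - 1) * q ^ l * (1 / qpoch (q / z) q l))) (msets {1..l})"
        using fin unfolding prod by (rule has_sum_cmult_right)
      ultimately have "((\<lambda>P. ?f (add_mset l P)) has_sum ?g l) (msets {1..l})" using False by simp
      then show ?thesis
        unfolding fib by (subst has_sum_reindex) (auto simp: inj_on_def o_def)
    qed
  qed auto
  then have "?g sums infsum ?f (msets {1..})" by (rule has_sum_imp_sums)
  then have "(\<lambda>l. ?g (Suc l)) sums (infsum ?f (msets {1..}) - 1)"
    using sums_Suc_iff[of ?g "infsum ?f (msets {1..}) - 1"] by simp
  moreover have "?g (Suc l) = q / (1 - q / z) * ((z * q ^ Suc 0) ^ l / qpoch (q ^ Suc (Suc 0) / z) q l)" for l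
    using qpoch_unit_nz[of "1 / z" 0] z by (simp add: qpoch_Suc_left power_mult_distrib norm_divide mult_ac)
  moreover have "(\<lambda>l. q / (1 - q / z) * ((z * q ^ Suc 0) ^ l / qpoch (q ^ Suc (Suc 0) / z) q l)) sums (q / (1 - q / z) * fine_sum z 0)"
    unfolding fine_sum_def by (intro sums_mult summable_sums) (use fine_sum_bound z(1) in metis)
  ultimately have "infsum ?f (msets {1..}) - 1 = q / (1 - q / z) * fine_sum z 0"
    using sums_unique2 by simp
  then show ?thesis using fine_sum_rank[OF z] by (simp add: algebra_simps)
qed

text \<open>The series F satisfies (1 - x) F(x) = (1 - a x) F(qx); iterating this towards F(0) = 1
  produces the two infinite products.\<close>

lemma q_binomial:
  assumes t: "norm t < 1"
  shows "(\<lambda>n. qpoch a q n / qpoch q q n * t ^ n) sums (qpoch_inf (a * t) q / qpoch_inf t q)"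
proof -
  let ?c = "\<lambda>n. qpoch a q n / qpoch q q n"
  have "(\<lambda>n. ?c n) \<longlonglongrightarrow> qpoch_inf a q / qpoch_inf q q"
    by (intro tendsto_divide qpoch_tendsto) simp
  then have "Bseq ?c" by (intro convergent_imp_Bseq) (auto simp: convergent_def)
  then obtain K where K: "K > 0" "\<And>n. norm (?c n) \<le> K" by (auto simp: Bseq_def)
  have bd: "norm (?c n * x ^ n) \<le> K * norm x ^ n" for n x
    unfolding norm_mult norm_power by (intro mult_right_mono K) auto
  have sK: "summable (\<lambda>n. K * norm x ^ n)" if "norm x < 1" for x :: complex
    using that by (intro summable_mult summable_geometric) auto
  have sm: "summable (\<lambda>n. ?c n * x ^ n)" if "norm x < 1" for x
    by (rule summable_comparison_test'[OF sK[OF that]]) (rule bd)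
  define F where "F x = (\<Sum>n. ?c n * x ^ n)" for x
  have Fs: "(\<lambda>n. ?c n * x ^ n) sums F x" if "norm x < 1" for x
    unfolding F_def by (rule summable_sums[OF sm[OF that]])
  have step: "(1 - x) * F x = (1 - a * x) * F (q * x)" if x: "norm x < 1" for x
  proof -
    have qx: "norm (q * x) < 1"
      using x norm_q mult_strict_mono'[of "norm q" 1 "norm x" 1] by (simp add: norm_mult)
    have "(\<lambda>n. ?c n * x ^ n - ?c n * (q * x) ^ n) sums (F x - F (q * x))"
      by (intro sums_diff Fs x qx)
    then have "(\<lambda>n. ?c (Suc n) * x ^ Suc n - ?c (Suc n) * (q * x) ^ Suc n) sums (F x - F (q * x))"
      using sums_Suc_iff[of "\<lambda>n. ?c n * x ^ n - ?c n * (q * x) ^ n" "F x - F (q * x)"] by simp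
    moreover have "?c (Suc n) * x ^ Suc n - ?c (Suc n) * (q * x) ^ Suc n = x * (?c n * x ^ n) - a * x * (?c n * (q * x) ^ n)" for n
    proof -
      have nz: "1 - q ^ Suc n \<noteq> 0" using power_neq_1[of "Suc n"] by auto
      have "?c (Suc n) = ?c n * (1 - q ^ n * a) / (1 - q ^ Suc n)"
        by (simp add: qpoch_Suc mult_ac)
      then have c: "?c (Suc n) * (1 - q ^ Suc n) = ?c n * (1 - q ^ n * a)"
        using nz by simp
      have "C * x ^ Suc n - C * (q * x) ^ Suc n = C * (1 - q ^ Suc n) * x ^ Suc n" for C
        by (simp add: power_mult_distrib algebra_simps)
      then have "?c (Suc n) * x ^ Suc n - ?c (Suc n) * (q * x) ^ Suc n = ?c (Suc n) * (1 - q ^ Suc n) * x ^ Suc n" .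
      also have "\<dots> = x * (?c n * x ^ n) - a * x * (?c n * (q * x) ^ n)"
        unfolding c by (simp add: power_mult_distrib algebra_simps diff_divide_distrib)
      finally show ?thesis .
    qed
    moreover have "(\<lambda>n. x * (?c n * x ^ n) - a * x * (?c n * (q * x) ^ n)) sums (x * F x - a * x * F (q * x))"
      by (intro sums_diff sums_mult Fs x qx)
    ultimately have "F x - F (q * x) = x * F x - a * x * F (q * x)"
      using sums_unique2 by simp
    then show ?thesis by (simp add: algebra_simps)
  qed
  have tq: "norm (q ^ N * t) < 1" for N
  proof -
    have "norm q ^ N * norm t \<le> norm t" using norm_q by (simp add: mult_left_le_one_le power_le_one)
    then show ?thesis using t by (simp add: norm_mult norm_power)
  qed
  have iter: "qpoch t q N * F t = qpoch (a * t) q N * F (q ^ N * t)" for N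
  proof (induction N)
    case (Suc N)
    have "qpoch t q (Suc N) * F t = (1 - q ^ N * t) * (qpoch t q N * F t)" by (simp add: qpoch_Suc mult_ac)
    also have "\<dots> = qpoch (a * t) q N * ((1 - q ^ N * t) * F (q ^ N * t))" unfolding Suc by simp
    also have "\<dots> = qpoch (a * t) q (Suc N) * F (q ^ Suc N * t)"
      unfolding step[OF tq] by (simp add: qpoch_Suc mult_ac)
    finally show ?case .
  qed simp
  have "(\<lambda>N. F (q ^ N * t)) \<longlonglongrightarrow> 1"
  proof -
    have "(\<lambda>N. \<Sum>\<^sub>\<infinity>n. ?c n * (q ^ N * t) ^ n) \<longlonglongrightarrow> (\<Sum>\<^sub>\<infinity>n::nat. if n = 0 then 1 else 0)"
    proof (rule infsum_tendsto_dominated)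
      show "norm (?c n * (q ^ N * t) ^ n) \<le> K * norm t ^ n" for n N
      proof -
        have "norm (q ^ N * t) \<le> norm t"
          using norm_q by (simp add: norm_mult norm_power mult_left_le_one_le power_le_one)
        then have "K * norm (q ^ N * t) ^ n \<le> K * norm t ^ n"
          using K by (intro mult_left_mono power_mono) auto
        then show ?thesis using bd[of n "q ^ N * t"] by linarith
      qed
      show "(\<lambda>n. K * norm t ^ n) summable_on UNIV"
        using sK[OF t] K by (intro summable_nonneg_imp_summable_on) auto
      fix n :: nat
      show "(\<lambda>N. ?c n * (q ^ N * t) ^ n) \<longlonglongrightarrow> (if n = 0 then 1 else 0)"
      proof (cases "n = 0")
        case False
        have "(\<lambda>N. ?c n * (q ^ N * t) ^ n) \<longlonglongrightarrow> ?c n * (0 * t) ^ n"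
          using norm_q by (intro tendsto_intros LIMSEQ_power_zero) auto
        moreover have "?c n * (0 * t) ^ n = 0" using False by simp
        ultimately show ?thesis using False by (simp only: if_False)
      qed simp
    qed
    moreover have "(\<Sum>\<^sub>\<infinity>n. ?c n * (q ^ N * t) ^ n) = F (q ^ N * t)" for N
    proof (rule infsumI, rule norm_summable_imp_has_sum)
      show "summable (\<lambda>n. norm (?c n * (q ^ N * t) ^ n))"
        by (rule summable_comparison_test'[OF sK[OF tq[of N]]]) (use bd in auto)
      show "(\<lambda>n. ?c n * (q ^ N * t) ^ n) sums F (q ^ N * t)" by (rule Fs[OF tq])
    qed
    moreover have "(\<Sum>\<^sub>\<infinity>n::nat. if n = 0 then 1 else 0 :: complex) = 1"
      by (rule infsumI, rule has_sum_finite_neutralI[of "{0}"]) auto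
    ultimately show ?thesis by simp
  qed
  then have "(\<lambda>N. qpoch (a * t) q N * F (q ^ N * t)) \<longlonglongrightarrow> qpoch_inf (a * t) q * 1"
    by (intro tendsto_mult qpoch_tendsto)
  moreover have "(\<lambda>N. qpoch t q N * F t) \<longlonglongrightarrow> qpoch_inf t q * F t"
    by (intro tendsto_mult qpoch_tendsto tendsto_const)
  ultimately have "qpoch_inf t q * F t = qpoch_inf (a * t) q"
    unfolding iter using LIMSEQ_unique by fastforce
  moreover have "qpoch_inf t q \<noteq> 0"
  proof
    assume "qpoch_inf t q = 0"
    then obtain i where "q ^ i * t = 1" by (auto simp: qpoch_inf_eq_0_iff)
    then show False using tq[of i] by simp
  qed
  ultimately have "F t = qpoch_inf (a * t) q / qpoch_inf t q" by (simp add: field_simps)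
  then show ?thesis using Fs[OF t] by simp
qed

end

context nome
begin

section \<open>The crank: classification by the number of ones\<close>

lemma prod_from_2:
  assumes "w \<ge> 1"
  shows "(\<Prod>x\<in>{2..w}. 1 / (1 - q ^ x)) = (1 - q) / qpoch q q w"
  using assms
proof (induction w rule: nat_induct_at_least)
  case base
  then show ?case using power_neq_1[of 1] by (simp add: qpoch_Suc)
next
  case (Suc w)
  then show ?case by (simp add: qpoch_Suc prod.nat_ivl_Suc' mult.commute)
qed

text \<open>Without ones the crank is the largest part. Compared with 1 - q times the case a = 0 of
  \<open>q_binomial\<close>, only two terms deviate: l = 0 gives 1 instead of 1 - q, and l = 1 gives
  0 instead of z q. Hence the correction q - z q.\<close>

lemma crank_fiber_0:
  assumes z: "norm z = 1"
  shows "(\<Sum>\<^sub>\<infinity>P\<in>msets {2..}. z ^ max_part P * q ^ sum_mset P) = (1 - q) / qpoch_inf (z * q) q + q - z * q"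
proof -
  let ?f = "\<lambda>P. z ^ max_part P * q ^ sum_mset P"
  let ?c = "\<lambda>l. (1 - q) * (qpoch 0 q l / qpoch q q l * (z * q) ^ l)"
  let ?g = "\<lambda>l. if l = 0 then 1 else if l = 1 then 0 else ?c l"
  have 0: "qpoch 0 q l = 1" for l by (simp add: qpoch_def)
  have q1: "1 - q \<noteq> 0" using power_neq_1[of 1] by simp
  have "(?g has_sum infsum ?f (msets {2..})) UNIV"
  proof (rule has_sum_fibers[where key = max_part])
    show "(?f has_sum infsum ?f (msets {2..})) (msets {2..})"
      by (intro has_sum_infsum partitions_summable) (use z in \<open>auto simp: norm_power\<close>)
    fix l :: nat
    consider "l = 0" | "l = 1" | "l \<ge> 2" by linarith
    then show "(?f has_sum ?g l) {P \<in> msets {2..}. max_part P = l}"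
    proof cases
      case 1
      have e: "{P \<in> msets {2..}. max_part P = l} = {{#}}" unfolding 1 by (rule max_part_0) simp
      show ?thesis unfolding e using has_sum_finite[of "{{#}}" ?f] by (simp add: 1 max_part_def)
    next
      case 2
      have e: "{P \<in> msets {2..}. max_part P = l} = {}"
      proof -
        have "2 \<le> max_part P" if "P \<in> msets {2..}" "P \<noteq> {#}" for P
          using that Max_in[of "set_mset P"] by (auto simp: msets_def max_part_def simp del: Max_in)
        then show ?thesis using 2 by (fastforce simp: max_part_def)
      qed
      show ?thesis unfolding e by (simp add: 2)
    next
      case 3
      note fib = max_part_fiber[OF 3, of, simplified]
      let ?w = "\<lambda>x. q ^ x * (if True then 1 else 1)"
      have fin: "((\<lambda>P. \<Prod>x\<in>#P. ?w x) has_sum (\<Prod>x\<in>{2..l}. 1 / (1 - ?w x))) (msets {2..l})"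
        by (rule msets_prod_has_sum_finite) (use norm_power_less_1 in \<open>auto simp: norm_power\<close>)
      have prod: "(\<Prod>x\<in>{2..l}. 1 / (1 - ?w x)) = (1 - q) / qpoch q q l"
        using prod_from_2[of l] 3 by simp
      have "?f (add_mset l P) = z ^ l * q ^ l * (\<Prod>x\<in>#P. ?w x)" if "P \<in> msets {2..l}" for P
      proof -
        have "Max (set_mset (add_mset l P)) = l" using that by (intro Max_eqI) (auto simp: msets_def)
        then have "max_part (add_mset l P) = l" by (simp add: max_part_def)
        then show ?thesis unfolding prod_mset_weights by (simp add: power_add mult_ac)
      qed
      then have "((\<lambda>P. ?f (add_mset l P)) has_sum (z ^ l * q ^ l * ((1 - q) / qpoch q q l))) (msets {2..l}) \<longleftrightarrow>
        ((\<lambda>P. z ^ l * q ^ l * (\<Prod>x\<in>#P. ?w x)) has_sum (z ^ l * q ^ l * ((1 - q) / qpoch q q l))) (msets {2..l})"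
        by (rule has_sum_cong)
      moreover have "((\<lambda>P. z ^ l * q ^ l * (\<Prod>x\<in>#P. ?w x)) has_sum (z ^ l * q ^ l * ((1 - q) / qpoch q q l))) (msets {2..l})"
        using fin unfolding prod by (rule has_sum_cmult_right)
      moreover have "z ^ l * q ^ l * ((1 - q) / qpoch q q l) = ?g l"
        using 3 by (simp add: 0 power_mult_distrib)
      ultimately have "((\<lambda>P. ?f (add_mset l P)) has_sum ?g l) (msets {2..l})" by simp
      then show ?thesis
        unfolding fib by (subst has_sum_reindex) (auto simp: inj_on_def o_def)
    qed
  qed auto
  then have g: "?g sums infsum ?f (msets {2..})" by (rule has_sum_imp_sums)
  have zq: "norm (z * q) < 1" using z norm_q by (simp add: norm_mult)
  have "?c sums ((1 - q) * (qpoch_inf (0 * (z * q)) q / qpoch_inf (z * q) q))"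
    by (intro sums_mult q_binomial zq)
  moreover have "qpoch_inf (0 * (z * q)) q = 1" by (simp add: qpoch_inf_def)
  ultimately have c: "?c sums ((1 - q) / qpoch_inf (z * q) q)" by simp
  have "(\<lambda>l. ?g l - ?c l) sums (\<Sum>l\<in>{0, 1}. ?g l - ?c l)"
    by (rule sums_finite) auto
  moreover have "(\<Sum>l\<in>{0, 1}. ?g l - ?c l) = q - z * q"
    using q1 by (simp add: qpoch_Suc)
  ultimately have "q - z * q = infsum ?f (msets {2..}) - (1 - q) / qpoch_inf (z * q) q"
    using sums_unique2[OF _ sums_diff[OF g c]] by auto
  then show ?thesis by (simp add: algebra_simps)
qed

text \<open>The w ones contribute (q/z)^w, a part x with 2 \<le> x \<le> w contributes q^x, and a
  part x > w contributes z q^x.\<close>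

lemma crank_fiber:
  assumes z: "norm z = 1" and w: "w \<ge> 1"
  shows "((\<lambda>P. z powi crank0 P * q ^ sum_mset P) has_sum
    ((1 - q) / qpoch_inf (z * q) q * (qpoch (z * q) q w / qpoch q q w * (q / z) ^ w)))
    {P \<in> msets {1..}. count P 1 = w}"
proof -
  have z0: "z \<noteq> 0" using z by auto
  let ?f = "\<lambda>P. z powi crank0 P * q ^ sum_mset P"
  let ?w = "\<lambda>x. q ^ x * (if w < x then z else 1)"
  let ?L = "(1 - q) / qpoch q q w * qpoch (z * q) q w / qpoch_inf (z * q) q"
  have nz: "qpoch (z * q) q N \<noteq> 0" for N
    using qpoch_unit_nz[of z] z by (auto simp: qpoch_def mult_ac)
  have prod: "(\<Prod>x\<in>{2..N}. 1 / (1 - ?w x)) = (1 - q) / qpoch q q w * qpoch (z * q) q w / qpoch (z * q) q N" if "N \<ge> w" for N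
    using that
  proof (induction N rule: nat_induct_at_least)
    case base
    have "(\<Prod>x\<in>{2..w}. 1 / (1 - ?w x)) = (\<Prod>x\<in>{2..w}. 1 / (1 - q ^ x))" by (rule prod.cong) auto
    then show ?case using nz prod_from_2[OF w] by simp
  next
    case (Suc N)
    then show ?case using w by (simp add: qpoch_Suc prod.nat_ivl_Suc' mult_ac)
  qed
  have "((\<lambda>P. \<Prod>x\<in>#P. ?w x) has_sum ?L) (msets {2..})"
  proof (rule msets_prod_has_sum)
    show "(\<lambda>N. \<Prod>x\<in>{2..} \<inter> {..N}. 1 / (1 - ?w x)) \<longlonglongrightarrow> ?L"
    proof (rule Lim_transform_eventually)
      show "(\<lambda>N. (1 - q) / qpoch q q w * qpoch (z * q) q w / qpoch (z * q) q N) \<longlonglongrightarrow> ?L"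
      proof (intro tendsto_divide tendsto_const qpoch_tendsto)
        show "qpoch_inf (z * q) q \<noteq> 0"
          using qpoch_unit_nz[of z] z by (auto simp: qpoch_inf_eq_0_iff mult_ac)
      qed
      have "{2..} \<inter> {..N} = {2..N}" for N :: nat by auto
      then show "\<forall>\<^sub>F N in sequentially. (1 - q) / qpoch q q w * qpoch (z * q) q w / qpoch (z * q) q N = (\<Prod>x\<in>{2..} \<inter> {..N}. 1 / (1 - ?w x))"
        using prod unfolding eventually_sequentially by metis
    qed
  qed (use z in \<open>auto simp: norm_mult norm_power\<close>)
  then have 1: "((\<lambda>P. (q / z) ^ w * (\<Prod>x\<in>#P. ?w x)) has_sum ((q / z) ^ w * ?L)) (msets {2..})"
    by (rule has_sum_cmult_right)
  have bij: "bij_betw (\<lambda>P. replicate_mset w 1 + P) (msets {2..}) {P \<in> msets {1..}. count P 1 = w}"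
  proof (rule bij_betwI[of _ _ _ "\<lambda>P. P - replicate_mset w 1"])
    show "(\<lambda>P. replicate_mset w 1 + P) \<in> msets {2..} \<rightarrow> {P \<in> msets {1..}. count P 1 = w}"
    proof
      fix P :: "nat multiset" assume P: "P \<in> msets {2..}"
      have "1 \<notin># P" using P by (auto simp: msets_def)
      moreover have "set_mset P \<subseteq> {1..}" using P by (force simp: msets_def)
      ultimately show "replicate_mset w 1 + P \<in> {P \<in> msets {1..}. count P 1 = w}"
        using w by (simp add: msets_def count_eq_zero_iff)
    qed
    show "(\<lambda>P. P - replicate_mset w 1) \<in> {P \<in> msets {1..}. count P 1 = w} \<rightarrow> msets {2..}"
    proof
      fix P :: "nat multiset" assume P: "P \<in> {P \<in> msets {1..}. count P 1 = w}"
      have "2 \<le> x" if "x \<in># P - replicate_mset w 1" for x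
      proof -
        have "x \<in># P" using that by (rule in_diffD)
        then have "1 \<le> x" using P by (auto simp: msets_def)
        moreover have "x \<noteq> 1" using that P by (auto simp: in_diff_count)
        ultimately show ?thesis by simp
      qed
      then show "P - replicate_mset w 1 \<in> msets {2..}" by (auto simp: msets_def)
    qed
    fix P :: "nat multiset" assume P: "P \<in> {P \<in> msets {1..}. count P 1 = w}"
    then have "replicate_mset w 1 \<subseteq># P" by (simp add: count_le_replicate_mset_subset_eq[symmetric])
    then show "replicate_mset w 1 + (P - replicate_mset w 1) = P" by simp
  qed auto
  have "?f (replicate_mset w 1 + P) = (q / z) ^ w * (\<Prod>x\<in>#P. ?w x)" if "P \<in> msets {2..}" for P
  proof -
    have c: "count P 1 = 0" using that by (auto simp: msets_def count_eq_zero_iff)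
    have "filter_mset (\<lambda>x. w < x) (replicate_mset w 1) = {#}" using w by (auto simp: filter_mset_eq_conv)
    then have "crank0 (replicate_mset w 1 + P) = int (size (filter_mset (\<lambda>x. w < x) P)) + - int w"
      using c w by (simp add: crank0_def crank_def Let_def)
    then have "z powi crank0 (replicate_mset w 1 + P) = z ^ size (filter_mset (\<lambda>x. w < x) P) * (1 / z) ^ w"
      using z0 by (simp only: power_int_add[OF disjI1[OF z0]]) (simp add: power_int_minus power_inverse divide_inverse)
    then show ?thesis unfolding prod_mset_weights by (simp add: power_add power_divide sum_mset_replicate_mset mult_ac)
  qed
  then have "((\<lambda>P. ?f (replicate_mset w 1 + P)) has_sum ((q / z) ^ w * ?L)) (msets {2..})"
    using 1 by (subst has_sum_cong)
  then have "(?f has_sum ((q / z) ^ w * ?L)) {P \<in> msets {1..}. count P 1 = w}"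
    using has_sum_reindex_bij_betw[OF bij, of ?f] by blast
  then show ?thesis by (simp add: mult_ac)
qed

text \<open>Summing over the number w of ones is \<open>q_binomial\<close> with a = z q and t = q/z,
  where a t = q^2. The extra (z - 1) q accounts for n = 1: the only partition has crank -1, whereas
  the product has the coefficient z + 1/z - 1.\<close>

theorem crank_generating_function:
  assumes z: "norm z = 1"
  shows "(\<Sum>\<^sub>\<infinity>P\<in>msets {1..}. z powi crank0 P * q ^ sum_mset P) + (z - 1) * q
    = qpoch_inf q q / (qpoch_inf (z * q) q * qpoch_inf (q / z) q)"
proof -
  have z0: "z \<noteq> 0" using z by auto
  let ?f = "\<lambda>P. z powi crank0 P * q ^ sum_mset P"
  let ?G = "\<lambda>w. (1 - q) / qpoch_inf (z * q) q * (qpoch (z * q) q w / qpoch q q w * (q / z) ^ w)"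
  let ?g = "\<lambda>w. if w = 0 then infsum ?f (msets {2..}) else ?G w"
  have sm: "?f summable_on msets A" if "A \<subseteq> {1..}" for A
    by (rule partitions_summable) (use z that in \<open>auto simp: norm_power_int\<close>)
  have f0: "infsum ?f (msets {2..}) = (1 - q) / qpoch_inf (z * q) q + q - z * q"
  proof -
    have "?f P = z ^ max_part P * q ^ sum_mset P" if "P \<in> msets {2..}" for P
    proof -
      have "count P 1 = 0" using that by (auto simp: msets_def count_eq_zero_iff)
      then show ?thesis by (simp add: crank0_def crank_def max_part_def)
    qed
    then have "infsum ?f (msets {2..}) = (\<Sum>\<^sub>\<infinity>P\<in>msets {2..}. z ^ max_part P * q ^ sum_mset P)"
      by (rule infsum_cong)
    then show ?thesis using crank_fiber_0[OF z] by simp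
  qed
  have "(?g has_sum infsum ?f (msets {1..})) UNIV"
  proof (rule has_sum_fibers[where key = "\<lambda>P. count P 1"])
    show "(?f has_sum infsum ?f (msets {1..})) (msets {1..})"
      by (intro has_sum_infsum sm) auto
    fix w :: nat
    show "(?f has_sum ?g w) {P \<in> msets {1..}. count P 1 = w}"
    proof (cases "w = 0")
      case True
      have "{2..} = {1..} - {1::nat}" by auto
      then have "{P \<in> msets {1..}. count P 1 = w} = msets {2..}"
        unfolding True msets_def count_eq_zero_iff by (simp only: subset_Diff_insert Diff_empty mem_Collect_eq)
      then show ?thesis using True has_sum_infsum[OF sm[of "{2..}"]] by auto
    next
      case False
      then show ?thesis using crank_fiber[OF z, of w] by simp
    qed
  qed auto
  then have g: "?g sums infsum ?f (msets {1..})" by (rule has_sum_imp_sums)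
  have "norm (q / z) < 1" using z norm_q by (simp add: norm_divide)
  then have G: "?G sums ((1 - q) / qpoch_inf (z * q) q * (qpoch_inf (z * q * (q / z)) q / qpoch_inf (q / z) q))"
    by (intro sums_mult q_binomial)
  have "(1 - q) * qpoch_inf (z * q * (q / z)) q = qpoch_inf q q"
    using qpoch_inf_unfold[of q] z0 by simp
  then have val: "(1 - q) / qpoch_inf (z * q) q * (qpoch_inf (z * q * (q / z)) q / qpoch_inf (q / z) q)
    = qpoch_inf q q / (qpoch_inf (z * q) q * qpoch_inf (q / z) q)" by simp
  have "(\<lambda>w. ?g w - ?G w) sums (\<Sum>w\<in>{0}. ?g w - ?G w)"
    by (rule sums_finite) auto
  moreover have "(\<Sum>w\<in>{0}. ?g w - ?G w) = q - z * q"
    using f0 by simp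
  ultimately have "q - z * q = infsum ?f (msets {1..}) - qpoch_inf q q / (qpoch_inf (z * q) q * qpoch_inf (q / z) q)"
    using sums_unique2[OF _ sums_diff[OF g G]] unfolding val by auto
  then show ?thesis by (simp add: algebra_simps)
qed

end

section \<open>Deviations\<close>

lemma partitions_0: "partitions 0 = {{#}}"
proof -
  have "P = {#}" if "P \<in> partitions 0" for P
    using that by (cases P) (auto simp: partitions_def)
  then show ?thesis by (auto simp: partitions_def)
qed

lemma partitions_1: "partitions 1 = {{#1#}}"
proof (intro equalityI subsetI)
  fix P assume P: "P \<in> partitions 1"
  then have "P \<noteq> {#}" by (auto simp: partitions_def)
  then obtain x R where R: "P = add_mset x R" by (meson multiset_cases)
  then have "0 < x" "x + sum_mset R = 1" "\<forall>y\<in>#R. 0 < y" using P by (auto simp: partitions_def)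
  then have "x = 1" "R \<in> partitions 0" by (auto simp: partitions_def simp del: sum_mset_0_iff)
  then show "P \<in> {{#1#}}" using R by (simp add: partitions_0)
qed (auto simp: partitions_def)

lemma sum_card_values:
  assumes "finite A"
  shows "(\<Sum>m\<in>{m. Q m \<and> int (card {P \<in> A. r P = m}) \<noteq> 0}. int (card {P \<in> A. r P = m})) = (\<Sum>P\<in>A. if Q (r P) then 1 else 0)"
proof -
  let ?S = "{P \<in> A. Q (r P)}"
  have fin: "finite {P \<in> A. r P = m}" for m using assms by simp
  have "{m. Q m \<and> int (card {P \<in> A. r P = m}) \<noteq> 0} = r ` ?S"
    using fin by auto
  moreover have "{P \<in> ?S. r P = m} = {P \<in> A. r P = m}" if "m \<in> r ` ?S" for m
    using that by auto
  ultimately have "(\<Sum>m\<in>{m. Q m \<and> int (card {P \<in> A. r P = m}) \<noteq> 0}. int (card {P \<in> A. r P = m})) = (\<Sum>m\<in>r ` ?S. \<Sum>P\<in>{P \<in> ?S. r P = m}. 1)"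
    by simp
  also have "\<dots> = (\<Sum>P\<in>?S. 1)"
    using assms by (intro sum.image_gen[symmetric]) simp
  also have "\<dots> = (\<Sum>P\<in>A. if Q (r P) then 1 else 0)"
    using assms by (simp add: sum.If_cases Int_def)
  finally show ?thesis .
qed

lemma Nrk_rank0: "Nrk m n = int (card {P \<in> partitions n. rank0 P = m})"
proof (cases "n = 0")
  case True
  have "{P \<in> partitions 0. rank0 P = m} = (if m = 0 then {{#}} else {})"
    by (auto simp: partitions_0 rank0_def)
  then show ?thesis using True by (simp add: Nrk_def)
next
  case False
  then have "{P \<in> partitions n. rank0 P = m} = {P \<in> partitions n. rank P = m}"
    by (auto simp: partitions_def rank0_def)
  then show ?thesis using False by (simp add: Nrk_def)
qed

lemma Ccr_crank0: "n \<noteq> 1 \<Longrightarrow> Ccr m n = int (card {P \<in> partitions n. crank0 P = m})"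
proof (cases "n = 0")
  case True
  have "{P \<in> partitions 0. crank0 P = m} = (if m = 0 then {{#}} else {})"
    by (auto simp: partitions_0 crank0_def)
  then show ?thesis using True by (simp add: Ccr_def)
next
  case False
  then have "{P \<in> partitions n. crank0 P = m} = {P \<in> partitions n. crank P = m}"
    by (auto simp: partitions_def crank0_def)
  then show "n \<noteq> 1 \<Longrightarrow> ?thesis" using False by (simp add: Ccr_def)
qed

lemma NrkMod_rank0: "NrkMod a M n = (\<Sum>P\<in>partitions n. if rank0 P mod M = a mod M then 1 else 0)"
  unfolding NrkMod_def Nrk_rank0 by (rule sum_card_values[OF finite_partitions])

text \<open>At n = 1 the combinatorial crank supplies only the value -1; the convention for C(m,1)
  additionally counts +1 at m = 1 and -1 at m = 0.\<close>

lemma CcrMod_crank0: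
  "CcrMod a M n = (\<Sum>P\<in>partitions n. if crank0 P mod M = a mod M then 1 else 0)
    + (if n = 1 then (if 1 mod M = a mod M then 1 else 0) - (if 0 = a mod M then 1 else 0) else 0)"
proof (cases "n = 1")
  case True
  have "CcrMod a M 1 = (\<Sum>m\<in>{m \<in> {1, -1, 0}. m mod M = a mod M}. Ccr m 1)"
    unfolding CcrMod_def by (rule sum.cong) (auto simp: Ccr_def split: if_splits)
  also have "\<dots> = (\<Sum>m\<in>{1, -1, 0}. if m mod M = a mod M then Ccr m 1 else 0)"
    by (rule sum.inter_filter) simp
  finally show ?thesis
    using True by (simp add: partitions_1[simplified] crank0_def crank_def Ccr_def)
next
  case False
  then show ?thesis
    using sum_card_values[OF finite_partitions[of n], of crank0 "\<lambda>m. m mod M = a mod M"]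
    unfolding CcrMod_def Ccr_crank0[OF False] by simp
qed

section \<open>Finite Fourier inversion over the residues modulo 7\<close>

lemma has_sum_finite_sum:
  fixes f :: "'i \<Rightarrow> 'a \<Rightarrow> complex"
  assumes "finite I" "\<And>i. i \<in> I \<Longrightarrow> (f i has_sum s i) A"
  shows "((\<lambda>x. \<Sum>i\<in>I. f i x) has_sum (\<Sum>i\<in>I. s i)) A"
  using assms by (induction I rule: finite_induct) (auto intro: has_sum_add)

text \<open>A nonzero polynomial of degree at most 6 cannot have all seven roots of unity as
  zeros.\<close>

lemma roots_of_unity_unique:
  fixes d :: "nat \<Rightarrow> complex"
  assumes d: "\<And>z. z ^ 7 = 1 \<Longrightarrow> (\<Sum>a<7. d a * z ^ a) = 0" and a: "a < 7"
  shows "d a = 0"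
proof (rule ccontr)
  assume "d a \<noteq> 0"
  then have da: "\<exists>k\<le>6. d k \<noteq> 0" using a by (intro exI[of _ a]) auto
  have "{..<7} = {..6::nat}" by auto
  then have "{z::complex. z ^ 7 = 1} \<subseteq> {z. (\<Sum>i\<le>6. d i * z ^ i) = 0}" using d by auto
  moreover have "finite {z. (\<Sum>i\<le>6. d i * z ^ i) = 0}" "card {z. (\<Sum>i\<le>6. d i * z ^ i) = 0} \<le> 6"
    using polyfun_rootbound[OF da] by auto
  ultimately have "card {z::complex. z ^ 7 = 1} \<le> 6" using card_mono order_trans by blast
  then show False using card_roots_unity_eq[of 7] by simp
qed

lemma sum_7: "(\<Sum>a<7. f a) = f 0 + f 1 + f 2 + f 3 + f 4 + f 5 + f (6::nat)" for f :: "nat \<Rightarrow> complex"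
  by (simp add: eval_nat_numeral)

lemma sum_residues_root:
  fixes z :: complex
  assumes z: "z ^ 7 = 1"
  shows "(\<Sum>a<7. (if m mod 7 = int a mod 7 then 1 else 0) * z ^ a) = z powi m"
proof -
  have z0: "z \<noteq> 0" using z by auto
  have "z powi m = z powi (7 * (m div 7) + m mod 7)" by simp
  also have "\<dots> = (z powi 7) powi (m div 7) * z powi (m mod 7)"
    by (simp only: power_int_add[OF disjI1[OF z0]] power_int_mult)
  also have "z powi 7 = 1" using z by (simp add: power_int_def)
  finally have 1: "z powi m = z ^ nat (m mod 7)"
    by (simp add: power_int_def)
  have "(\<Sum>a<7. (if m mod 7 = int a mod 7 then 1 else 0) * z ^ a) = (\<Sum>a<7. if nat (m mod 7) = a then z ^ a else 0)"
    by (rule sum.cong) auto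
  then show ?thesis unfolding 1 by (simp add: nat_less_iff)
qed

context nome
begin

definition residue_dev :: "(nat multiset \<Rightarrow> int) \<Rightarrow> nat \<Rightarrow> complex" where
  "residue_dev r a = (\<Sum>\<^sub>\<infinity>P\<in>msets {1..}. ((if r P mod 7 = int a mod 7 then 1 else 0) - 1 / 7) * q ^ sum_mset P)"

lemma residue_dev_sums:
  "(\<lambda>n. ((\<Sum>P\<in>partitions n. if r P mod 7 = int a mod 7 then 1 else 0) - of_nat (npart n) / 7) * q ^ n) sums residue_dev r a"
proof -
  have "(\<Sum>P\<in>partitions n. (if r P mod 7 = int a mod 7 then 1 else 0) - 1 / 7 :: complex)
      = (\<Sum>P\<in>partitions n. if r P mod 7 = int a mod 7 then 1 else 0) - of_nat (npart n) / 7" for n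
    by (simp add: sum_subtractf npart_def)
  moreover have "(\<lambda>n. (\<Sum>P\<in>partitions n. (if r P mod 7 = int a mod 7 then 1 else 0) - 1 / 7) * q ^ n) sums residue_dev r a"
    unfolding residue_dev_def by (rule partitions_sums) auto
  ultimately show ?thesis by simp
qed

lemma Dev_residue_dev: "Dev (int a) 7 q = residue_dev rank0 a"
  using residue_dev_sums[of rank0 a]
  by (simp add: Dev_def NrkMod_rank0 sums_iff of_int_sum if_distrib[of of_int] cong: if_cong)

lemma DevC_residue_dev:
  "DevC (int a) 7 q = residue_dev crank0 a + ((if 1 = int a mod 7 then 1 else 0) - (if 0 = int a mod 7 then 1 else 0)) * q"
proof -
  let ?e = "(if 1 = int a mod 7 then 1 else 0) - (if 0 = int a mod 7 then 1 else 0) :: complex"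
  have "(\<lambda>n. if n = 1 then ?e * q ^ n else 0) sums (?e * q ^ 1)" by (rule sums_single)
  from sums_add[OF residue_dev_sums[of crank0 a] this]
  have "(\<lambda>n. (of_int (CcrMod (int a) 7 n) - of_nat (npart n) / 7) * q ^ n) sums (residue_dev crank0 a + ?e * q ^ 1)"
    by (rule sums_cong[THEN iffD1, rotated])
       (auto simp: CcrMod_crank0 of_int_sum if_distrib[of of_int] ring_distribs cong: if_cong)
  then show ?thesis by (simp add: DevC_def sums_iff)
qed

lemma residue_dev_root:
  assumes z: "z ^ 7 = 1"
  shows "(\<Sum>a<7. residue_dev r a * z ^ a) = (if z = 1 then 0 else \<Sum>\<^sub>\<infinity>P\<in>msets {1..}. z powi r P * q ^ sum_mset P)"
proof -
  let ?h = "\<lambda>a P. (if r P mod 7 = int a mod 7 then 1 else 0) - 1 / 7 :: complex"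
  have s: "(\<lambda>P. ?h a P * q ^ sum_mset P) summable_on msets {1..}" for a
    by (rule partitions_summable) auto
  have "(\<Sum>a<7. residue_dev r a * z ^ a) = (\<Sum>a<7. \<Sum>\<^sub>\<infinity>P\<in>msets {1..}. ?h a P * q ^ sum_mset P * z ^ a)"
    unfolding residue_dev_def by (simp add: infsum_cmult_left' del: if_distrib)
  also have "\<dots> = (\<Sum>\<^sub>\<infinity>P\<in>msets {1..}. \<Sum>a<7. ?h a P * q ^ sum_mset P * z ^ a)"
    by (intro infsumI[symmetric] has_sum_finite_sum has_sum_infsum summable_on_cmult_left s) simp
  also have "\<dots> = (\<Sum>\<^sub>\<infinity>P\<in>msets {1..}. (z powi r P - (\<Sum>a<7. z ^ a) / 7) * q ^ sum_mset P)"
  proof (rule infsum_cong)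
    fix P
    have "(\<Sum>a<7. ?h a P * q ^ sum_mset P * z ^ a) = (\<Sum>a<7. ?h a P * z ^ a) * q ^ sum_mset P"
      unfolding sum_distrib_right by (rule sum.cong) (simp_all only: mult_ac)
    also have "(\<Sum>a<7. ?h a P * z ^ a) = z powi r P - (\<Sum>a<7. z ^ a) / 7"
      unfolding left_diff_distrib sum_subtractf sum_residues_root[OF z]
      by (simp add: sum_divide_distrib)
    finally show "(\<Sum>a<7. ?h a P * q ^ sum_mset P * z ^ a) = (z powi r P - (\<Sum>a<7. z ^ a) / 7) * q ^ sum_mset P" .
  qed
  finally have *: "(\<Sum>a<7. residue_dev r a * z ^ a) = (\<Sum>\<^sub>\<infinity>P\<in>msets {1..}. (z powi r P - (\<Sum>a<7. z ^ a) / 7) * q ^ sum_mset P)" .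
  show ?thesis
  proof (cases "z = 1")
    case False
    then have "(\<Sum>a<7. z ^ a) = 0" using z by (simp add: geometric_sum)
    then show ?thesis using * False by simp
  next
    case True
    then show ?thesis unfolding * by simp
  qed
qed

lemma norm_root: "z ^ 7 = 1 \<Longrightarrow> norm z = 1" for z :: complex
  using norm_power[of z 7] power_eq_1_iff[of "norm z" 7] by simp

lemma Dev_values:
  "Dev (int a) 7 q = [2 * theta7 (- 4) 3 (- 1) 2 1 (- 2) q + 2 * G7 1 0 0 q,
     theta7 6 (- 1) 5 (- 3) 2 3 q + G7 (- 1) 1 0 q,
     theta7 (- 1) (- 1) (- 2) 4 (- 5) 3 q + G7 0 (- 1) 1 q,
     theta7 (- 1) (- 1) (- 2) (- 3) 2 (- 4) q + G7 0 0 (- 1) q,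
     theta7 (- 1) (- 1) (- 2) (- 3) 2 (- 4) q + G7 0 0 (- 1) q,
     theta7 (- 1) (- 1) (- 2) 4 (- 5) 3 q + G7 0 (- 1) 1 q,
     theta7 6 (- 1) 5 (- 3) 2 3 q + G7 (- 1) 1 0 q] ! a" (is "_ = ?R ! a") if "a < 7"
proof -
  have "Dev (int a) 7 q - ?R ! a = 0"
  proof (rule roots_of_unity_unique[OF _ that])
    fix z :: complex assume z: "z ^ 7 = 1"
    have L: "(\<Sum>a<7. Dev (int a) 7 q * z ^ a) = (if z = 1 then 0 else (1 - z) * rank_lambert z q / qpoch_inf q q)"
      using residue_dev_root[OF z, of rank0] rank_generating_function[OF norm_root[OF z]]
      by (simp add: Dev_residue_dev)
    have "(\<Sum>a<7. ?R ! a * z ^ a) = (if z = 1 then 0 else (1 - z) * rank_lambert z q / qpoch_inf q q)"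
    proof (cases "z = 1")
      case True
      have "(\<Sum>a<7. ?R ! a * z ^ a) = 2 * (theta7 (- 4) 3 (- 1) 2 1 (- 2) q + G7 1 0 0 q + theta7 6 (- 1) 5 (- 3) 2 3 q + G7 (- 1) 1 0 q
        + theta7 (- 1) (- 1) (- 2) 4 (- 5) 3 q + G7 0 (- 1) 1 q + theta7 (- 1) (- 1) (- 2) (- 3) 2 (- 4) q + G7 0 0 (- 1) q)"
        unfolding sum_7 True by (simp add: eval_nat_numeral del: power_Suc)
      \<comment> \<open>In every argument position of \<open>theta7\<close> and of \<open>G7\<close>
        the four coefficients add up to 0.\<close>
      also have "\<dots> = 0" unfolding theta7_def G7_def by algebra
      finally show ?thesis using True by simp
    next
      case False
      show ?thesis unfolding if_not_P[OF False] rank_root[OF z False] sum_7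
        by (simp add: algebra_simps)
    qed
    then show "(\<Sum>a<7. (Dev (int a) 7 q - ?R ! a) * z ^ a) = 0"
      using L by (simp only: left_diff_distrib sum_subtractf)  simp
  qed
  then show ?thesis by simp
qed

lemma DevC_values:
  "DevC (int a) 7 q = [2 * theta7 3 (- 4) (- 1) 2 1 (- 2) q,
     theta7 (- 1) 6 (- 2) (- 3) (- 5) 3 q,
     theta7 (- 1) (- 1) 5 (- 3) 2 (- 4) q,
     theta7 (- 1) (- 1) (- 2) 4 2 3 q,
     theta7 (- 1) (- 1) (- 2) 4 2 3 q,
     theta7 (- 1) (- 1) 5 (- 3) 2 (- 4) q,
     theta7 (- 1) 6 (- 2) (- 3) (- 5) 3 q] ! a" (is "_ = ?R ! a") if "a < 7"
proof -
  have "DevC (int a) 7 q - ?R ! a = 0"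
  proof (rule roots_of_unity_unique[OF _ that])
    fix z :: complex assume z: "z ^ 7 = 1"
    let ?gf = "qpoch_inf q q / (qpoch_inf (z * q) q * qpoch_inf (q / z) q)"
    have L: "(\<Sum>a<7. DevC (int a) 7 q * z ^ a) = (if z = 1 then 0 else ?gf)"
    proof -
      have "(\<Sum>a<7. DevC (int a) 7 q * z ^ a) = (\<Sum>a<7. residue_dev crank0 a * z ^ a)
         + (\<Sum>a<7. ((if 1 = int a mod 7 then 1 else 0) - (if 0 = int a mod 7 then 1 else 0)) * q * z ^ a)"
        unfolding DevC_residue_dev distrib_right sum.distrib ..
      also have "(\<Sum>a<7. ((if 1 = int a mod 7 then 1 else 0) - (if 0 = int a mod 7 then 1 else 0)) * q * z ^ a) = (z - 1) * q"
        unfolding sum_7 by (simp add: algebra_simps)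
      finally show ?thesis
        using residue_dev_root[OF z, of crank0] crank_generating_function[OF norm_root[OF z]] by simp
    qed
    have "(\<Sum>a<7. ?R ! a * z ^ a) = (if z = 1 then 0 else ?gf)"
    proof (cases "z = 1")
      case True
      have "(\<Sum>a<7. ?R ! a * z ^ a) = 2 * (theta7 3 (- 4) (- 1) 2 1 (- 2) q + theta7 (- 1) 6 (- 2) (- 3) (- 5) 3 q
        + theta7 (- 1) (- 1) 5 (- 3) 2 (- 4) q + theta7 (- 1) (- 1) (- 2) 4 2 3 q)"
        unfolding sum_7 True by (simp add: eval_nat_numeral del: power_Suc)
      also have "\<dots> = 0" unfolding theta7_def by algebra
      finally show ?thesis using True by simp
    next
      case False
      show ?thesis unfolding if_not_P[OF False] crank_root[OF z False] sum_7
        by (simp add: algebra_simps)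
    qed
    then show "(\<Sum>a<7. (DevC (int a) 7 q - ?R ! a) * z ^ a) = 0"
      using L by (simp only: left_diff_distrib sum_subtractf) simp
  qed
  then show ?thesis by simp
qed

end

theorem theorem8p2:
  fixes q :: complex
  assumes "0 < norm q" and "norm q < 1"
  shows "Dev 0 7 q = 2 * theta7 (-4) 3 (-1) 2 1 (-2) q + 2 * G7 1 0 0 q
    \<and> Dev 1 7 q = theta7 6 (-1) 5 (-3) 2 3 q + G7 (-1) 1 0 q
    \<and> Dev 6 7 q = theta7 6 (-1) 5 (-3) 2 3 q + G7 (-1) 1 0 q
    \<and> Dev 2 7 q = theta7 (-1) (-1) (-2) 4 (-5) 3 q + G7 0 (-1) 1 q
    \<and> Dev 5 7 q = theta7 (-1) (-1) (-2) 4 (-5) 3 q + G7 0 (-1) 1 q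
    \<and> Dev 3 7 q = theta7 (-1) (-1) (-2) (-3) 2 (-4) q + G7 0 0 (-1) q
    \<and> Dev 4 7 q = theta7 (-1) (-1) (-2) (-3) 2 (-4) q + G7 0 0 (-1) q
    \<and> DevC 0 7 q = 2 * theta7 3 (-4) (-1) 2 1 (-2) q
    \<and> DevC 1 7 q = theta7 (-1) 6 (-2) (-3) (-5) 3 q
    \<and> DevC 6 7 q = theta7 (-1) 6 (-2) (-3) (-5) 3 q
    \<and> DevC 2 7 q = theta7 (-1) (-1) 5 (-3) 2 (-4) q
    \<and> DevC 5 7 q = theta7 (-1) (-1) 5 (-3) 2 (-4) q
    \<and> DevC 3 7 q = theta7 (-1) (-1) (-2) 4 2 3 q
    \<and> DevC 4 7 q = theta7 (-1) (-1) (-2) 4 2 3 q"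
proof -
  interpret nome q by unfold_locales (use assms in auto)
  show ?thesis
    using Dev_values[of 0] Dev_values[of 1] Dev_values[of 2] Dev_values[of 3] Dev_values[of 4] Dev_values[of 5] Dev_values[of 6]
      DevC_values[of 0] DevC_values[of 1] DevC_values[of 2] DevC_values[of 3] DevC_values[of 4] DevC_values[of 5] DevC_values[of 6]
    by simp
qed

end
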